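(* Let $r\ge 2$ be an integer, let $1\le\rho_0<\infty$ and let $0\le\sigma_0\le\infty$. Then there exists a function $G\in PF_r$, analytic in $\overline{\mathbb C}\setminus\{1\}$ and possessing an essential singularity at $z=1$, such that $$\limsup_{y\to 1^-}\frac{\log\log M(y,G)}{\log\log(1/(1-y))}=\rho_0$$ and, if $\rho_0>1$, also such that $$\limsup_{y\to 1^-}\frac{\log M(y,G)}{\left(\log(1/(1-y))\right)^{\rho_0}}=\sigma_0.$$
   Context: For $r\in\mathbb N$, a real sequence $\{a_k\}_{k=0}^\infty$ belongs to $PF_r$ if all minors of order $\le r$ of the infinite upper triangular Toeplitz matrix $(a_{j-i})_{i,j\ge 0}$ (with $a_m:=0$ for $m<0$) are non-negative. The generating function $\sum_{k\ge0}a_kz^k$ of such a sequence is also said to belong to $PF_r$. For $G$ analytic in $\mathbb D=\{|z|<1\}$, $M(y,G)=\max_{|z|=y}|G(z)|$, $0<y<1$. $\overline{\mathbb C}$ is the extended complex plane. *)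

theory Defs
  imports "HOL-Complex_Analysis.Complex_Analysis" "Jordan_Normal_Form.Determinant"
begin

definition toeplitz_entry :: "(nat \<Rightarrow> real) \<Rightarrow> nat \<Rightarrow> nat \<Rightarrow> real" where
  "toeplitz_entry a i j = (if i \<le> j then a (j - i) else 0)"

text \<open>A minor of order \<open>k\<close> of the infinite Toeplitz matrix is given by \<open>k\<close> rows \<open>I\<close> and
  \<open>k\<close> columns \<open>J\<close>, both listed increasingly.  The empty minor \<open>k = 0\<close> equals \<open>1\<close> and
  imposes no condition.\<close>

definition PF_seq :: "nat \<Rightarrow> (nat \<Rightarrow> real) \<Rightarrow> bool" where
  "PF_seq r a \<longleftrightarrow>
     (\<forall>k \<le> r. \<forall>I J :: nat \<Rightarrow> nat.
        strict_mono_on {..<k} I \<longrightarrow> strict_mono_on {..<k} J \<longrightarrow>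
        Determinant.det (Matrix.mat k k (\<lambda>(p, q). toeplitz_entry a (I p) (J q))) \<ge> 0)"

definition PF_fun :: "nat \<Rightarrow> (complex \<Rightarrow> complex) \<Rightarrow> bool" where
  "PF_fun r G \<longleftrightarrow>
     (\<exists>a. PF_seq r a \<and> G has_fps_expansion Abs_fps (\<lambda>k. complex_of_real (a k)))"

text \<open>The value at infinity is not part of \<open>f\<close>; it is the value at \<open>0\<close> of the analytic
  function \<open>g\<close> that continues \<open>f (1/z)\<close>.\<close>

definition analytic_at_inf :: "(complex \<Rightarrow> complex) \<Rightarrow> bool" where
  "analytic_at_inf f \<longleftrightarrow>
     (\<exists>g. g analytic_on {0} \<and> (\<forall>\<^sub>F z in at 0. f (1 / z) = g z))"

definition essential_singularity_at :: "(complex \<Rightarrow> complex) \<Rightarrow> complex \<Rightarrow> bool" where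
  "essential_singularity_at f z \<longleftrightarrow> isolated_singularity_at f z \<and> \<not> not_essential f z"

text \<open>For \<open>G\<close> continuous on the circle, which is compact, the supremum is a maximum.\<close>

definition max_modulus :: "real \<Rightarrow> (complex \<Rightarrow> complex) \<Rightarrow> real" where
  "max_modulus y G = (SUP z\<in>sphere 0 y. norm (G z))"

end

theory Submission
  imports Defs "HOL-Real_Asymp.Real_Asymp"
begin

text \<open>
  The function is constructed from its coefficients,
  \<open>a k = (\<Prod>i. (1 + k / exp i) ^ M i)\<close>, with suitable multiplicities \<open>M i\<close>.

  \<^emph>\<open>Singularity.\<close>  A product of factors \<open>1 + \<epsilon> k\<close> with \<open>\<epsilon> \<ge> 0\<close> has a Newton expansion
  \<open>a k = (\<Sum>n. b n * (k choose n))\<close> with \<open>b n \<ge> 0\<close>.  As \<open>(\<Sum>k. (k choose n) z ^ k) = z ^ n / (1 - z) ^ (n + 1)\<close>, the generating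
  function equals \<open>w * (\<Sum>n. b n * (w - 1) ^ n)\<close> with \<open>w = 1 / (1 - z)\<close>.  All terms are nonnegative for \<open>0 \<le> z < 1\<close>; hence, if
  \<open>a k\<close> grows subexponentially, the series in \<open>w - 1\<close> converges everywhere and the generating function is an entire
  function of \<open>w\<close>.  It is analytic off \<open>1\<close>, also at infinity, and the singularity is essential as soon as the growth
  exceeds every power of \<open>w\<close> (\<open>PF_fun_with_essential_singularity\<close>).

  \<^emph>\<open>Multiple positivity.\<close>  The product of factors \<open>1 + k / \<xi>\<close> belongs to \<open>PF\<^sub>r\<close> whenever \<open>\<xi> \<ge> 1\<close>, the value \<open>\<xi> = 1\<close> occurs, and every
  zero is repeated at least \<open>m\<close> times, where \<open>m\<close> depends on \<open>r\<close> only (\<open>PF_seq_linear_product\<close>).  By a criterion of Fekete type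
  (\<open>PF_seq_of_solid_minors\<close>), it suffices that the determinants of \<open>a (n + j - i)\<close> of order up to \<open>r\<close> are positive.  After a
  harmless rescaling the entries are values of a Weierstrass product of genus one, at the integers \<open>t = j - i\<close>.  With
  \<open>\<delta>\<^sup>2 = (\<Sum> 1 / (\<xi> + n)\<^sup>2)\<close>, they are close to \<open>exp (- \<delta>\<^sup>2 t\<^sup>2 / 2)\<close>.  For large \<open>\<delta>\<close> the matrix is nearly the identity.  For bounded \<open>\<delta>\<close> the
  repetition of zeros makes the product close to the Gaussian as an entire function, and the Gaussian determinant is a
  Vandermonde determinant; mixed differences show that this comparison survives the degeneration of both determinants
  as \<open>\<delta>\<close> tends to \<open>0\<close> (\<open>fdet_weierstrass_pos\<close>).

  \<^emph>\<open>Growth.\<close>  The coefficients being nonnegative, the maximum modulus at \<open>y\<close> is the sum of the series at \<open>y\<close>.  Put \<open>s = ln (1 / (1 - y))\<close>.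
  The logarithm of that sum lies, up to lower order, between the values of \<open>\<Sum>i. M i * ln (1 + x / exp i)\<close> at \<open>x = exp (s - 1)\<close> and at
  \<open>x = exp ((1 + \<eta>) s)\<close>, for any \<open>\<eta> > 0\<close>.  At \<open>x = exp n\<close> this function is \<open>\<Sum>i<n. (n - i) * M i\<close> up to lower order.  Choosing the
  multiplicities as multiples of \<open>m\<close> so that the latter sum is asymptotic to \<open>\<sigma> n powr \<rho>\<close>, or comparable to \<open>n powr \<rho> * ln n\<close> or
  \<open>n powr \<rho> / ln n\<close>, realizes all orders and types, even with limits in place of upper limits.
\<close>

section \<open>Determinants and the Pluecker relation\<close>

definition fdet :: "nat \<Rightarrow> (nat \<Rightarrow> nat \<Rightarrow> 'a) \<Rightarrow> 'a::comm_ring_1" where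
  "fdet k f = Determinant.det (Matrix.mat k k (\<lambda>(i, j). f i j))"

lemma fdet_leibniz:
  "fdet k f = (\<Sum>p | p permutes {0..<k}. signof p * (\<Prod>i = 0..<k. f i (p i)))"
proof -
  have "(\<Prod>i = 0..<k. Matrix.mat k k (\<lambda>(i, j). f i j) $$ (i, p i)) = (\<Prod>i = 0..<k. f i (p i))"
    if "p permutes {0..<k}" for p
    using that by (intro prod.cong) (auto simp: permutes_in_image[of p "{0..<k}", symmetric] dest: permutes_in_image)
  then show ?thesis
    unfolding fdet_def by (subst det_def'[of _ k]) (auto intro!: sum.cong)
qed

lemma fdet_cong: "(\<And>i j. i < k \<Longrightarrow> j < k \<Longrightarrow> f i j = g i j) \<Longrightarrow> fdet k f = fdet k g"
  unfolding fdet_def by (rule arg_cong[of _ _ Determinant.det]) (auto intro!: eq_matI)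

lemma fdet_0 [simp]: "fdet 0 f = 1"
  by (simp add: fdet_leibniz)

lemma fdet_transpose: "fdet k (\<lambda>i j. f j i) = fdet k f"
proof -
  have "Matrix.mat k k (\<lambda>(i, j). f j i) = Matrix.transpose_mat (Matrix.mat k k (\<lambda>(i, j). f i j))"
    by (auto intro!: eq_matI)
  then show ?thesis unfolding fdet_def by (simp add: Determinant.det_transpose[of _ k])
qed

lemma fdet_identical_rows:
  assumes "i < k" "i' < k" "i \<noteq> i'" "\<And>j. j < k \<Longrightarrow> f i j = f i' j"
  shows "fdet k f = 0"
  unfolding fdet_def using assms
  by (intro Determinant.det_identical_rows[of _ k i i']) (auto intro!: eq_vecI)

text \<open>The increasing enumeration of the natural numbers other than \<open>s\<close>: the index map left behind by deleting row or
  column \<open>s\<close>.\<close>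
definition skip :: "nat \<Rightarrow> nat \<Rightarrow> nat" where
  "skip s p = (if p < s then p else Suc p)"

lemma fdet_expand_row:
  assumes "i < Suc n"
  shows "fdet (Suc n) f = (\<Sum>j<Suc n. (-1) ^ (i + j) * f i j * fdet n (\<lambda>p q. f (skip i p) (skip j q)))"
proof -
  let ?A = "Matrix.mat (Suc n) (Suc n) (\<lambda>(i, j). f i j)"
  have "mat_delete ?A i j = Matrix.mat n n (\<lambda>(p, q). f (skip i p) (skip j q))" for j
    unfolding mat_delete_def skip_def by (auto intro!: eq_matI)
  then have "cofactor ?A i j = (-1) ^ (i + j) * fdet n (\<lambda>p q. f (skip i p) (skip j q))" for j
    unfolding cofactor_def fdet_def by simp
  then show ?thesis
    unfolding fdet_def[of "Suc n"] using assms
    by (subst laplace_expansion_row[of _ "Suc n" i]) (auto intro!: sum.cong simp: algebra_simps)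
qed

lemma fdet_expand_col:
  assumes "j < Suc n"
  shows "fdet (Suc n) f = (\<Sum>i<Suc n. (-1) ^ (i + j) * f i j * fdet n (\<lambda>p q. f (skip i p) (skip j q)))"
proof -
  have t: "fdet n (\<lambda>p q. f (skip i q) (skip j p)) = fdet n (\<lambda>p q. f (skip i p) (skip j q))" for i
    by (rule fdet_transpose)
  have "fdet (Suc n) f = fdet (Suc n) (\<lambda>i j. f j i)" by (rule fdet_transpose[symmetric])
  also have "\<dots> = (\<Sum>i<Suc n. (-1) ^ (j + i) * f i j * fdet n (\<lambda>p q. f (skip i q) (skip j p)))"
    using assms by (rule fdet_expand_row)
  also have "\<dots> = (\<Sum>i<Suc n. (-1) ^ (i + j) * f i j * fdet n (\<lambda>p q. f (skip i p) (skip j q)))"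
    unfolding t by (simp only: add.commute)
  finally show ?thesis .
qed

definition insert_at :: "nat \<Rightarrow> 'b \<Rightarrow> (nat \<Rightarrow> 'b) \<Rightarrow> nat \<Rightarrow> 'b" where
  "insert_at t x c q = (if q < t then c q else if q = t then x else c (q - 1))"

lemma insert_at_skip [simp]: "insert_at t x c (skip t q) = c q"
  by (simp add: insert_at_def skip_def)

text \<open>Expanding along the inserted column, the position \<open>t\<close> only shows up in the sign.  This is what
  spares all bookkeeping about sorting columns in the Pluecker relation below.\<close>
lemma fdet_insert_at:
  assumes "t \<le> n"
  shows "fdet (Suc n) (\<lambda>p q. V p (insert_at t x c q)) =
    (-1) ^ t * (\<Sum>p<Suc n. (-1) ^ p * V p x * fdet n (\<lambda>p' q. V (skip p p') (c q)))"
  using assms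
  by (subst fdet_expand_col[of t]) (auto simp: sum_distrib_left insert_at_def[of t x c t] power_add mult_ac simp del: sum.lessThan_Suc intro!: sum.cong)

text \<open>Repeat row \<open>p\<close> on top of the matrix: the determinant vanishes, and its expansion along the repeated row is the
  linear relation between \<open>n + 2\<close> vectors in a space of dimension \<open>n + 1\<close>.\<close>
lemma fdet_relation:
  assumes "p < Suc n"
  shows "(\<Sum>q<Suc (Suc n). (-1) ^ q * V p (c q) * fdet (Suc n) (\<lambda>p' q'. V p' (c (skip q q')))) = 0"
proof -
  let ?f = "\<lambda>i j. V (case i of 0 \<Rightarrow> p | Suc i' \<Rightarrow> i') (c j)"
  have "fdet (Suc (Suc n)) ?f = 0"
    using assms by (intro fdet_identical_rows[of 0 _ "Suc p"]) auto
  then show ?thesis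
    by (subst (asm) fdet_expand_row[of 0]) (auto simp: skip_def)
qed

lemma minus_one_power_mult_cancel [simp]: "(-1) ^ n * ((-1) ^ n * x) = (x :: 'a::comm_ring_1)"
proof -
  have "(-1) ^ n * ((-1) ^ n * x) = ((-1) * (-1)) ^ n * x" by (simp only: power_mult_distrib mult.assoc)
  then show ?thesis by simp
qed

text \<open>The linear relation between the \<open>l + 3\<close> columns \<open>c 0, c 1, \<dots>\<close> of length \<open>l + 2\<close> is paired with the functional \<open>f\<close> that
  deletes row \<open>p0\<close> and takes the determinant of a column followed by the columns \<open>w\<close> (all but \<open>c 0\<close>, \<open>c s\<close> and the last one).
  The functional kills every column of \<open>w\<close>, so only three terms survive.  The form of the identity is the one that
  expresses a minor with a gap in its columns by minors of smaller spread.\<close>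
lemma three_term_plucker:
  fixes V :: "nat \<Rightarrow> 'b \<Rightarrow> 'a::comm_ring_1"
  assumes s: "1 \<le> s" "s \<le> Suc l" and p0: "p0 \<le> Suc l"
  defines "D \<equiv> \<lambda>d. fdet (Suc (Suc l)) (\<lambda>p q. V p (d q))"
  defines "F \<equiv> \<lambda>d. fdet (Suc l) (\<lambda>p q. V (skip p0 p) (d q))"
  shows "D (\<lambda>q. c (skip s q)) * F (\<lambda>q. c (Suc q)) =
         D (\<lambda>q. c (Suc q)) * F (\<lambda>q. c (skip s q)) + D c * F (\<lambda>q. c (skip s (Suc q)))"
proof -
  define w where "w = (\<lambda>q. c (skip s (Suc q)))"
  define f where "f = (\<lambda>x. \<Sum>p<Suc l. (-1) ^ p * V (skip p0 p) x * fdet l (\<lambda>p' q. V (skip p0 (skip p p')) (w q)))"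
  have Fins: "F (insert_at t x w) = (-1) ^ t * f x" if "t \<le> l" for t x
    unfolding F_def f_def using that by (rule fdet_insert_at)
  have Fcong: "F d = F d'" if "\<And>q. q \<le> l \<Longrightarrow> d q = d' q" for d d'
    unfolding F_def using that by (intro fdet_cong) auto
  have f0: "f (c 0) = F (\<lambda>q. c (skip s q))"
  proof -
    have "F (insert_at 0 (c 0) w) = F (\<lambda>q. c (skip s q))"
    proof (rule Fcong)
      show "insert_at 0 (c 0) w q = c (skip s q)" for q
        using s(1) by (cases q) (simp_all add: insert_at_def w_def skip_def)
    qed
    then show ?thesis using Fins[of 0 "c 0"] by simp
  qed
  have fs: "f (c s) = (-1) ^ (s - 1) * F (\<lambda>q. c (Suc q))"
  proof -
    have "F (insert_at (s - 1) (c s) w) = F (\<lambda>q. c (Suc q))"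
    proof (rule Fcong)
      show "insert_at (s - 1) (c s) w q = c (Suc q)" for q
      proof -
        consider "q < s - 1" | "q = s - 1" | "q > s - 1" by linarith
        then show ?thesis
        proof cases
          case 1
          then have "Suc q < s" by linarith
          with 1 show ?thesis by (simp add: insert_at_def w_def skip_def)
        next
          case 2
          then show ?thesis using s(1) by (simp add: insert_at_def)
        next
          case 3
          then obtain q' where "q = Suc q'" by (cases q) auto
          moreover have "\<not> Suc q' < s" using 3 \<open>q = Suc q'\<close> by linarith
          ultimately show ?thesis using 3 by (simp add: insert_at_def w_def skip_def)
        qed
      qed
    qed
    then have "F (\<lambda>q. c (Suc q)) = (-1) ^ (s - 1) * f (c s)" using Fins[of "s - 1" "c s"] s by simp
    then show ?thesis by simp
  qed
  have fl: "f (c (Suc (Suc l))) = (-1) ^ l * F (\<lambda>q. c (skip s (Suc q)))"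
  proof -
    have "F (insert_at l (c (Suc (Suc l))) w) = F (\<lambda>q. c (skip s (Suc q)))"
    proof (rule Fcong)
      show "insert_at l (c (Suc (Suc l))) w q = c (skip s (Suc q))" if "q \<le> l" for q
      proof (cases "q = l")
        case True
        then show ?thesis using s(2) by (simp add: insert_at_def skip_def)
      next
        case False
        then show ?thesis using that by (simp add: insert_at_def w_def)
      qed
    qed
    then have "F (\<lambda>q. c (skip s (Suc q))) = (-1) ^ l * f (c (Suc (Suc l)))"
      using Fins[of l "c (Suc (Suc l))"] s by simp
    then show ?thesis by simp
  qed
  have fz: "f (c q) = 0" if q: "q < Suc (Suc (Suc l))" "q \<noteq> 0" "q \<noteq> s" "q \<noteq> Suc (Suc l)" for q
  proof -
    define q' where "q' = (if q < s then q - 1 else q - 2)"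
    have "Suc (Suc (q - 2)) = q" if "\<not> q < s" using that q s by linarith
    then have q': "q' < l" "w q' = c q" using q s by (auto simp: q'_def w_def skip_def)
    have "F (insert_at 0 (c q) w) = 0"
    proof -
      have "fdet (Suc l) (\<lambda>p r. V (skip p0 r) (insert_at 0 (c q) w p)) = 0"
        using q' by (intro fdet_identical_rows[of 0 _ "Suc q'"]) (auto simp: insert_at_def)
      moreover have "F (insert_at 0 (c q) w) = fdet (Suc l) (\<lambda>p r. V (skip p0 r) (insert_at 0 (c q) w p))"
        unfolding F_def by (rule fdet_transpose[symmetric])
      ultimately show ?thesis by simp
    qed
    then show ?thesis using Fins[of 0 "c q"] by simp
  qed
  have D: "D d = D d'" if "\<And>q. q \<le> Suc l \<Longrightarrow> d q = d' q" for d d'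
    unfolding D_def using that by (intro fdet_cong) auto
  define E where "E = (\<lambda>q. D (\<lambda>q'. c (skip q q')))"
  define \<phi> where "\<phi> = (\<lambda>p. fdet l (\<lambda>p' q. V (skip p0 (skip p p')) (w q)))"
  have f_eq: "f x = (\<Sum>p<Suc l. (-1) ^ p * V (skip p0 p) x * \<phi> p)" for x
    unfolding f_def \<phi>_def ..
  have "(\<Sum>q<Suc (Suc (Suc l)). (-1) ^ q * f (c q) * E q)
     = (\<Sum>q<Suc (Suc (Suc l)). \<Sum>p<Suc l. (-1) ^ p * \<phi> p * ((-1) ^ q * V (skip p0 p) (c q) * E q))"
    unfolding f_eq sum_distrib_left sum_distrib_right by (intro sum.cong refl) (simp only: mult_ac)
  also have "\<dots> = (\<Sum>p<Suc l. (-1) ^ p * \<phi> p * (\<Sum>q<Suc (Suc (Suc l)). (-1) ^ q * V (skip p0 p) (c q) * E q))"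
    unfolding sum_distrib_left by (rule sum.swap)
  also have "\<dots> = 0"
  proof (rule sum.neutral, rule ballI)
    fix p assume "p \<in> {..<Suc l}"
    then have "skip p0 p < Suc (Suc l)" by (auto simp: skip_def)
    then have "(\<Sum>q<Suc (Suc (Suc l)). (-1) ^ q * V (skip p0 p) (c q) * E q) = 0"
      unfolding E_def D_def by (rule fdet_relation)
    then show "(-1) ^ p * \<phi> p *
          (\<Sum>q<Suc (Suc (Suc l)). (-1) ^ q * V (skip p0 p) (c q) * E q) = 0" by simp
  qed
  finally have sum0: "(\<Sum>q<Suc (Suc (Suc l)). (-1) ^ q * f (c q) * E q) = 0" .
  have sum3: "(\<Sum>q<Suc (Suc (Suc l)). (-1) ^ q * f (c q) * E q) = (\<Sum>q\<in>{0, s, Suc (Suc l)}. (-1) ^ q * f (c q) * E q)"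
  proof (rule sum.mono_neutral_right)
    show "{0, s, Suc (Suc l)} \<subseteq> {..<Suc (Suc (Suc l))}" using s by auto
    show "\<forall>q\<in>{..<Suc (Suc (Suc l))} - {0, s, Suc (Suc l)}. (-1) ^ q * f (c q) * E q = 0"
    proof
      fix q assume "q \<in> {..<Suc (Suc (Suc l))} - {0, s, Suc (Suc l)}"
      then have "f (c q) = 0" by (intro fz) auto
      then show "(-1) ^ q * f (c q) * E q = 0" by simp
    qed
  qed simp
  have E: "E (Suc (Suc l)) = D c" "E 0 = D (\<lambda>q. c (Suc q))" "E s = D (\<lambda>q. c (skip s q))"
    unfolding E_def by (intro D; auto simp: skip_def)+
  have "(\<Sum>q\<in>{0, s, Suc (Suc l)}. g q) = g 0 + g s + g (Suc (Suc l))" for g :: "nat \<Rightarrow> 'a"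
    using s by (simp add: add.assoc)
  from sum3[unfolded this sum0 E, symmetric]
  have "f (c 0) * D (\<lambda>q. c (Suc q)) + ((-1) ^ s * f (c s)) * D (\<lambda>q. c (skip s q))
      + ((-1) ^ l * f (c (Suc (Suc l)))) * D c = 0"
    by (simp only: power_Suc power_0 mult_1_left mult_minus_left minus_minus)
  moreover have "(-1) ^ s * ((-1) ^ (s - 1) * y) = - y" for y :: 'a
  proof -
    obtain n where "s = Suc n" using s(1) by (cases s) auto
    then show ?thesis by simp
  qed
  then have "(-1) ^ s * f (c s) = - F (\<lambda>q. c (Suc q))"
    unfolding fs by blast
  moreover have "(-1) ^ l * f (c (Suc (Suc l))) = F (\<lambda>q. c (skip s (Suc q)))"
    unfolding fl by (rule minus_one_power_mult_cancel)
  ultimately have "F (\<lambda>q. c (skip s q)) * D (\<lambda>q. c (Suc q)) - F (\<lambda>q. c (Suc q)) * D (\<lambda>q. c (skip s q))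
      + F (\<lambda>q. c (skip s (Suc q))) * D c = 0"
    unfolding f0 by (simp only: mult_minus_left diff_conv_add_uminus)
  moreover have "y * x = b * a + z * w" if "a * b - x * y + w * z = 0" for a b x y w z :: 'a
  proof -
    have "y * x = b * a + z * w - (a * b - x * y + w * z)" by (simp add: mult.commute[of w z] mult.commute[of x y] mult.commute[of a b])
    then show ?thesis using that by simp
  qed
  ultimately show ?thesis by blast
qed

section \<open>Fekete's criterion for triangular Toeplitz matrices\<close>

lemma strict_mono_on_less:
  fixes J :: "nat \<Rightarrow> nat"
  shows "strict_mono_on {..<k} J \<Longrightarrow> a < b \<Longrightarrow> b < k \<Longrightarrow> J a < J b"
  by (auto intro: strict_mono_onD[of "{..<k}" J])

lemma strict_mono_on_gap:
  fixes J :: "nat \<Rightarrow> nat"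
  assumes mono: "strict_mono_on {..<k} J" and gap: "\<not> (\<forall>q<k. J q = J 0 + q)"
  obtains s where "1 \<le> s" "s < k" "J (s - 1) + 1 < J s"
proof -
  have "\<exists>s. 1 \<le> s \<and> s < k \<and> J (s - 1) + 1 < J s"
  proof (rule ccontr)
    assume no: "\<nexists>s. 1 \<le> s \<and> s < k \<and> J (s - 1) + 1 < J s"
    have "J q = J 0 + q" if "q < k" for q
      using that
    proof (induction q)
      case (Suc q)
      then have "J q < J (Suc q)" using Suc.prems by (intro strict_mono_on_less[OF mono]) auto
      moreover have "\<not> (1 \<le> Suc q \<and> Suc q < k \<and> J (Suc q - 1) + 1 < J (Suc q))" using no by blast
      moreover have "J q = J 0 + q" using Suc.prems by (intro Suc.IH) auto
      ultimately show ?case using Suc.prems by simp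
    qed simp
    then show False using gap by blast
  qed
  then show thesis using that by blast
qed

text \<open>Filling the first free place of a gap; the new family has one more index but the same extreme ones.\<close>
lemma strict_mono_on_insert_gap:
  fixes J :: "nat \<Rightarrow> nat"
  assumes mono: "strict_mono_on {..<k} J" and s: "1 \<le> s" "s < k" "J (s - 1) + 1 < J s"
  shows "strict_mono_on {..<Suc k} (insert_at s (J (s - 1) + 1) J)"
proof -
  define c where "c = insert_at s (J (s - 1) + 1) J"
  have lt: "J a < J b" if "a < b" "b < k" for a b
    using mono that by (rule strict_mono_on_less)
  have le: "J a \<le> J b" if "a \<le> b" "b < k" for a b
    using lt[of a b] that by (cases "a = b") auto
  have "c a < c b" if ab: "a < b" "b < Suc k" for a b
  proof -
    consider "b < s" | "b = s" | "a < s" "s < b" | "a = s" | "s < a" using ab by linarith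
    then show ?thesis
    proof cases
      case 1 then show ?thesis using ab s lt by (simp add: c_def insert_at_def)
    next
      case 2
      then have "J a \<le> J (s - 1)" using ab s by (intro le) auto
      then show ?thesis using 2 ab by (simp add: c_def insert_at_def)
    next
      case 3
      then have "J a < J (b - 1)" using ab s by (intro lt) auto
      then show ?thesis using 3 ab by (simp add: c_def insert_at_def)
    next
      case 4
      then have "J s \<le> J (b - 1)" using ab s by (intro le) auto
      then show ?thesis using 4 ab s by (simp add: c_def insert_at_def)
    next
      case 5
      then have "J (a - 1) < J (b - 1)" using ab s by (intro lt) auto
      then show ?thesis using 5 ab by (simp add: c_def insert_at_def)
    qed
  qed
  then show ?thesis unfolding c_def[symmetric] by (intro strict_mono_onI) auto
qed

lemma insert_gap_le:
  fixes J :: "nat \<Rightarrow> nat"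
  assumes mono: "strict_mono_on {..<k} J" and s: "1 \<le> s" "s < k" "J (s - 1) + 1 < J s" and q: "q < k"
  shows "insert_at s (J (s - 1) + 1) J q \<le> J q"
proof -
  have "J (q - 1) \<le> J q" using strict_mono_on_less[OF mono, of "q - 1" q] q by (cases q) auto
  then show ?thesis using s by (auto simp: insert_at_def)
qed

lemma strict_mono_on_Suc_shift:
  "strict_mono_on {..<Suc k} J \<Longrightarrow> strict_mono_on {..<k} (\<lambda>q. J (Suc q))"
  "strict_mono_on {..<Suc k} J \<Longrightarrow> strict_mono_on {..<k} J"
  by (auto simp: strict_mono_on_def)

text \<open>An induction on the spread of the columns, due to Fekete.  A gap is filled by a new column, and the Pluecker relation
  writes the given minor, times a positive minor of smaller order, as a sum of products of positive minors.  The last row is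
  the deleted one, so that the rows stay consecutive; then the zeros of the triangle can only enter through a first
  column left of the diagonal, which the hypothesis excludes.\<close>
lemma toeplitz_solid_rows:
  assumes solid: "\<And>k n. k \<le> r \<Longrightarrow> fdet k (\<lambda>p q. toeplitz_entry a p (n + q)) > 0"
  shows "k \<le> r \<Longrightarrow> strict_mono_on {..<k} J \<Longrightarrow> (0 < k \<Longrightarrow> i \<le> J 0) \<Longrightarrow>
    fdet k (\<lambda>p q. toeplitz_entry a (i + p) (J q)) > 0"
proof (induction k arbitrary: J)
  case 0
  then show ?case by simp
next
  case (Suc k)
  note IHk = Suc.IH
  show ?case
    using Suc.prems
  proof (induction "J k - J 0" arbitrary: J rule: less_induct)
    case less
    show ?case
    proof (cases "\<forall>q<Suc k. J q = J 0 + q")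
      case True
      have "fdet (Suc k) (\<lambda>p q. toeplitz_entry a (i + p) (J q)) =
            fdet (Suc k) (\<lambda>p q. toeplitz_entry a p ((J 0 - i) + q))"
      proof (rule fdet_cong)
        fix p q assume "p < Suc k" "q < Suc k"
        then have "J q = J 0 + q" using True by blast
        moreover have "i \<le> J 0" using less.prems(3) by simp
        ultimately show "toeplitz_entry a (i + p) (J q) = toeplitz_entry a p (J 0 - i + q)"
          by (auto simp: toeplitz_entry_def)
      qed
      then show ?thesis using solid[OF less.prems(1), of "J 0 - i"] by (simp only:)
    next
      case False
      obtain s where s: "1 \<le> s" "s < Suc k" "J (s - 1) + 1 < J s"
        using strict_mono_on_gap[OF less.prems(2) False] .
      then obtain l where l: "k = Suc l" by (cases k) auto
      define c where "c = insert_at s (J (s - 1) + 1) J"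
      have mono: "strict_mono_on {..<Suc (Suc k)} c"
        unfolding c_def using less.prems(2) s by (rule strict_mono_on_insert_gap)
      have c0: "c 0 = J 0" and cl: "c (Suc k) = J k" using s by (auto simp: c_def insert_at_def)
      have c1: "c 0 < c 1" and ck: "c k < c (Suc k)" by (rule strict_mono_on_less[OF mono]; simp)+
      have J0: "J 0 \<le> J k" and iJ: "i \<le> J 0"
        using strict_mono_on_less[OF less.prems(2), of 0 k] less.prems(3) l by auto
      let ?D = "\<lambda>d. fdet (Suc (Suc l)) (\<lambda>p q. toeplitz_entry a (i + p) (d q))"
      let ?F = "\<lambda>d. fdet (Suc l) (\<lambda>p q. toeplitz_entry a (i + skip (Suc l) p) (d q))"
      have Feq: "?F d = fdet k (\<lambda>p q. toeplitz_entry a (i + p) (d q))" for d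
        unfolding l by (rule fdet_cong) (simp add: skip_def)
      have F: "?F d > 0" if "strict_mono_on {..<k} d" "i \<le> d 0" for d
        unfolding Feq using that less.prems(1) by (intro IHk) auto
      have id: "?D (\<lambda>q. c (skip s q)) * ?F (\<lambda>q. c (Suc q)) =
         ?D (\<lambda>q. c (Suc q)) * ?F (\<lambda>q. c (skip s q)) + ?D c * ?F (\<lambda>q. c (skip s (Suc q)))"
        by (rule three_term_plucker[where V = "\<lambda>p x. toeplitz_entry a (i + p) x" and c = c and s = s and l = l and ?p0.0 = "Suc l"])
          (use s l in auto)
      have cs: "c (skip s q) = J q" for q by (simp add: c_def)
      note shift = strict_mono_on_Suc_shift
      have F1: "?F (\<lambda>q. c (Suc q)) > 0"
        using shift(2)[OF shift(1)[OF mono]] c0 c1 iJ by (intro F) auto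
      have D1: "?D (\<lambda>q. c (Suc q)) > 0"
        unfolding l[symmetric]
      proof (rule less.hyps)
        show "c (Suc k) - c (Suc 0) < J k - J 0" using c0 c1 cl J0 mono strict_mono_on_less[of "Suc (Suc k)" c "Suc 0" "Suc k"] l by auto
      qed (use less.prems shift(1)[OF mono] c0 c1 iJ in auto)
      have D2: "?D c > 0"
        unfolding l[symmetric]
      proof (rule less.hyps)
        have "c 0 < c k" by (rule strict_mono_on_less[OF mono]) (simp_all add: l)
        then show "c k - c 0 < J k - J 0" using c0 ck cl by auto
      qed (use less.prems shift(2)[OF mono] c0 iJ in auto)
      have F2: "?F J > 0" using shift(2)[OF less.prems(2)] iJ by (intro F) auto
      have F3: "?F (\<lambda>q. J (Suc q)) > 0"
        using shift(1)[OF less.prems(2)] iJ strict_mono_on_less[OF less.prems(2), of 0 1] l by (intro F) auto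
      have "?D J * ?F (\<lambda>q. c (Suc q)) > 0"
        unfolding id[unfolded cs]
        by (rule add_pos_pos[OF mult_pos_pos[OF D1 F2] mult_pos_pos[OF D2 F3]])
      then have "?D J > 0" using F1 by (rule zero_less_mult_pos2)
      then show ?thesis unfolding l .
    qed
  qed
qed

text \<open>If \<open>J p < I p\<close>, then the rows from \<open>p\<close> on and the columns up to \<open>p\<close> span a block of zeros too large for any
  permutation to avoid it.\<close>
lemma toeplitz_minor_eq_0:
  assumes I: "strict_mono_on {..<k} I" and J: "strict_mono_on {..<k} J" and p: "p < k" "J p < I p"
  shows "fdet k (\<lambda>p q. toeplitz_entry a (I p) (J q)) = 0"
  unfolding fdet_leibniz
proof (rule sum.neutral, rule ballI)
  fix \<pi> assume "\<pi> \<in> {\<pi>. \<pi> permutes {0..<k}}"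
  then have perm: "\<pi> permutes {0..<k}" by simp
  have "\<exists>i\<in>{p..<k}. \<pi> i \<le> p"
  proof (rule ccontr)
    assume "\<not> ?thesis"
    moreover have "\<pi> x < k" if "x < k" for x using permutes_in_image[OF perm, of x] that by simp
    ultimately have "\<pi> ` {p..<k} \<subseteq> {p<..<k}" by (auto simp: not_le)
    moreover have "card (\<pi> ` {p..<k}) = k - p"
      using permutes_inj[OF perm] by (simp add: card_image inj_on_subset)
    ultimately have "k - p \<le> card {p<..<k}" by (metis card_mono finite_greaterThanLessThan)
    then show False using p by simp
  qed
  then obtain i where i: "p \<le> i" "i < k" "\<pi> i \<le> p" by auto
  have "J (\<pi> i) \<le> J p" using strict_mono_on_less[OF J, of "\<pi> i" p] i p by (cases "\<pi> i = p") auto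
  moreover have "I p \<le> I i" using strict_mono_on_less[OF I, of p i] i p by (cases "p = i") auto
  ultimately have "toeplitz_entry a (I i) (J (\<pi> i)) = 0" using p by (simp add: toeplitz_entry_def)
  then have "(\<Prod>i = 0..<k. toeplitz_entry a (I i) (J (\<pi> i))) = 0"
    using i by (intro prod_zero) auto
  then show "signof \<pi> * (\<Prod>i = 0..<k. toeplitz_entry a (I i) (J (\<pi> i))) = 0" by simp
qed

text \<open>The same induction on the spread of the rows.  Here the first column is deleted: the condition \<open>I p \<le> J p\<close> then
  persists in all minors involved except possibly the one of full order without the first row, which is nonnegative in any case.\<close>
lemma toeplitz_minors_pos:
  assumes solid: "\<And>k n. k \<le> r \<Longrightarrow> fdet k (\<lambda>p q. toeplitz_entry a p (n + q)) > 0"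
  shows "k \<le> r \<Longrightarrow> strict_mono_on {..<k} I \<Longrightarrow> strict_mono_on {..<k} J \<Longrightarrow> (\<And>p. p < k \<Longrightarrow> I p \<le> J p) \<Longrightarrow>
    fdet k (\<lambda>p q. toeplitz_entry a (I p) (J q)) > 0"
proof (induction k arbitrary: I J)
  case 0
  then show ?case by simp
next
  case (Suc k)
  note IHk = Suc.IH
  show ?case
    using Suc.prems
  proof (induction "I k - I 0" arbitrary: I rule: less_induct)
    case less
    show ?case
    proof (cases "\<forall>q<Suc k. I q = I 0 + q")
      case True
      have "fdet (Suc k) (\<lambda>p q. toeplitz_entry a (I p) (J q)) =
            fdet (Suc k) (\<lambda>p q. toeplitz_entry a (I 0 + p) (J q))"
      proof (rule fdet_cong)
        fix p q assume "p < Suc k"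
        then have "I p = I 0 + p" using True by blast
        then show "toeplitz_entry a (I p) (J q) = toeplitz_entry a (I 0 + p) (J q)" by (rule arg_cong)
      qed
      then show ?thesis using toeplitz_solid_rows[OF solid, of r "Suc k" J "I 0"] less.prems by simp
    next
      case False
      obtain s where s: "1 \<le> s" "s < Suc k" "I (s - 1) + 1 < I s"
        using strict_mono_on_gap[OF less.prems(2) False] .
      then obtain l where l: "k = Suc l" by (cases k) auto
      define c where "c = insert_at s (I (s - 1) + 1) I"
      have mono: "strict_mono_on {..<Suc (Suc k)} c"
        unfolding c_def using less.prems(2) s by (rule strict_mono_on_insert_gap)
      have cI: "c q \<le> I q" if "q < Suc k" for q
        unfolding c_def using less.prems(2) s that by (rule insert_gap_le)
      have c0: "c 0 = I 0" and cl: "c (Suc k) = I k" using s by (auto simp: c_def insert_at_def)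
      have c1: "c 0 < c 1" and ck: "c k < c (Suc k)" by (rule strict_mono_on_less[OF mono]; simp)+
      have JJ: "J q < J (Suc q)" if "q < k" for q
        using strict_mono_on_less[OF less.prems(3), of q "Suc q"] that by auto
      let ?D = "\<lambda>d. fdet (Suc (Suc l)) (\<lambda>q p. toeplitz_entry a (d p) (J q))"
      let ?F = "\<lambda>d. fdet (Suc l) (\<lambda>q p. toeplitz_entry a (d p) (J (skip 0 q)))"
      have Deq: "?D d = fdet (Suc k) (\<lambda>p q. toeplitz_entry a (d p) (J q))" for d
        unfolding l by (rule fdet_transpose)
      have Feq: "?F d = fdet k (\<lambda>p q. toeplitz_entry a (d p) (J (Suc q)))" for d
      proof -
        have "?F d = fdet (Suc l) (\<lambda>p q. toeplitz_entry a (d p) (J (skip 0 q)))" by (rule fdet_transpose)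
        then show ?thesis by (simp add: l skip_def)
      qed
      note shift = strict_mono_on_Suc_shift
      have F: "?F d > 0" if "strict_mono_on {..<k} d" "\<And>q. q < k \<Longrightarrow> d q \<le> J (Suc q)" for d
        unfolding Feq using that less.prems(1) shift(1)[OF less.prems(3)] by (intro IHk) auto
      have id: "?D (\<lambda>q. c (skip s q)) * ?F (\<lambda>q. c (Suc q)) =
         ?D (\<lambda>q. c (Suc q)) * ?F (\<lambda>q. c (skip s q)) + ?D c * ?F (\<lambda>q. c (skip s (Suc q)))"
        by (rule three_term_plucker[where V = "\<lambda>q x. toeplitz_entry a x (J q)" and c = c and s = s and l = l and ?p0.0 = 0])
          (use s l in auto)
      have cs: "c (skip s q) = I q" for q by (simp add: c_def)
      have IJ: "I q \<le> J q" if "q < Suc k" for q using less.prems that by auto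
      have F1: "?F (\<lambda>q. c (Suc q)) > 0"
      proof (rule F)
        show "c (Suc q) \<le> J (Suc q)" if "q < k" for q
          using cI[of "Suc q"] IJ[of "Suc q"] that by simp
      qed (rule shift(2)[OF shift(1)[OF mono]])
      have D1: "?D (\<lambda>q. c (Suc q)) \<ge> 0"
      proof (cases "\<forall>q<Suc k. c (Suc q) \<le> J q")
        case True
        have "?D (\<lambda>q. c (Suc q)) > 0"
          unfolding Deq
        proof (rule less.hyps)
          show "c (Suc k) - c (Suc 0) < I k - I 0"
            using c0 c1 cl strict_mono_on_less[OF mono, of "Suc 0" "Suc k"] l by auto
        qed (use less.prems shift(1)[OF mono] True in auto)
        then show ?thesis by simp
      next
        case False
        then obtain q where "q < Suc k" "J q < c (Suc q)" by (auto simp: not_le)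
        then have "?D (\<lambda>q. c (Suc q)) = 0"
          unfolding Deq using shift(1)[OF mono] less.prems(3) by (intro toeplitz_minor_eq_0)
        then show ?thesis by simp
      qed
      have D2: "?D c > 0"
        unfolding Deq
      proof (rule less.hyps)
        have "c 0 < c k" by (rule strict_mono_on_less[OF mono]) (simp_all add: l)
        then show "c k - c 0 < I k - I 0" using c0 ck cl by auto
        show "c q \<le> J q" if "q < Suc k" for q using cI[OF that] IJ[OF that] by simp
      qed (use less.prems shift(2)[OF mono] in auto)
      have F2: "?F I > 0"
      proof (rule F)
        show "I q \<le> J (Suc q)" if "q < k" for q using IJ[of q] JJ[of q] that by simp
      qed (rule shift(2)[OF less.prems(2)])
      have F3: "?F (\<lambda>q. I (Suc q)) > 0"
        using IJ by (intro F shift(1)[OF less.prems(2)]) auto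
      have "?D I * ?F (\<lambda>q. c (Suc q)) > 0"
        unfolding id[unfolded cs]
        by (rule add_nonneg_pos[OF mult_nonneg_nonneg[OF D1 less_imp_le[OF F2]] mult_pos_pos[OF D2 F3]])
      then have "?D I > 0" using F1 by (rule zero_less_mult_pos2)
      then show ?thesis unfolding Deq .
    qed
  qed
qed

text \<open>Minors with \<open>I p > J p\<close> for some \<open>p\<close> vanish, and all others are positive by the two inductions.\<close>
theorem PF_seq_of_solid_minors:
  assumes solid: "\<And>k n. k \<le> r \<Longrightarrow> fdet k (\<lambda>p q. toeplitz_entry a p (n + q)) > 0"
  shows "PF_seq r a"
  unfolding PF_seq_def
proof (intro allI impI)
  fix k and I J :: "nat \<Rightarrow> nat"
  assume k: "k \<le> r" and I: "strict_mono_on {..<k} I" and J: "strict_mono_on {..<k} J"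
  have "fdet k (\<lambda>p q. toeplitz_entry a (I p) (J q)) \<ge> 0"
  proof (cases "\<forall>p<k. I p \<le> J p")
    case True
    then show ?thesis using toeplitz_minors_pos[OF solid k I J] by (simp add: less_imp_le)
  next
    case False
    then show ?thesis using toeplitz_minor_eq_0[OF I J] by (auto simp: not_le)
  qed
  then show "0 \<le> Determinant.det (Matrix.mat k k (\<lambda>(p, q). toeplitz_entry a (I p) (J q)))"
    unfolding fdet_def .
qed

lemma tendsto_fdet:
  fixes f :: "'c \<Rightarrow> nat \<Rightarrow> nat \<Rightarrow> real"
  assumes "\<And>i j. i < k \<Longrightarrow> j < k \<Longrightarrow> ((\<lambda>x. f x i j) \<longlongrightarrow> g i j) F"
  shows "((\<lambda>x. fdet k (f x)) \<longlongrightarrow> fdet k g) F"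
  unfolding fdet_leibniz using assms
  by (intro tendsto_sum tendsto_mult tendsto_const tendsto_prod) (auto dest: permutes_in_image)

lemma PF_seq_tendsto:
  assumes PF: "\<And>n. PF_seq r (f n)" and lim: "\<And>k. (\<lambda>n. f n k) \<longlonglongrightarrow> a k"
  shows "PF_seq r a"
  unfolding PF_seq_def fdet_def[symmetric]
proof (intro allI impI)
  fix k and I J :: "nat \<Rightarrow> nat"
  assume A: "k \<le> r" "strict_mono_on {..<k} I" "strict_mono_on {..<k} J"
  have "(\<lambda>n. fdet k (\<lambda>p q. toeplitz_entry (f n) (I p) (J q))) \<longlonglongrightarrow> fdet k (\<lambda>p q. toeplitz_entry a (I p) (J q))"
    using lim by (intro tendsto_fdet) (auto simp: toeplitz_entry_def)
  moreover have "fdet k (\<lambda>p q. toeplitz_entry (f n) (I p) (J q)) \<ge> 0" for n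
    using PF[of n] A unfolding PF_seq_def fdet_def by blast
  ultimately show "0 \<le> fdet k (\<lambda>p q. toeplitz_entry a (I p) (J q))"
    by (intro LIMSEQ_le_const) auto
qed

section \<open>Estimates for determinants\<close>

lemma norm_prod_diff_le:
  fixes \<alpha> \<beta> :: "'i \<Rightarrow> 'a::real_normed_field"
  assumes "finite J" "\<And>j. j \<in> J \<Longrightarrow> norm (\<alpha> j) \<le> B j" "\<And>j. j \<in> J \<Longrightarrow> norm (\<beta> j) \<le> B j"
    "\<And>j. j \<in> J \<Longrightarrow> 1 \<le> B j"
  shows "norm (prod \<alpha> J - prod \<beta> J) \<le> (\<Sum>j\<in>J. norm (\<alpha> j - \<beta> j)) * prod B J"
  using assms
proof (induction J rule: finite_induct)
  case (insert x J)
  let ?S = "\<Sum>j\<in>J. norm (\<alpha> j - \<beta> j)"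
  have "1 \<le> B j" if "j \<in> insert x J" for j using insert.prems that by blast
  then have B: "1 \<le> B x" "0 \<le> B x" "0 \<le> prod B J"
    by (auto intro!: prod_nonneg intro: order_trans[OF zero_le_one])
  have \<beta>: "norm (prod \<beta> J) \<le> prod B J"
    unfolding prod_norm[symmetric] using insert.prems by (intro prod_mono) auto
  have "prod \<alpha> (insert x J) - prod \<beta> (insert x J) = \<alpha> x * (prod \<alpha> J - prod \<beta> J) + (\<alpha> x - \<beta> x) * prod \<beta> J"
    using insert by (simp add: algebra_simps)
  also have "norm \<dots> \<le> norm (\<alpha> x) * norm (prod \<alpha> J - prod \<beta> J) + norm (\<alpha> x - \<beta> x) * norm (prod \<beta> J)"
    by (rule order_trans[OF norm_triangle_ineq]) (simp add: norm_mult)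
  also have "\<dots> \<le> B x * (?S * prod B J) + norm (\<alpha> x - \<beta> x) * (B x * prod B J)"
  proof (rule add_mono)
    show "norm (\<alpha> x) * norm (prod \<alpha> J - prod \<beta> J) \<le> B x * (?S * prod B J)"
      using insert B by (intro mult_mono) auto
    have "prod B J \<le> B x * prod B J" using B by (simp add: mult_le_cancel_right1)
    then show "norm (\<alpha> x - \<beta> x) * norm (prod \<beta> J) \<le> norm (\<alpha> x - \<beta> x) * (B x * prod B J)"
      using \<beta> by (intro mult_left_mono) auto
  qed
  also have "\<dots> = (\<Sum>j\<in>insert x J. norm (\<alpha> j - \<beta> j)) * prod B (insert x J)"
    using insert by (simp add: algebra_simps)
  finally show ?case .
qed simp

lemma fdet_diff_le:
  fixes f g :: "nat \<Rightarrow> nat \<Rightarrow> real"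
  assumes "1 \<le> C" "\<And>i j. i < k \<Longrightarrow> j < k \<Longrightarrow> \<bar>f i j\<bar> \<le> C" "\<And>i j. i < k \<Longrightarrow> j < k \<Longrightarrow> \<bar>g i j\<bar> \<le> C"
    "\<And>i j. i < k \<Longrightarrow> j < k \<Longrightarrow> \<bar>f i j - g i j\<bar> \<le> \<eta>"
  shows "\<bar>fdet k f - fdet k g\<bar> \<le> fact k * (real k * \<eta> * C ^ k)"
proof -
  let ?P = "{\<pi>. \<pi> permutes {0..<k}}"
  have "\<bar>fdet k f - fdet k g\<bar> = \<bar>\<Sum>\<pi>\<in>?P. signof \<pi> * ((\<Prod>i=0..<k. f i (\<pi> i)) - (\<Prod>i=0..<k. g i (\<pi> i)))\<bar>"
    unfolding fdet_leibniz by (simp add: sum_subtractf right_diff_distrib)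
  also have "\<dots> \<le> (\<Sum>\<pi>\<in>?P. \<bar>signof \<pi> * ((\<Prod>i=0..<k. f i (\<pi> i)) - (\<Prod>i=0..<k. g i (\<pi> i)))\<bar>)"
    by (rule sum_abs)
  also have "\<dots> \<le> (\<Sum>\<pi>\<in>?P. real k * \<eta> * C ^ k)"
  proof (rule sum_mono)
    fix \<pi> assume "\<pi> \<in> ?P"
    then have \<pi>: "\<pi> i < k" if "i < k" for i using permutes_in_image[of \<pi> "{0..<k}" i] that by simp
    have "norm ((\<Prod>i=0..<k. f i (\<pi> i)) - (\<Prod>i=0..<k. g i (\<pi> i))) \<le> (\<Sum>i=0..<k. norm (f i (\<pi> i) - g i (\<pi> i))) * (\<Prod>i=0..<k. C)"
      using assms \<pi> by (intro norm_prod_diff_le) auto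
    also have "\<dots> \<le> (\<Sum>i=0..<k. \<eta>) * (\<Prod>i=0..<k. C)"
      using assms \<pi> by (intro mult_right_mono sum_mono) auto
    finally have "\<bar>(\<Prod>i=0..<k. f i (\<pi> i)) - (\<Prod>i=0..<k. g i (\<pi> i))\<bar> \<le> real k * \<eta> * C ^ k" by simp
    then show "\<bar>signof \<pi> * ((\<Prod>i=0..<k. f i (\<pi> i)) - (\<Prod>i=0..<k. g i (\<pi> i)))\<bar> \<le> real k * \<eta> * C ^ k"
      by (simp add: abs_mult sign_def)
  qed
  also have "\<dots> = fact k * (real k * \<eta> * C ^ k)"
    by (simp add: card_permutations[of "{0..<k}" k])
  finally show ?thesis .
qed

lemma fdet_scale:
  "fdet k (\<lambda>i j. x i * f i j * y j) = (\<Prod>i<k. x i) * (\<Prod>j<k. y j) * fdet k f"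
proof -
  have "(\<Prod>i=0..<k. x i * f i (\<pi> i) * y (\<pi> i)) = (\<Prod>i<k. x i) * (\<Prod>j<k. y j) * (\<Prod>i=0..<k. f i (\<pi> i))"
    if "\<pi> permutes {0..<k}" for \<pi>
  proof -
    have "(\<Prod>i=0..<k. y (\<pi> i)) = (\<Prod>j=0..<k. y j)"
      using prod.permute[OF that, of y] by (simp add: o_def)
    then show ?thesis by (simp add: prod.distrib atLeast0LessThan mult_ac)
  qed
  then show ?thesis
    unfolding fdet_leibniz sum_distrib_left by (intro sum.cong) (auto simp: mult_ac)
qed

lemma fdet_mult: "fdet k (\<lambda>i j. \<Sum>l<k. A i l * B l j) = fdet k A * fdet k B"
proof -
  have "Matrix.mat k k (\<lambda>(i, j). \<Sum>l<k. A i l * B l j) = Matrix.mat k k (\<lambda>(i, j). A i j) * Matrix.mat k k (\<lambda>(i, j). B i j)"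
    by (intro eq_matI) (auto simp: scalar_prod_def atLeast0LessThan)
  then show ?thesis unfolding fdet_def by (simp add: Determinant.det_mult[of _ k])
qed

lemma fdet_lower_unitriangular:
  assumes "\<And>i j. i < j \<Longrightarrow> j < k \<Longrightarrow> f i j = 0" "\<And>i. i < k \<Longrightarrow> f i i = 1"
  shows "fdet k f = 1"
  using assms unfolding fdet_def
  by (subst Determinant.det_lower_triangular[of k]) (auto simp: prod_list_diag_prod)

lemma fdet_upper_unitriangular:
  assumes "\<And>i j. j < i \<Longrightarrow> i < k \<Longrightarrow> f i j = 0" "\<And>i. i < k \<Longrightarrow> f i i = 1"
  shows "fdet k f = 1"
proof -
  have "fdet k (\<lambda>i j. f j i) = 1" using assms by (intro fdet_lower_unitriangular)
  then show ?thesis using fdet_transpose[of k f] by simp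
qed

text \<open>Multiplication by \<open>U\<close> subtracts \<open>x 0\<close> times each column from the next one, which clears the first row and leaves a
  Vandermonde matrix in the remaining nodes, with its rows scaled by \<open>x (p + 1) - x 0\<close>.\<close>
lemma fdet_vandermonde_ge:
  fixes x :: "nat \<Rightarrow> real"
  assumes "0 \<le> \<theta>" "\<And>i j. i < j \<Longrightarrow> j < k \<Longrightarrow> \<theta> \<le> x j - x i"
  shows "\<theta> ^ (k choose 2) \<le> fdet k (\<lambda>i j. x i ^ j)"
  using assms(2)
proof (induction k arbitrary: x)
  case (Suc k)
  define U where "U = (\<lambda>l j. if l = j then 1 else if Suc l = j then - x 0 else 0)"
  define f where "f = (\<lambda>i j. \<Sum>l<Suc k. x i ^ l * U l j)"
  have "fdet (Suc k) U = 1" by (rule fdet_upper_unitriangular) (auto simp: U_def)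
  then have 1: "fdet (Suc k) (\<lambda>i j. x i ^ j) = fdet (Suc k) f"
    unfolding f_def fdet_mult by simp
  have f0: "f i 0 = 1" for i
  proof -
    have "f i 0 = (\<Sum>l<Suc k. if l = 0 then 1 else 0)"
      unfolding f_def by (intro sum.cong) (auto simp: U_def)
    then show ?thesis by (simp add: sum.delta)
  qed
  have fS: "f i (Suc j) = (x i - x 0) * x i ^ j" if "j < k" for i j
  proof -
    have "f i (Suc j) = (\<Sum>l<Suc k. (if l = Suc j then x i ^ l else 0) - (if l = j then x 0 * x i ^ l else 0))"
      unfolding f_def by (intro sum.cong) (auto simp: U_def)
    also have "\<dots> = x i ^ Suc j - x 0 * x i ^ j"
      using that unfolding sum_subtractf by (subst (1 2) sum.delta) auto
    finally show ?thesis by (simp add: algebra_simps)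
  qed
  have "fdet (Suc k) f = (\<Sum>j<Suc k. (- 1) ^ (0 + j) * f 0 j * fdet k (\<lambda>p q. f (skip 0 p) (skip j q)))"
    by (rule fdet_expand_row) simp
  also have "\<dots> = (\<Sum>j<Suc k. if j = 0 then fdet k (\<lambda>p q. f (skip 0 p) (skip 0 q)) else 0)"
  proof (rule sum.cong)
    show "(- 1) ^ (0 + j) * f 0 j * fdet k (\<lambda>p q. f (skip 0 p) (skip j q)) =
         (if j = 0 then fdet k (\<lambda>p q. f (skip 0 p) (skip 0 q)) else 0)" if "j \<in> {..<Suc k}" for j
      using that f0 fS[of "j - 1" 0] by (cases j) auto
  qed simp
  also have "\<dots> = fdet k (\<lambda>p q. f (Suc p) (Suc q))"
    by (subst sum.delta) (auto simp: skip_def)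
  also have "\<dots> = fdet k (\<lambda>p q. (x (Suc p) - x 0) * x (Suc p) ^ q * 1)"
    by (intro fdet_cong) (simp add: fS)
  also have "\<dots> = (\<Prod>p<k. x (Suc p) - x 0) * fdet k (\<lambda>p q. x (Suc p) ^ q)"
    by (subst fdet_scale) simp
  finally have 2: "fdet (Suc k) f = (\<Prod>p<k. x (Suc p) - x 0) * fdet k (\<lambda>p q. x (Suc p) ^ q)" .
  have "\<theta> ^ k * \<theta> ^ (k choose 2) \<le> (\<Prod>p<k. x (Suc p) - x 0) * fdet k (\<lambda>p q. x (Suc p) ^ q)"
  proof (rule mult_mono)
    have "(\<Prod>p<k. \<theta>) \<le> (\<Prod>p<k. x (Suc p) - x 0)"
      using Suc.prems assms(1) by (intro prod_mono) auto
    then show "\<theta> ^ k \<le> (\<Prod>p<k. x (Suc p) - x 0)" by simp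
    show "\<theta> ^ (k choose 2) \<le> fdet k (\<lambda>p q. x (Suc p) ^ q)"
      by (rule Suc.IH) (use Suc.prems in auto)
    have "0 \<le> x (Suc p) - x 0" if "p < k" for p
      using Suc.prems[of 0 "Suc p"] assms(1) that by simp
    then show "0 \<le> (\<Prod>p<k. x (Suc p) - x 0)" by (intro prod_nonneg) auto
  qed (use assms in simp)
  moreover have "Suc k choose 2 = k + (k choose 2)" by (simp add: numeral_2_eq_2)
  ultimately show ?case unfolding 1 2 by (simp add: power_add)
qed (simp add: binomial_eq_0)

text \<open>Since \<open>exp (- (\<delta> (j - i))\<^sup>2 / 2)\<close> is \<open>exp (\<delta>\<^sup>2 i j)\<close> up to factors depending on \<open>i\<close> or \<open>j\<close> alone, the determinant
  is a Vandermonde determinant with nodes \<open>exp (\<delta>\<^sup>2 i)\<close>, any two of which differ by at least \<open>\<delta>\<^sup>2\<close>.\<close>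
lemma fdet_gauss_ge:
  fixes \<delta> :: real
  shows "exp (- (\<delta>\<^sup>2 * (\<Sum>i<k. (real i)\<^sup>2))) * (\<delta>\<^sup>2) ^ (k choose 2)
     \<le> fdet k (\<lambda>i j. exp (- (\<delta> * (real j - real i))\<^sup>2 / 2))"
proof -
  have "fdet k (\<lambda>i j. exp (- (\<delta> * (real j - real i))\<^sup>2 / 2)) =
    fdet k (\<lambda>i j. exp (- (\<delta>\<^sup>2 * (real i)\<^sup>2 / 2)) * exp (\<delta>\<^sup>2 * real i) ^ j * exp (- (\<delta>\<^sup>2 * (real j)\<^sup>2 / 2)))"
    by (intro fdet_cong) (simp add: exp_of_nat_mult[symmetric] exp_add[symmetric] power2_eq_square field_simps)
  also have "\<dots> = (\<Prod>i<k. exp (- (\<delta>\<^sup>2 * (real i)\<^sup>2 / 2))) * (\<Prod>i<k. exp (- (\<delta>\<^sup>2 * (real i)\<^sup>2 / 2))) * fdet k (\<lambda>i j. exp (\<delta>\<^sup>2 * real i) ^ j)"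
    by (rule fdet_scale)
  also have "(\<Prod>i<k. exp (- (\<delta>\<^sup>2 * (real i)\<^sup>2 / 2))) * (\<Prod>i<k. exp (- (\<delta>\<^sup>2 * (real i)\<^sup>2 / 2)))
     = exp (- (\<delta>\<^sup>2 * (\<Sum>i<k. (real i)\<^sup>2)))"
    by (simp add: exp_sum[symmetric] exp_add[symmetric] sum_negf sum_distrib_left sum.distrib[symmetric])
  also have "exp (- (\<delta>\<^sup>2 * (\<Sum>i<k. (real i)\<^sup>2))) * (\<delta>\<^sup>2) ^ (k choose 2) \<le> exp (- (\<delta>\<^sup>2 * (\<Sum>i<k. (real i)\<^sup>2))) * fdet k (\<lambda>i j. exp (\<delta>\<^sup>2 * real i) ^ j)"
  proof (intro mult_left_mono fdet_vandermonde_ge)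
    fix i j :: nat assume "i < j"
    then have "\<delta>\<^sup>2 * 1 \<le> \<delta>\<^sup>2 * (real j - real i)" by (intro mult_left_mono) auto
    also have "\<dots> \<le> exp (\<delta>\<^sup>2 * (real j - real i)) - 1"
      using exp_ge_add_one_self[of "\<delta>\<^sup>2 * (real j - real i)"] by linarith
    also have "\<dots> \<le> exp (\<delta>\<^sup>2 * real i) * (exp (\<delta>\<^sup>2 * (real j - real i)) - 1)"
      using mult_right_mono[of 1 "exp (\<delta>\<^sup>2 * real i)" "exp (\<delta>\<^sup>2 * (real j - real i)) - 1"] \<open>i < j\<close> by simp
    also have "\<dots> = exp (\<delta>\<^sup>2 * real j) - exp (\<delta>\<^sup>2 * real i)"
      by (simp add: algebra_simps exp_add[symmetric])
    finally show "\<delta>\<^sup>2 \<le> exp (\<delta>\<^sup>2 * real j) - exp (\<delta>\<^sup>2 * real i)" by simp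
  qed auto
  finally show ?thesis .
qed

text \<open>In the expansion over permutations every term other than the diagonal one contains an entry of size at most \<open>\<epsilon>\<close>.\<close>
lemma fdet_near_identity_pos:
  fixes f :: "nat \<Rightarrow> nat \<Rightarrow> real"
  assumes diag: "\<And>i. i < k \<Longrightarrow> f i i = 1"
    and off: "\<And>i j. i < k \<Longrightarrow> j < k \<Longrightarrow> i \<noteq> j \<Longrightarrow> 0 \<le> f i j \<and> f i j \<le> \<epsilon>"
    and \<epsilon>: "0 \<le> \<epsilon>" "\<epsilon> \<le> 1" "fact k * \<epsilon> < 1"
  shows "fdet k f > 0"
proof -
  let ?P = "{\<pi>. \<pi> permutes {0..<k}}"
  let ?t = "\<lambda>\<pi>. signof \<pi> * (\<Prod>i=0..<k. f i (\<pi> i))"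
  have fin: "finite ?P" by (rule finite_permutations) simp
  have id: "id \<in> ?P" by (simp add: permutes_id)
  have f1: "0 \<le> f i j \<and> f i j \<le> 1" if "i < k" "j < k" for i j
    using diag off \<epsilon> that by (cases "i = j") (auto intro: order_trans)
  have small: "- \<epsilon> \<le> ?t \<pi>" if \<pi>: "\<pi> \<in> ?P" "\<pi> \<noteq> id" for \<pi>
  proof -
    have lt: "\<pi> i < k" if "i < k" for i using permutes_in_image[of \<pi> "{0..<k}" i] \<pi> that by simp
    obtain i where i: "\<pi> i \<noteq> i" using \<pi> by fastforce
    then have ik: "i < k" using \<pi> unfolding permutes_def by force
    have "(\<Prod>i=0..<k. f i (\<pi> i)) = f i (\<pi> i) * (\<Prod>j\<in>{0..<k} - {i}. f j (\<pi> j))"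
      using ik by (intro prod.remove) auto
    also have "\<dots> \<le> \<epsilon> * 1"
      using off[OF ik lt[OF ik]] i f1 lt \<epsilon> by (intro mult_mono prod_le_1 prod_nonneg) auto
    finally have "(\<Prod>i=0..<k. f i (\<pi> i)) \<le> \<epsilon>" by simp
    moreover have "0 \<le> (\<Prod>i=0..<k. f i (\<pi> i))" using f1 lt by (intro prod_nonneg) auto
    ultimately show ?thesis by (simp add: sign_def)
  qed
  have "fdet k f = ?t id + (\<Sum>\<pi>\<in>?P - {id}. ?t \<pi>)"
    unfolding fdet_leibniz using fin id by (rule sum.remove)
  also have "?t id = 1" using diag by (simp add: sign_id)
  finally have "fdet k f = 1 + (\<Sum>\<pi>\<in>?P - {id}. ?t \<pi>)" .
  moreover have "(\<Sum>\<pi>\<in>?P - {id}. - \<epsilon>) \<le> (\<Sum>\<pi>\<in>?P - {id}. ?t \<pi>)"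
    using small by (intro sum_mono) auto
  moreover have "(\<Sum>\<pi>\<in>?P. \<epsilon>) = fact k * \<epsilon>" by (simp add: card_permutations[of "{0..<k}" k])
  moreover have "(\<Sum>\<pi>\<in>?P. \<epsilon>) = \<epsilon> + (\<Sum>\<pi>\<in>?P - {id}. \<epsilon>)" using fin id by (rule sum.remove)
  ultimately show ?thesis using \<epsilon> unfolding sum_negf by linarith
qed

section \<open>Mixed differences of Toeplitz matrices\<close>

lemma alternating_binomial_power_sum:
  "a < p \<Longrightarrow> (\<Sum>i\<le>p. (-1) ^ i * of_nat (p choose i) * of_nat i ^ a) = (0 :: 'a::comm_ring_1)"
proof (induction p arbitrary: a)
  case (Suc p)
  show ?case
  proof (cases a)
    case 0
    have "(\<Sum>i\<le>Suc p. (-1) ^ i * of_nat (Suc p choose i)) = (0 :: 'a)"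
      by (rule choose_alternating_sum) simp
    then show ?thesis using 0 by simp
  next
    case (Suc b)
    have b: "b < p" using Suc.prems Suc by simp
    have "(\<Sum>i\<le>Suc p. (-1) ^ i * of_nat (Suc p choose i) * of_nat i ^ a) =
        (\<Sum>i\<le>p. (-1) ^ Suc i * of_nat (Suc p choose Suc i) * of_nat (Suc i) ^ a :: 'a)"
      unfolding sum.atMost_Suc_shift by (simp add: Suc)
    also have "\<dots> = (\<Sum>i\<le>p. \<Sum>c\<le>b. - of_nat (Suc p) * of_nat (b choose c) * ((-1) ^ i * of_nat (p choose i) * of_nat i ^ c))"
    proof (rule sum.cong)
      fix i
      have absorb: "of_nat (Suc p choose Suc i) * of_nat (Suc i) = (of_nat (Suc p) * of_nat (p choose i) :: 'a)"
        unfolding of_nat_mult[symmetric] by (subst Suc_times_binomial_eq) simp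
      have regroup: "(-1) ^ Suc i * A * B ^ Suc b = - ((-1) ^ i * ((A * B) * B ^ b))" for A B :: 'a
        by (simp add: mult_ac)
      have "of_nat (Suc i) = (of_nat i + 1 :: 'a)" by simp
      then have "(-1) ^ Suc i * of_nat (Suc p choose Suc i) * of_nat (Suc i) ^ a
        = - of_nat (Suc p) * ((-1) ^ i * of_nat (p choose i)) * (of_nat i + 1 :: 'a) ^ b"
        unfolding Suc regroup absorb by (simp add: mult_ac del: of_nat_Suc)
      also have "\<dots> = - of_nat (Suc p) * ((-1) ^ i * of_nat (p choose i)) * (\<Sum>c\<le>b. of_nat (b choose c) * of_nat i ^ c)"
        by (subst binomial_ring) simp
      finally show "(-1) ^ Suc i * of_nat (Suc p choose Suc i) * of_nat (Suc i) ^ a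
        = (\<Sum>c\<le>b. - of_nat (Suc p) * of_nat (b choose c) * ((-1) ^ i * of_nat (p choose i) * of_nat i ^ c :: 'a))"
        by (simp add: sum_distrib_left mult_ac)
    qed simp
    also have "\<dots> = (\<Sum>c\<le>b. - of_nat (Suc p) * of_nat (b choose c) * (\<Sum>i\<le>p. (-1) ^ i * of_nat (p choose i) * of_nat i ^ c))"
      by (subst sum.swap) (simp add: sum_distrib_left)
    also have "\<dots> = 0"
      using b by (intro sum.neutral) (simp add: Suc.IH)
    finally show ?thesis .
  qed
qed simp

text \<open>The coefficients of the \<open>p\<close>-th forward difference at \<open>0\<close>.\<close>
definition dcoef :: "nat \<Rightarrow> nat \<Rightarrow> 'a::comm_ring_1" where
  "dcoef p i = (-1) ^ (p + i) * of_nat (p choose i)"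

lemma dcoef_annihilates:
  assumes "a < p" "p < k"
  shows "(\<Sum>i<k. dcoef p i * of_nat i ^ a) = (0 :: 'a::comm_ring_1)"
proof -
  have "(\<Sum>i<k. dcoef p i * of_nat i ^ a) = (\<Sum>i\<le>p. dcoef p i * of_nat i ^ a :: 'a)"
    using assms by (intro sum.mono_neutral_right) (auto simp: dcoef_def binomial_eq_0)
  also have "\<dots> = (-1) ^ p * (\<Sum>i\<le>p. (-1) ^ i * of_nat (p choose i) * of_nat i ^ a)"
    by (simp add: dcoef_def power_add sum_distrib_left mult_ac)
  finally show ?thesis using alternating_binomial_power_sum[OF assms(1), where 'a = 'a] by simp
qed

lemma sum_norm_dcoef_le:
  assumes "p < k"
  shows "(\<Sum>i<k. norm (dcoef p i :: 'a::real_normed_field)) \<le> 2 ^ k"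
proof -
  have "norm (dcoef p i :: 'a) = real (p choose i)" for i
    by (simp add: dcoef_def norm_mult norm_power)
  then have "(\<Sum>i<k. norm (dcoef p i :: 'a)) = (\<Sum>i\<le>p. real (p choose i))"
    using assms by (auto simp: binomial_eq_0 intro!: sum.mono_neutral_right)
  also have "\<dots> = 2 ^ p" by (simp only: of_nat_sum[symmetric] choose_row_sum) simp
  also have "\<dots> \<le> 2 ^ k" using assms by (intro power_increasing) auto
  finally show ?thesis .
qed

text \<open>The \<open>p\<close>-th difference in the row index and the \<open>q\<close>-th difference in the column index of the matrix
  \<open>h (j - i)\<close>.\<close>
definition mixed_diff :: "nat \<Rightarrow> nat \<Rightarrow> nat \<Rightarrow> (real \<Rightarrow> 'a) \<Rightarrow> 'a::real_normed_field" where
  "mixed_diff k p q h = (\<Sum>i<k. \<Sum>j<k. dcoef p i * dcoef q j * h (real j - real i))"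

text \<open>Taking differences multiplies the matrix from both sides by unitriangular matrices.\<close>
lemma fdet_mixed_diff:
  fixes h :: "real \<Rightarrow> 'a::real_normed_field"
  shows "fdet k (\<lambda>p q. mixed_diff k p q h) = fdet k (\<lambda>i j. h (real j - real i))"
proof -
  have "fdet k (\<lambda>p q. mixed_diff k p q h) =
      fdet k (\<lambda>p q. \<Sum>i<k. dcoef p i * (\<Sum>j<k. h (real j - real i) * dcoef q j))"
    by (intro fdet_cong) (simp add: mixed_diff_def sum_distrib_left mult_ac)
  also have "\<dots> = fdet k (dcoef :: nat \<Rightarrow> nat \<Rightarrow> 'a) * (fdet k (\<lambda>i j. h (real j - real i)) * fdet k (\<lambda>i j. dcoef j i))"
    by (simp only: fdet_mult)
  also have "fdet k (dcoef :: nat \<Rightarrow> nat \<Rightarrow> 'a) = 1"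
    by (rule fdet_lower_unitriangular) (auto simp: dcoef_def binomial_eq_0 simp flip: mult_2)
  also have "fdet k (\<lambda>i j. dcoef j i :: 'a) = 1"
    by (rule fdet_upper_unitriangular) (auto simp: dcoef_def binomial_eq_0 simp flip: mult_2)
  finally show ?thesis by simp
qed

text \<open>Every monomial of \<open>(j - i) ^ l\<close> has degree below \<open>p\<close> in \<open>i\<close> or below \<open>q\<close> in \<open>j\<close>.\<close>
lemma mixed_diff_power:
  assumes "p < k" "q < k" "l < p + q"
  shows "mixed_diff k p q (\<lambda>t. of_real t ^ l) = (0 :: 'a::real_normed_field)"
proof -
  have "mixed_diff k p q (\<lambda>t. of_real t ^ l) =
      (\<Sum>i<k. \<Sum>j<k. \<Sum>c\<le>l. (of_nat (l choose c) * (-1) ^ (l - c)) * ((dcoef p i * of_nat i ^ (l - c)) * (dcoef q j * of_nat j ^ c)) :: 'a)"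
    unfolding mixed_diff_def
  proof (intro sum.cong refl)
    fix i j
    have "(of_real (real j - real i) :: 'a) ^ l = (of_nat j + (- of_nat i)) ^ l" by simp
    also have "\<dots> = (\<Sum>c\<le>l. of_nat (l choose c) * of_nat j ^ c * (- of_nat i) ^ (l - c))"
      by (rule binomial_ring)
    also have "\<dots> = (\<Sum>c\<le>l. of_nat (l choose c) * of_nat j ^ c * ((-1) ^ (l - c) * of_nat i ^ (l - c)))"
      by (simp only: power_minus[of "of_nat i"])
    finally show "dcoef p i * dcoef q j * (of_real (real j - real i) :: 'a) ^ l =
      (\<Sum>c\<le>l. (of_nat (l choose c) * (-1) ^ (l - c)) * ((dcoef p i * of_nat i ^ (l - c)) * (dcoef q j * of_nat j ^ c)))"
      by (simp add: sum_distrib_left mult_ac)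
  qed
  also have "\<dots> = (\<Sum>i<k. \<Sum>c\<le>l. \<Sum>j<k. (of_nat (l choose c) * (-1) ^ (l - c)) * ((dcoef p i * of_nat i ^ (l - c)) * (dcoef q j * of_nat j ^ c)))"
    by (intro sum.cong refl sum.swap)
  also have "\<dots> = (\<Sum>c\<le>l. \<Sum>i<k. \<Sum>j<k. (of_nat (l choose c) * (-1) ^ (l - c)) * ((dcoef p i * of_nat i ^ (l - c)) * (dcoef q j * of_nat j ^ c)))"
    by (rule sum.swap)
  also have "\<dots> = (\<Sum>c\<le>l. (of_nat (l choose c) * (-1) ^ (l - c)) *
      ((\<Sum>i<k. dcoef p i * of_nat i ^ (l - c)) * (\<Sum>j<k. dcoef q j * of_nat j ^ c)))"
    by (intro sum.cong refl, subst sum_product, simp only: sum_distrib_left)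
  also have "\<dots> = 0"
  proof (intro sum.neutral ballI)
    fix c assume "c \<in> {..l}"
    then have "l - c < p \<or> c < q" using assms by auto
    then have "(\<Sum>i<k. dcoef p i * of_nat i ^ (l - c)) * (\<Sum>j<k. dcoef q j * of_nat j ^ c) = (0 :: 'a)"
      using dcoef_annihilates[of "l - c" p k] dcoef_annihilates[of c q k] assms by auto
    then show "(of_nat (l choose c) * (-1) ^ (l - c)) *
      ((\<Sum>i<k. dcoef p i * of_nat i ^ (l - c)) * (\<Sum>j<k. dcoef q j * of_nat j ^ c)) = (0 :: 'a)" by simp
  qed
  finally show ?thesis .
qed

lemma norm_mixed_diff_le:
  assumes "p < k" "q < k" "\<And>i j. i < k \<Longrightarrow> j < k \<Longrightarrow> norm (h (real j - real i)) \<le> B"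
  shows "norm (mixed_diff k p q h) \<le> 4 ^ k * B"
proof -
  have B: "0 \<le> B" using assms(3)[of 0 0] assms(1) by (auto intro: order_trans[OF norm_ge_zero])
  have "norm (mixed_diff k p q h) \<le> (\<Sum>i<k. \<Sum>j<k. norm (dcoef p i :: 'a) * norm (dcoef q j :: 'a) * B)"
    unfolding mixed_diff_def
    using assms by (intro sum_norm_le) (auto simp: norm_mult intro!: mult_left_mono)
  also have "\<dots> = (\<Sum>i<k. norm (dcoef p i :: 'a)) * (\<Sum>j<k. norm (dcoef q j :: 'a)) * B"
    by (subst sum_product) (simp only: sum_distrib_right)
  also have "\<dots> \<le> 2 ^ k * 2 ^ k * B"
    using assms B by (intro mult_right_mono mult_mono sum_norm_dcoef_le sum_nonneg) auto
  also have "2 ^ k * 2 ^ k = (4::real) ^ k" by (simp flip: power_mult_distrib)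
  finally show ?thesis .
qed

text \<open>On the scale \<open>\<delta>\<close> the mixed difference of an entire function is of order \<open>\<delta> ^ (p + q)\<close>: the powers below
  \<open>p + q\<close> of its Taylor series contribute nothing, and the Cauchy estimates on the circle of radius \<open>X\<close> turn the rest
  into a geometric series of ratio at most \<open>1 / 2\<close>.  The constant is proportional to the bound \<open>\<eta>\<close> on the function, which
  makes the estimate useful for the difference of two functions that are close to each other.\<close>
lemma mixed_diff_entire_le:
  assumes hol: "H holomorphic_on UNIV" and bound: "\<And>z. norm z = X \<Longrightarrow> norm (H z) \<le> \<eta>"
    and X: "0 < X" "2 * real k * \<delta> \<le> X" and \<delta>: "0 \<le> \<delta>" and pq: "p < k" "q < k"
  shows "norm (mixed_diff k p q (\<lambda>t. H (of_real (\<delta> * t)))) \<le> 2 * 4 ^ k * \<eta> * (real k * \<delta> / X) ^ (p + q)"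
proof -
  define h where "h = (\<lambda>l. (deriv ^^ l) H 0 / fact l)"
  define \<theta> where "\<theta> = real k * \<delta> / X"
  have \<theta>: "0 \<le> \<theta>" "\<theta> \<le> 1 / 2" using X \<delta> by (auto simp: \<theta>_def field_simps)
  have \<eta>: "0 \<le> \<eta>" using bound[of "of_real X"] X by (auto intro: order_trans[OF norm_ge_zero])
  have h: "norm (h l) \<le> \<eta> / X ^ l" for l
  proof -
    have "norm ((deriv ^^ l) H 0) \<le> fact l * \<eta> / X ^ l"
    proof (rule Cauchy_inequality)
      show "H holomorphic_on ball 0 X" using hol by (rule holomorphic_on_subset) auto
      show "continuous_on (cball 0 X) H"
        using hol by (intro holomorphic_on_imp_continuous_on) (auto intro: holomorphic_on_subset)
    qed (use X bound in auto)
    then show ?thesis by (simp add: h_def norm_divide field_simps)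
  qed
  have sums: "(\<lambda>l. h l * z ^ l) sums H z" for z
  proof -
    have "H holomorphic_on ball 0 (norm z + 1)" using hol by (rule holomorphic_on_subset) auto
    from holomorphic_power_series[OF this, of z] show ?thesis by (simp add: h_def)
  qed
  have "(\<lambda>l. dcoef p i * dcoef q j * (h l * of_real (\<delta> * (real j - real i)) ^ l)) sums
      (dcoef p i * dcoef q j * H (of_real (\<delta> * (real j - real i))))" for i j
    by (intro sums_mult sums)
  then have "(\<lambda>l. \<Sum>i<k. \<Sum>j<k. dcoef p i * dcoef q j * (h l * of_real (\<delta> * (real j - real i)) ^ l)) sums
      mixed_diff k p q (\<lambda>t. H (of_real (\<delta> * t)))"
    unfolding mixed_diff_def by (intro sums_sum) auto
  moreover have "(\<Sum>i<k. \<Sum>j<k. dcoef p i * dcoef q j * (h l * of_real (\<delta> * (real j - real i)) ^ l)) =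
     h l * of_real \<delta> ^ l * mixed_diff k p q (\<lambda>t. of_real t ^ l)" for l
    unfolding mixed_diff_def sum_distrib_left by (intro sum.cong refl) (simp add: power_mult_distrib)
  ultimately have S: "(\<lambda>l. h l * of_real \<delta> ^ l * mixed_diff k p q (\<lambda>t. of_real t ^ l)) sums
      mixed_diff k p q (\<lambda>t. H (of_real (\<delta> * t)))" (is "?t sums _") by simp
  have term_le: "norm (?t l) \<le> 4 ^ k * \<eta> * \<theta> ^ l" for l
  proof -
    have "norm (mixed_diff k p q (\<lambda>t. of_real t ^ l) :: complex) \<le> 4 ^ k * real k ^ l"
      using pq by (intro norm_mixed_diff_le) (auto simp: norm_power simp flip: of_real_diff intro!: power_mono)
    then have "norm (?t l) \<le> \<eta> / X ^ l * \<delta> ^ l * (4 ^ k * real k ^ l)"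
      unfolding norm_mult using h[of l] \<delta> X \<eta>
      by (intro mult_mono) (auto simp: norm_power intro!: divide_nonneg_nonneg)
    also have "\<dots> = 4 ^ k * \<eta> * \<theta> ^ l" by (simp add: \<theta>_def power_mult_distrib power_divide mult_ac)
    finally show ?thesis .
  qed
  have term_0: "?t l = 0" if "l < p + q" for l using mixed_diff_power[OF pq that, where 'a = complex] by simp
  have "(\<lambda>l. ?t (l + (p + q))) sums (mixed_diff k p q (\<lambda>t. H (of_real (\<delta> * t))) - (\<Sum>l<p + q. ?t l))"
    using S by (rule sums_split_initial_segment)
  then have S': "(\<lambda>l. ?t (l + (p + q))) sums mixed_diff k p q (\<lambda>t. H (of_real (\<delta> * t)))"
    using term_0 by (simp del: mult_eq_0_iff)
  have geo: "(\<lambda>l. 4 ^ k * \<eta> * \<theta> ^ (p + q) * \<theta> ^ l) sums (4 ^ k * \<eta> * \<theta> ^ (p + q) * (1 / (1 - \<theta>)))"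
    using \<theta> by (intro sums_mult geometric_sums) auto
  have "norm (\<Sum>l. ?t (l + (p + q))) \<le> (\<Sum>l. 4 ^ k * \<eta> * \<theta> ^ (p + q) * \<theta> ^ l)"
  proof (rule norm_suminf_le)
    show "norm (?t (l + (p + q))) \<le> 4 ^ k * \<eta> * \<theta> ^ (p + q) * \<theta> ^ l" for l
      using term_le[of "l + (p + q)"] by (simp only: power_add mult_ac)
  qed (use geo sums_summable in blast)
  then have "norm (mixed_diff k p q (\<lambda>t. H (of_real (\<delta> * t)))) \<le> 4 ^ k * \<eta> * \<theta> ^ (p + q) * (1 / (1 - \<theta>))"
    using S' geo by (simp only: sums_unique[symmetric])
  also have "\<dots> \<le> 4 ^ k * \<eta> * \<theta> ^ (p + q) * 2"
    using \<theta> \<eta> by (intro mult_left_mono) (auto simp: field_simps)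
  finally show ?thesis by (simp add: \<theta>_def mult_ac)
qed

section \<open>Weierstrass products and the Gaussian\<close>

lemma norm_weierstrass_factor_le:
  fixes y :: complex
  shows "norm ((1 + y) * exp (- y)) \<le> exp ((norm y)\<^sup>2 / 2)"
proof -
  have "(norm (1 + y))\<^sup>2 = 1 + (2 * Re y + (norm y)\<^sup>2)"
    unfolding cmod_power2 by (simp add: power2_eq_square algebra_simps)
  also have "\<dots> \<le> exp (2 * Re y + (norm y)\<^sup>2)" by (rule exp_ge_add_one_self)
  finally have "(norm (1 + y))\<^sup>2 * (exp (- Re y))\<^sup>2 \<le> exp (2 * Re y + (norm y)\<^sup>2) * (exp (- Re y))\<^sup>2"
    by (intro mult_right_mono) auto
  also have "\<dots> = (exp ((norm y)\<^sup>2 / 2))\<^sup>2"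
    by (simp add: power2_eq_square exp_add[symmetric] mult_exp_exp)
  finally have "(norm (1 + y) * exp (- Re y))\<^sup>2 \<le> (exp ((norm y)\<^sup>2 / 2))\<^sup>2" by (simp add: power_mult_distrib)
  then have "norm (1 + y) * exp (- Re y) \<le> exp ((norm y)\<^sup>2 / 2)"
    by (rule power2_le_imp_le) simp
  then show ?thesis by (simp add: norm_mult)
qed

lemma norm_gauss_factor_le:
  fixes y :: complex
  shows "norm (exp (- (y\<^sup>2 / 2))) \<le> exp ((norm y)\<^sup>2 / 2)"
proof -
  have "norm (exp (- (y\<^sup>2 / 2))) = exp (Re (- (y\<^sup>2 / 2)))" by (rule norm_exp_eq_Re)
  also have "Re (- (y\<^sup>2 / 2)) \<le> norm (- (y\<^sup>2 / 2))" by (rule complex_Re_le_cmod)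
  also have "norm (- (y\<^sup>2 / 2)) = (norm y)\<^sup>2 / 2" by (simp add: norm_divide norm_power)
  finally show ?thesis by simp
qed

text \<open>Both functions have the Taylor polynomial \<open>1 - y\<^sup>2 / 2\<close> of degree two.\<close>
lemma norm_weierstrass_gauss_diff_le:
  fixes y :: complex
  assumes "norm y \<le> 1"
  shows "norm ((1 + y) * exp (- y) - exp (- (y\<^sup>2 / 2))) \<le> 8 * norm y ^ 3"
proof -
  have e: "exp (1::real) \<le> 3" by (rule exp_le)
  have "norm (exp (- y) - (\<Sum>i\<le>2. (- y) ^ i / fact i)) \<le> exp (norm (- y)) * norm (- y) ^ Suc 2 / fact 2"
    by (rule Taylor_exp_field)
  also have "\<dots> \<le> 3 * norm y ^ 3 / 2"
    using assms e order_trans[of "exp (norm y)" "exp 1" 3] by (auto simp: fact_numeral eval_nat_numeral intro!: mult_right_mono)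
  finally have 1: "norm (exp (- y) - (1 - y + y\<^sup>2 / 2)) \<le> 3 * norm y ^ 3 / 2"
    by (simp add: eval_nat_numeral)
  have n2: "norm (y\<^sup>2 / 2) \<le> 1" using assms by (simp add: norm_divide norm_power power_le_one order_trans[of _ 1])
  have "norm (exp (- (y\<^sup>2 / 2)) - (\<Sum>i\<le>1. (- (y\<^sup>2 / 2)) ^ i / fact i)) \<le> exp (norm (- (y\<^sup>2 / 2))) * norm (- (y\<^sup>2 / 2)) ^ Suc 1 / fact 1"
    by (rule Taylor_exp_field)
  also have "\<dots> \<le> 3 * norm (- (y\<^sup>2 / 2)) ^ 2"
    using n2 e order_trans[of "exp (norm (y\<^sup>2 / 2))" "exp 1" 3] by (auto simp: eval_nat_numeral intro!: mult_right_mono)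
  also have "\<dots> = 3 / 4 * (norm y ^ 3 * norm y)"
    by (simp add: norm_divide norm_mult power_divide eval_nat_numeral)
  also have "\<dots> \<le> 3 / 4 * (norm y ^ 3 * 1)" using assms by (intro mult_left_mono) auto
  finally have 2: "norm (exp (- (y\<^sup>2 / 2)) - (1 - y\<^sup>2 / 2)) \<le> 3 / 4 * norm y ^ 3" by simp
  have "(1 + y) * exp (- y) - exp (- (y\<^sup>2 / 2)) =
     (1 + y) * (exp (- y) - (1 - y + y\<^sup>2 / 2)) + (y ^ 3 / 2 - (exp (- (y\<^sup>2 / 2)) - (1 - y\<^sup>2 / 2)))"
    by (simp add: algebra_simps eval_nat_numeral)
  also have "norm \<dots> \<le> norm ((1 + y) * (exp (- y) - (1 - y + y\<^sup>2 / 2))) + norm (y ^ 3 / 2 - (exp (- (y\<^sup>2 / 2)) - (1 - y\<^sup>2 / 2)))"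
    by (rule norm_triangle_ineq)
  also have "\<dots> \<le> 2 * (3 * norm y ^ 3 / 2) + (norm y ^ 3 / 2 + 3 / 4 * norm y ^ 3)"
  proof (rule add_mono)
    have "norm (1 + y) \<le> 2" using norm_triangle_ineq[of 1 y] assms by simp
    then show "norm ((1 + y) * (exp (- y) - (1 - y + y\<^sup>2 / 2))) \<le> 2 * (3 * norm y ^ 3 / 2)"
      unfolding norm_mult using 1 by (intro mult_mono) auto
    show "norm (y ^ 3 / 2 - (exp (- (y\<^sup>2 / 2)) - (1 - y\<^sup>2 / 2))) \<le> norm y ^ 3 / 2 + 3 / 4 * norm y ^ 3"
    proof -
      have "norm (y ^ 3 / 2) = norm y ^ 3 / 2" by (simp add: norm_divide norm_power)
      then show ?thesis using 2 norm_triangle_ineq4[of "y ^ 3 / 2" "exp (- (y\<^sup>2 / 2)) - (1 - y\<^sup>2 / 2)"] by linarith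
    qed
  qed
  also have "\<dots> \<le> 8 * norm y ^ 3" by (simp add: field_simps)
  finally show ?thesis .
qed

lemma of_real_mixed_diff:
  "of_real (mixed_diff k p q h) = mixed_diff k p q (\<lambda>t. of_real (h t) :: complex)"
  by (simp add: mixed_diff_def dcoef_def)

lemma prod_power_choose_two: "(\<Prod>p<k. x ^ p) = (x :: 'a::comm_monoid_mult) ^ (k choose 2)"
  by (induction k) (auto simp: numeral_2_eq_2 power_add mult.commute)

abbreviation weierstrass_toeplitz :: "'i set \<Rightarrow> ('i \<Rightarrow> real) \<Rightarrow> real \<Rightarrow> nat \<Rightarrow> nat \<Rightarrow> real" where
  "weierstrass_toeplitz J v \<delta> \<equiv> \<lambda>p q.
     \<Prod>j\<in>J. (1 + v j * (\<delta> * (real q - real p))) * exp (- (v j * (\<delta> * (real q - real p))))"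

text \<open>If \<open>\<Sum> (v j)\<^sup>2 = 1\<close> and all \<open>v j\<close> are small, the product of the Weierstrass factors \<open>(1 + v j z) exp (- v j z)\<close> is close to
  \<open>exp (- z\<^sup>2 / 2)\<close> on a large circle, with an error proportional to \<open>max \<bar>v j\<bar>\<close>.  As \<open>\<delta>\<close> tends to \<open>0\<close>, both Toeplitz determinants
  degenerate like \<open>\<delta> ^ (k (k - 1))\<close>.  Passing to mixed differences divides this common factor out entry by entry, and what
  remains differs by a multiple of \<open>\<tau>\<close>, while the Gaussian determinant stays above the constant \<open>c\<close>.  So the comparison
  is uniform in \<open>\<delta>\<close>, however small.\<close>
lemma fdet_weierstrass_pos:
  fixes \<Delta> :: real
  assumes \<Delta>: "0 < \<Delta>"
  obtains \<tau> where "0 < \<tau>"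
    "\<And>J (v :: 'i \<Rightarrow> real) \<delta>. finite J \<Longrightarrow> (\<Sum>j\<in>J. (v j)\<^sup>2) = 1 \<Longrightarrow> (\<And>j. j \<in> J \<Longrightarrow> \<bar>v j\<bar> \<le> \<tau>) \<Longrightarrow>
       0 < \<delta> \<Longrightarrow> \<delta> \<le> \<Delta> \<Longrightarrow>
       0 < fdet k (weierstrass_toeplitz J v \<delta>)"
proof -
  \<comment> \<open>The radius is large enough for the geometric ratio \<open>k \<delta> / X\<close> to be at most \<open>1 / 2\<close> and for \<open>k / X \<le> 1\<close>.\<close>
  define X where "X = 1 + real k + 2 * real k * \<Delta>"
  define E where "E = exp (X\<^sup>2 / 2)"
  define C where "C = 2 * 4 ^ k * E"
  define c where "c = exp (- (\<Delta>\<^sup>2 * (\<Sum>i<k. (real i)\<^sup>2)))"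
  define K where "K = fact k * (real k * (2 * 4 ^ k * (8 * X ^ 3 * E)) * C ^ k)"
  \<comment> \<open>\<open>\<tau> X \<le> 1\<close> keeps the cubic estimate valid on the circle; \<open>K \<tau> < c\<close> makes the error smaller than the Gaussian determinant.\<close>
  define \<tau> where "\<tau> = min (1 / X) (c / (K + 1))"
  have "0 \<le> 2 * real k * \<Delta>" using \<Delta> by simp
  then have X: "1 \<le> X" "0 < X" "real k \<le> X" "2 * real k * \<Delta> \<le> X" unfolding X_def by linarith+
  have E: "1 \<le> E" by (simp add: E_def)
  have "1 * 1 \<le> (4 ^ k * E :: real)" using E by (intro mult_mono) auto
  then have C: "1 \<le> C" by (simp add: C_def)
  have K: "0 \<le> K" using X E C by (simp add: K_def)
  have c: "0 < c" by (simp add: c_def)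
  have \<tau>: "0 < \<tau>" using X K c by (simp add: \<tau>_def)
  have \<tau>X: "\<tau> * X \<le> 1" using X by (simp add: \<tau>_def min_def field_simps)
  have "K * \<tau> \<le> K * (c / (K + 1))" using K by (intro mult_left_mono) (auto simp: \<tau>_def)
  also have "\<dots> < c" using K c by (simp add: field_simps)
  finally have K\<tau>: "K * \<tau> < c" .
  show thesis
  proof (rule that[OF \<tau>])
    fix J :: "'i set" and v :: "'i \<Rightarrow> real" and \<delta> :: real
    assume J: "finite J" and v1: "(\<Sum>j\<in>J. (v j)\<^sup>2) = 1" and v\<tau>: "\<And>j. j \<in> J \<Longrightarrow> \<bar>v j\<bar> \<le> \<tau>"
      and \<delta>: "0 < \<delta>" "\<delta> \<le> \<Delta>"
    define \<alpha> where "\<alpha> = (\<lambda>z j. (1 + of_real (v j) * z) * exp (- (of_real (v j) * z)) :: complex)"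
    define \<beta> where "\<beta> = (\<lambda>z j. exp (- ((of_real (v j) * z)\<^sup>2 / 2)) :: complex)"
    define F where "F = (\<lambda>z. prod (\<alpha> z) J)"
    define G where "G = (\<lambda>z::complex. exp (- (z\<^sup>2 / 2)))"
    define f where "f = (\<lambda>t. \<Prod>j\<in>J. (1 + v j * (\<delta> * t)) * exp (- (v j * (\<delta> * t))))"
    define g where "g = (\<lambda>t. exp (- (\<delta> * t)\<^sup>2 / 2))"
    have G_prod: "G z = prod (\<beta> z) J" for z
    proof -
      have "prod (\<beta> z) J = exp (\<Sum>j\<in>J. - ((of_real (v j) * z)\<^sup>2 / 2))"
        unfolding \<beta>_def using J by (simp add: exp_sum)
      also have "(\<Sum>j\<in>J. - ((of_real (v j) * z)\<^sup>2 / 2)) = - (of_real (\<Sum>j\<in>J. (v j)\<^sup>2) * z\<^sup>2 / 2)"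
        by (simp add: sum_negf sum_divide_distrib sum_distrib_right power_mult_distrib)
      finally show ?thesis by (simp add: v1 G_def)
    qed
    have fF: "complex_of_real (f t) = F (of_real (\<delta> * t))" for t
      by (simp add: f_def F_def \<alpha>_def exp_of_real[symmetric])
    have gG: "complex_of_real (g t) = G (of_real (\<delta> * t))" for t
      by (simp add: g_def G_def exp_of_real[symmetric])
    have holF: "F holomorphic_on UNIV"
      unfolding F_def \<alpha>_def by (intro holomorphic_intros)
    have holG: "G holomorphic_on UNIV"
      unfolding G_def by (intro holomorphic_intros) auto
    define B where "B = (\<lambda>j. exp ((v j)\<^sup>2 * X\<^sup>2 / 2))"
    have prodB: "prod B J = E"
      using J v1 by (simp add: B_def exp_sum[symmetric] E_def sum_divide_distrib[symmetric] sum_distrib_right[symmetric])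
    have \<alpha>B: "norm (\<alpha> z j) \<le> B j" and \<beta>B: "norm (\<beta> z j) \<le> B j" if "norm z = X" for z j
      using norm_weierstrass_factor_le[of "of_real (v j) * z"] norm_gauss_factor_le[of "of_real (v j) * z"] that
      by (auto simp: \<alpha>_def \<beta>_def B_def norm_mult power_mult_distrib)
    have boundF: "norm (F z) \<le> E" if "norm z = X" for z
      unfolding F_def prodB[symmetric] prod_norm[symmetric] using \<alpha>B[OF that] by (intro prod_mono) auto
    have boundG: "norm (G z) \<le> E" if "norm z = X" for z
      unfolding G_prod prodB[symmetric] prod_norm[symmetric] using \<beta>B[OF that] by (intro prod_mono) auto
    have boundFG: "norm (F z - G z) \<le> 8 * X ^ 3 * E * \<tau>" if z: "norm z = X" for z
    proof -
      have "norm (F z - G z) \<le> (\<Sum>j\<in>J. norm (\<alpha> z j - \<beta> z j)) * prod B J"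
        unfolding F_def G_prod
        by (rule norm_prod_diff_le) (use J \<alpha>B[OF z] \<beta>B[OF z] in \<open>auto simp: B_def\<close>)
      also have "(\<Sum>j\<in>J. norm (\<alpha> z j - \<beta> z j)) \<le> (\<Sum>j\<in>J. 8 * X ^ 3 * \<tau> * (v j)\<^sup>2)"
      proof (rule sum_mono)
        fix j assume j: "j \<in> J"
        have y: "norm (of_real (v j) * z) = \<bar>v j\<bar> * X" using z by (simp add: norm_mult)
        have "\<bar>v j\<bar> * X \<le> \<tau> * X" using v\<tau>[OF j] X by (intro mult_right_mono) auto
        then have "norm (\<alpha> z j - \<beta> z j) \<le> 8 * (\<bar>v j\<bar> * X) ^ 3"
          using norm_weierstrass_gauss_diff_le[of "of_real (v j) * z"] \<tau>X unfolding y \<alpha>_def \<beta>_def by linarith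
        also have "\<dots> = 8 * X ^ 3 * \<bar>v j\<bar> * (v j)\<^sup>2" by (simp add: power_mult_distrib eval_nat_numeral)
        also have "\<dots> \<le> 8 * X ^ 3 * \<tau> * (v j)\<^sup>2"
          using v\<tau>[OF j] X by (intro mult_right_mono mult_left_mono) auto
        finally show "norm (\<alpha> z j - \<beta> z j) \<le> 8 * X ^ 3 * \<tau> * (v j)\<^sup>2" .
      qed
      also have "\<dots> = 8 * X ^ 3 * \<tau>" by (simp only: sum_distrib_left[symmetric] v1 mult_1_right)
      finally show ?thesis unfolding prodB using E by (simp add: mult_ac)
    qed
    have k\<delta>: "2 * real k * \<delta> \<le> X"
      using X(4) mult_left_mono[OF \<delta>(2), of "2 * real k"] by simp
    have md: "\<bar>mixed_diff k p q h\<bar> \<le> 2 * 4 ^ k * \<eta> * \<delta> ^ (p + q)"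
      if hol: "H holomorphic_on UNIV" and b: "\<And>z. norm z = X \<Longrightarrow> norm (H z) \<le> \<eta>"
        and hH: "\<And>t. complex_of_real (h t) = H (of_real (\<delta> * t))" and pq: "p < k" "q < k" for H h \<eta> p q
    proof -
      have "\<bar>mixed_diff k p q h\<bar> = norm (complex_of_real (mixed_diff k p q h))" by simp
      also have "\<dots> = norm (mixed_diff k p q (\<lambda>t. H (of_real (\<delta> * t))))"
        unfolding of_real_mixed_diff hH ..
      also have "\<dots> \<le> 2 * 4 ^ k * \<eta> * (real k * \<delta> / X) ^ (p + q)"
        using hol b X(2) k\<delta> \<delta>(1) pq by (intro mixed_diff_entire_le) auto
      also have "\<dots> \<le> 2 * 4 ^ k * \<eta> * \<delta> ^ (p + q)"
      proof (intro mult_left_mono power_mono)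
        show "real k * \<delta> / X \<le> \<delta>" using X \<delta> by (simp add: field_simps)
        show "0 \<le> real k * \<delta> / X" using X \<delta> by simp
        have "0 \<le> \<eta>" using b[of "of_real X"] X by (auto intro: order_trans[OF norm_ge_zero])
        then show "0 \<le> 2 * 4 ^ k * \<eta>" by simp
      qed
      finally show ?thesis .
    qed
    define P where "P = (\<lambda>h p q. mixed_diff k p q h / \<delta> ^ (p + q))"
    have P_det: "fdet k (\<lambda>p q. h (real q - real p)) = (\<delta>\<^sup>2) ^ (k choose 2) * fdet k (P h)" for h :: "real \<Rightarrow> real"
    proof -
      have "fdet k (\<lambda>p q. h (real q - real p)) = fdet k (\<lambda>p q. \<delta> ^ p * P h p q * \<delta> ^ q)"
        unfolding fdet_mixed_diff[symmetric] using \<delta> by (intro fdet_cong) (simp add: P_def power_add)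
      also have "\<dots> = (\<Prod>p<k. \<delta> ^ p) * (\<Prod>p<k. \<delta> ^ p) * fdet k (P h)" by (rule fdet_scale)
      also have "(\<Prod>p<k. \<delta> ^ p) * (\<Prod>p<k. \<delta> ^ p) = (\<delta>\<^sup>2) ^ (k choose 2)"
        by (simp add: prod_power_choose_two power2_eq_square power_mult_distrib)
      finally show ?thesis .
    qed
    have "c \<le> fdet k (P g)"
    proof -
      have "exp (- (\<delta>\<^sup>2 * (\<Sum>i<k. (real i)\<^sup>2))) * (\<delta>\<^sup>2) ^ (k choose 2) \<le> (\<delta>\<^sup>2) ^ (k choose 2) * fdet k (P g)"
        unfolding P_det[symmetric] g_def by (rule fdet_gauss_ge)
      then have "exp (- (\<delta>\<^sup>2 * (\<Sum>i<k. (real i)\<^sup>2))) \<le> fdet k (P g)"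
        using \<delta> by (simp add: mult.commute[of "exp _"])
      moreover have "\<delta>\<^sup>2 * (\<Sum>i<k. (real i)\<^sup>2) \<le> \<Delta>\<^sup>2 * (\<Sum>i<k. (real i)\<^sup>2)"
        using \<delta> by (intro mult_right_mono power_mono sum_nonneg) auto
      ultimately show ?thesis unfolding c_def by (meson exp_le_cancel_iff neg_le_iff_le order_trans)
    qed
    moreover have "\<bar>fdet k (P f) - fdet k (P g)\<bar> \<le> fact k * (real k * (2 * 4 ^ k * (8 * X ^ 3 * E * \<tau>)) * C ^ k)"
    proof (rule fdet_diff_le[OF C])
      fix p q assume pq: "p < k" "q < k"
      show "\<bar>P f p q\<bar> \<le> C"
        using md[OF holF boundF fF pq] \<delta> by (simp add: P_def C_def abs_divide field_simps)
      show "\<bar>P g p q\<bar> \<le> C"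
        using md[OF holG boundG gG pq] \<delta> by (simp add: P_def C_def abs_divide field_simps)
      have "\<bar>mixed_diff k p q (\<lambda>t. f t - g t)\<bar> \<le> 2 * 4 ^ k * (8 * X ^ 3 * E * \<tau>) * \<delta> ^ (p + q)"
      proof (rule md[OF _ _ _ pq])
        show "(\<lambda>z. F z - G z) holomorphic_on UNIV" using holF holG by (rule holomorphic_on_diff)
      qed (use boundFG fF gG in auto)
      moreover have "mixed_diff k p q (\<lambda>t. f t - g t) = mixed_diff k p q f - mixed_diff k p q g"
        by (simp add: mixed_diff_def right_diff_distrib sum_subtractf)
      ultimately show "\<bar>P f p q - P g p q\<bar> \<le> 2 * 4 ^ k * (8 * X ^ 3 * E * \<tau>)"
        using \<delta> by (simp add: P_def diff_divide_distrib[symmetric] abs_divide pos_divide_le_eq)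
    qed
    moreover have "fact k * (real k * (2 * 4 ^ k * (8 * X ^ 3 * E * \<tau>)) * C ^ k) = K * \<tau>"
      by (simp add: K_def)
    ultimately have "0 < fdet k (P f)" using K\<tau> by linarith
    then have "0 < fdet k (\<lambda>p q. f (real q - real p))" unfolding P_det using \<delta> by simp
    then show "0 < fdet k (weierstrass_toeplitz J v \<delta>)"
      unfolding f_def .
  qed
qed

text \<open>The difference of the logarithms has derivative \<open>x (R - x) / ((1 + x) (1 + R))\<close>, which has the sign of \<open>x\<close>.\<close>
lemma weierstrass_factor_le:
  fixes x R :: real
  assumes "- 1 < x" "x \<le> R" "0 \<le> R"
  shows "(1 + x) * exp (- x) \<le> exp (- (x\<^sup>2 / (2 * (1 + R))))"
proof -
  define \<phi> where "\<phi> = (\<lambda>x::real. x - ln (1 + x) - x\<^sup>2 / (2 * (1 + R)))"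
  have d: "(\<phi> has_real_derivative (y * (R - y) / ((1 + y) * (1 + R)))) (at y)" if "- 1 < y" for y
  proof -
    have "(\<phi> has_real_derivative (1 - 1 / (1 + y) - 2 * y / (2 * (1 + R)))) (at y)"
      unfolding \<phi>_def using that assms(3) by (auto intro!: derivative_eq_intros)
    also have "1 - 1 / (1 + y) - 2 * y / (2 * (1 + R)) = y * (R - y) / ((1 + y) * (1 + R))"
      using that assms(3) by (simp add: divide_simps) (simp add: algebra_simps)
    finally show ?thesis .
  qed
  have "\<phi> 0 \<le> \<phi> x"
  proof (cases "0 \<le> x")
    case True
    show ?thesis
    proof (rule DERIV_nonneg_imp_nondecreasing[OF True])
      fix y assume "0 \<le> y" "y \<le> x"
      then show "\<exists>d. (\<phi> has_real_derivative d) (at y) \<and> 0 \<le> d"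
        using d[of y] assms by (intro exI[of _ "y * (R - y) / ((1 + y) * (1 + R))"]) auto
    qed
  next
    case False
    then have "x \<le> 0" by simp
    then show ?thesis
    proof (rule DERIV_nonpos_imp_nonincreasing)
      fix y assume "x \<le> y" "y \<le> 0"
      then show "\<exists>d. (\<phi> has_real_derivative d) (at y) \<and> d \<le> 0"
        using d[of y] assms
        by (intro exI[of _ "y * (R - y) / ((1 + y) * (1 + R))"]) (auto intro!: divide_nonpos_pos mult_nonpos_nonneg)
    qed
  qed
  then have "ln (1 + x) + - x \<le> - (x\<^sup>2 / (2 * (1 + R)))" by (simp add: \<phi>_def)
  then have "exp (ln (1 + x) + - x) \<le> exp (- (x\<^sup>2 / (2 * (1 + R))))" by simp
  then show ?thesis using assms(1) unfolding exp_add by simp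
qed

text \<open>Put \<open>u j = 1 / (\<xi> j + n)\<close>, so that \<open>a (n + t) = a n * (\<Prod>j. 1 + u j t)\<close>.  The factor \<open>exp (t * (\<Sum>j. u j))\<close> does not affect
  whether a Toeplitz determinant is positive; without it, the entries are \<open>\<Prod>j. (1 + u j t) exp (- u j t)\<close> and resemble
  \<open>exp (- \<delta>\<^sup>2 t\<^sup>2 / 2)\<close> with \<open>\<delta>\<^sup>2 = (\<Sum>j. (u j)\<^sup>2)\<close>.  For \<open>\<delta> \<ge> \<Delta>\<close> the matrix is close to the identity, also where indices below \<open>0\<close>
  produce zeros.  For \<open>\<delta> < \<Delta>\<close> the multiplicity \<open>m\<close> of every zero gives \<open>u j \<le> \<delta> / sqrt m\<close>.  Applied to the zero at \<open>-1\<close>, this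
  forces \<open>n > r\<close>, so that no index is negative; applied to all zeros, it allows the comparison with the Gaussian.
  The multiplicity needed depends on \<open>r\<close> only, and nothing is asked of the spacing of the zeros.\<close>
theorem PF_seq_linear_product:
  obtains m :: nat where "0 < m"
    "\<And>J (\<xi> :: 'i \<Rightarrow> real). finite J \<Longrightarrow> (\<And>j. j \<in> J \<Longrightarrow> 1 \<le> \<xi> j) \<Longrightarrow> (\<exists>j\<in>J. \<xi> j = 1) \<Longrightarrow>
      (\<And>j. j \<in> J \<Longrightarrow> m \<le> card {i\<in>J. \<xi> i = \<xi> j}) \<Longrightarrow> PF_seq r (\<lambda>n. \<Prod>j\<in>J. 1 + real n / \<xi> j)"
proof -
  define b where "b = 2 * (1 + real r)"
  \<comment> \<open>Chosen so that the bound \<open>\<epsilon>\<close> for the off-diagonal entries satisfies \<open>fact r * \<epsilon> = exp (- 1) < 1\<close>.\<close>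
  define \<Delta> where "\<Delta> = sqrt (b * (ln (fact r) + 1))"
  define \<epsilon> where "\<epsilon> = exp (- (\<Delta>\<^sup>2 / b))"
  have b: "0 < b" by (simp add: b_def)
  have lnr: "0 \<le> ln (fact r :: real)" by (simp add: fact_ge_1)
  have "0 < b * (ln (fact r) + 1)" using b lnr by (intro mult_pos_pos) linarith+
  then have \<Delta>: "0 < \<Delta>" "\<Delta>\<^sup>2 = b * (ln (fact r) + 1)" by (simp_all add: \<Delta>_def)
  have "exp (- (\<Delta>\<^sup>2 / b)) = exp (- ln (fact r)) * exp (- 1)"
    unfolding \<Delta>(2) exp_add[symmetric] using b by (simp add: field_simps)
  then have "fact r * \<epsilon> = exp (- 1)" by (simp add: \<epsilon>_def exp_minus)
  then have \<epsilon>: "0 \<le> \<epsilon>" "\<epsilon> \<le> 1" "fact r * \<epsilon> < 1" using b by (auto simp: \<epsilon>_def)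
  define Q where "Q = (\<lambda>k \<tau>. 0 < \<tau> \<and> (\<forall>J (v :: 'i \<Rightarrow> real) \<delta>. finite J \<longrightarrow> (\<Sum>j\<in>J. (v j)\<^sup>2) = 1 \<longrightarrow> (\<forall>j\<in>J. \<bar>v j\<bar> \<le> \<tau>) \<longrightarrow>
       0 < \<delta> \<longrightarrow> \<delta> \<le> \<Delta> \<longrightarrow>
       0 < fdet k (weierstrass_toeplitz J v \<delta>)))"
  have "\<exists>\<tau>. Q k \<tau>" for k
  proof -
    show ?thesis
    proof (rule fdet_weierstrass_pos[OF \<Delta>(1), where k = k and 'i = 'i])
      fix \<tau> :: real
      assume *: "0 < \<tau>" "\<And>J (v :: 'i \<Rightarrow> real) \<delta>. finite J \<Longrightarrow> (\<Sum>j\<in>J. (v j)\<^sup>2) = 1 \<Longrightarrow> (\<And>j. j \<in> J \<Longrightarrow> \<bar>v j\<bar> \<le> \<tau>) \<Longrightarrow>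
       0 < \<delta> \<Longrightarrow> \<delta> \<le> \<Delta> \<Longrightarrow>
       0 < fdet k (weierstrass_toeplitz J v \<delta>)"
      show "\<exists>\<tau>. Q k \<tau>"
        unfolding Q_def by (intro exI[of _ \<tau>] conjI allI impI *) auto
    qed
  qed
  then obtain \<tau> where \<tau>: "\<And>k. Q k (\<tau> k)" by metis
  define T where "T = Min (\<tau> ` {..r})"
  have T: "0 < T" "\<And>k. k \<le> r \<Longrightarrow> T \<le> \<tau> k"
    using \<tau> by (auto simp: T_def Q_def)
  \<comment> \<open>The first summand yields \<open>u j / \<delta> \<le> T\<close>, the second one \<open>n > r\<close>.\<close>
  obtain m :: nat where m: "1 / T\<^sup>2 + (\<Delta> * (real r + 1))\<^sup>2 < real m" using reals_Archimedean2 by blast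
  have "0 < 1 / T\<^sup>2" "0 < (\<Delta> * (real r + 1))\<^sup>2" using T \<Delta> by auto
  with m have m1: "1 / T\<^sup>2 < real m" and m2: "(\<Delta> * (real r + 1))\<^sup>2 < real m" by linarith+
  have m0: "0 < real m" using m2 by (smt (verit) zero_le_power2)
  show thesis
  proof (rule that)
    show "0 < m" using m0 by simp
    fix J and \<xi> :: "'i \<Rightarrow> real"
    assume J: "finite J" and \<xi>: "\<And>j. j \<in> J \<Longrightarrow> 1 \<le> \<xi> j" and \<xi>1: "\<exists>j\<in>J. \<xi> j = 1"
      and mult: "\<And>j. j \<in> J \<Longrightarrow> m \<le> card {i\<in>J. \<xi> i = \<xi> j}"
    let ?a = "\<lambda>n. \<Prod>j\<in>J. 1 + real n / \<xi> j"
    show "PF_seq r ?a"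
    proof (rule PF_seq_of_solid_minors)
      fix k n assume k: "k \<le> r"
      define u where "u = (\<lambda>j. 1 / (\<xi> j + real n))"
      define S where "S = (\<Sum>j\<in>J. (u j)\<^sup>2)"
      define \<delta> where "\<delta> = sqrt S"
      define e where "e = sum u J"
      define c where "c = (\<lambda>t. \<Prod>j\<in>J. (1 + u j * t) * exp (- (u j * t)))"
      define d where "d = (\<lambda>p q. if p \<le> n + q then c (real q - real p) else 0)"
      have u: "0 < u j" "u j \<le> 1" if "j \<in> J" for j using \<xi>[OF that] by (auto simp: u_def)
      have uS: "real m * (u j)\<^sup>2 \<le> S" if "j \<in> J" for j
      proof -
        have "real m * (u j)\<^sup>2 \<le> (\<Sum>i\<in>{i\<in>J. \<xi> i = \<xi> j}. (u j)\<^sup>2)"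
          using mult[OF that] by (simp add: mult_right_mono)
        also have "\<dots> = (\<Sum>i\<in>{i\<in>J. \<xi> i = \<xi> j}. (u i)\<^sup>2)"
          by (intro sum.cong) (auto simp: u_def)
        also have "\<dots> \<le> S" unfolding S_def using J by (intro sum_mono2) auto
        finally show ?thesis .
      qed
      obtain j0 where j0: "j0 \<in> J" "\<xi> j0 = 1" using \<xi>1 by blast
      have S0: "0 < S" using uS[OF j0(1)] u(1)[OF j0(1)] m0 by (smt (verit) mult_pos_pos zero_less_power)
      have \<delta>: "0 < \<delta>" "\<delta>\<^sup>2 = S" using S0 by (auto simp: \<delta>_def)
      have a0: "0 < ?a l" for l
        using \<xi> by (intro prod_pos ballI) (smt (verit) divide_nonneg_pos of_nat_0_le_iff)
      have shift: "?a (n + q - p) = ?a n * (\<Prod>j\<in>J. 1 + u j * (real q - real p))" if "p \<le> n + q" for p q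
        unfolding prod.distrib[symmetric]
      proof (rule prod.cong)
        fix j assume "j \<in> J"
        then have "0 < \<xi> j" using \<xi> by force
        then have "1 + real n / \<xi> j = (\<xi> j + real n) / \<xi> j" "\<xi> j + real n \<noteq> 0"
          by (simp_all add: field_simps add_pos_nonneg)
        moreover from this(2) have "1 + u j * (real q - real p) = (\<xi> j + real n + (real q - real p)) / (\<xi> j + real n)"
          by (simp add: u_def field_simps)
        moreover have "1 + real (n + q - p) / \<xi> j = (\<xi> j + real n + (real q - real p)) / \<xi> j"
          using that \<open>0 < \<xi> j\<close> by (simp add: of_nat_diff field_simps)
        ultimately show "1 + real (n + q - p) / \<xi> j = (1 + real n / \<xi> j) * (1 + u j * (real q - real p))"
          by simp
      qed simp
      have "fdet k (\<lambda>p q. toeplitz_entry ?a p (n + q)) =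
            fdet k (\<lambda>p q. (?a n * exp (- (e * real p))) * d p q * exp (e * real q))"
      proof (rule fdet_cong)
        fix p q
        have "(\<Prod>j\<in>J. exp (- (u j * (real q - real p)))) = exp (- (e * (real q - real p)))"
          using J by (simp add: exp_sum[symmetric] sum_negf e_def sum_distrib_right)
        then have "c (real q - real p) = (\<Prod>j\<in>J. 1 + u j * (real q - real p)) * exp (- (e * (real q - real p)))"
          by (simp add: c_def prod.distrib)
        then have "exp (- (e * real p)) * c (real q - real p) * exp (e * real q) =
            (\<Prod>j\<in>J. 1 + u j * (real q - real p)) * exp (- (e * real p) + - (e * (real q - real p)) + e * real q)"
          unfolding exp_add by simp
        also have "- (e * real p) + - (e * (real q - real p)) + e * real q = 0" by (simp add: algebra_simps)
        finally show "toeplitz_entry ?a p (n + q) = (?a n * exp (- (e * real p))) * d p q * exp (e * real q)"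
          using shift[of p q] by (auto simp: toeplitz_entry_def d_def mult.assoc)
      qed
      also have "\<dots> = (\<Prod>p<k. ?a n * exp (- (e * real p))) * (\<Prod>q<k. exp (e * real q)) * fdet k d"
        by (rule fdet_scale)
      finally have det_eq: "fdet k (\<lambda>p q. toeplitz_entry ?a p (n + q)) =
        (\<Prod>p<k. ?a n * exp (- (e * real p))) * (\<Prod>q<k. exp (e * real q)) * fdet k d" .
      have "0 < fdet k d"
      proof (cases "\<Delta> \<le> \<delta>")
        case True
        show ?thesis
        proof (rule fdet_near_identity_pos)
          show "d i i = 1" for i by (simp add: d_def c_def)
          have "fact k * \<epsilon> \<le> fact r * \<epsilon>" using k \<epsilon> by (intro mult_right_mono fact_mono) auto
          then show "fact k * \<epsilon> < 1" using \<epsilon> by linarith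
          fix p q assume pq: "p < k" "q < k" "p \<noteq> q"
          show "0 \<le> d p q \<and> d p q \<le> \<epsilon>"
          proof (cases "p \<le> n + q")
            case False
            then show ?thesis using \<epsilon> by (simp add: d_def)
          next
            case le: True
            define t where "t = real q - real p"
            have t: "\<bar>t\<bar> \<le> real r" "1 \<le> t\<^sup>2" "- real n \<le> t"
            proof -
              show "\<bar>t\<bar> \<le> real r" "- real n \<le> t" using pq k le by (auto simp: t_def)
              have "1 \<le> \<bar>t\<bar>" using pq by (auto simp: t_def)
              then show "1 \<le> t\<^sup>2" using power_mono[of 1 "\<bar>t\<bar>" 2] by simp
            qed
            have ut: "- 1 < u j * t" "u j * t \<le> real r" if "j \<in> J" for j
            proof -
              have "0 < \<xi> j + real n" "0 < \<xi> j + real n + t" using \<xi>[OF that] t by linarith+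
              then show "- 1 < u j * t" by (simp add: u_def field_simps)
              have "u j * t \<le> u j * \<bar>t\<bar>" using u[OF that] by (intro mult_left_mono) auto
              also have "\<dots> \<le> 1 * real r" using u[OF that] t by (intro mult_mono) auto
              finally show "u j * t \<le> real r" by simp
            qed
            have ut0: "0 \<le> 1 + u j * t" if "j \<in> J" for j using ut(1)[OF that] by simp
            have "c t \<le> (\<Prod>j\<in>J. exp (- ((u j * t)\<^sup>2 / b)))"
              unfolding c_def b_def using ut
              by (intro prod_mono conjI weierstrass_factor_le mult_nonneg_nonneg ut0) auto
            also have "\<dots> = exp (- (S * t\<^sup>2 / b))"
              using J by (simp add: exp_sum[symmetric] S_def sum_negf sum_divide_distrib sum_distrib_right power_mult_distrib)
            also have "\<dots> \<le> \<epsilon>"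
            proof -
              have "\<Delta>\<^sup>2 * 1 \<le> S * t\<^sup>2"
                unfolding \<delta>(2)[symmetric] using True \<Delta> t by (intro mult_mono power_mono) auto
              then show ?thesis using b by (simp add: \<epsilon>_def divide_right_mono)
            qed
            finally have "c t \<le> \<epsilon>" .
            moreover have "0 \<le> c t"
              unfolding c_def by (intro prod_nonneg ballI mult_nonneg_nonneg ut0) auto
            ultimately show ?thesis using le by (simp add: d_def t_def)
          qed
        qed (use \<epsilon> in auto)
      next
        case False
        then have \<delta>\<Delta>: "\<delta> \<le> \<Delta>" "S < \<Delta>\<^sup>2" using \<delta> power_strict_mono[of \<delta> \<Delta> 2] by auto
        have "(real r + 1)\<^sup>2 < (1 + real n)\<^sup>2"
        proof -
          have "\<Delta>\<^sup>2 * (real r + 1)\<^sup>2 < real m" using m2 by (simp add: power_mult_distrib)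
          also have "real m \<le> S * (1 + real n)\<^sup>2"
            using uS[OF j0(1)] by (simp add: u_def j0(2) power_divide field_simps)
          also have "\<dots> \<le> \<Delta>\<^sup>2 * (1 + real n)\<^sup>2" using \<delta>\<Delta> by (intro mult_right_mono) auto
          finally show ?thesis using \<Delta>(1) by (simp add: mult_less_cancel_left_pos)
        qed
        then have "real r + 1 < 1 + real n" by (rule power_less_imp_less_base) simp
        then have rn: "r < n" by simp
        define v where "v = (\<lambda>j. u j / \<delta>)"
        have "0 < fdet k (weierstrass_toeplitz J v \<delta>)"
        proof -
          have "(\<Sum>j\<in>J. (v j)\<^sup>2) = 1"
            using \<delta> S0 by (simp add: v_def power_divide sum_divide_distrib[symmetric] S_def[symmetric])
          moreover have "\<bar>v j\<bar> \<le> \<tau> k" if "j \<in> J" for j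
          proof -
            have "(v j)\<^sup>2 \<le> 1 / real m"
              using uS[OF that] \<delta> S0 m0 by (simp add: v_def power_divide field_simps)
            also have "\<dots> \<le> T\<^sup>2" using m1 T m0 by (simp add: field_simps)
            finally have "\<bar>v j\<bar> \<le> T" using T(1) abs_le_square_iff[of "v j" T] by simp
            then show ?thesis using T(2)[OF k] by simp
          qed
          ultimately show ?thesis
            by (intro \<tau>[of k, unfolded Q_def, THEN conjunct2, rule_format] J \<delta>(1) \<delta>\<Delta>(1))
        qed
        moreover have "v j * (\<delta> * t) = u j * t" for j t using \<delta> by (simp add: v_def)
        ultimately have "0 < fdet k (\<lambda>p q. c (real q - real p))" by (simp add: c_def)
        moreover have "fdet k (\<lambda>p q. c (real q - real p)) = fdet k d"
          using rn k by (intro fdet_cong) (simp add: d_def)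
        ultimately show ?thesis by simp
      qed
      then show "0 < fdet k (\<lambda>p q. toeplitz_entry ?a p (n + q))"
        unfolding det_eq by (intro mult_pos_pos prod_pos[of "{..<k}"] ballI a0) auto
    qed
  qed
qed

section \<open>Nonnegative Newton expansions\<close>

lemma summable_choose_power:
  fixes x :: real
  assumes "0 \<le> x" "x < 1"
  shows "summable (\<lambda>k. real (k choose n) * x ^ k)"
proof (cases "x = 0")
  case True
  have "summable (\<lambda>k. if k = 0 then real (k choose n) else 0)" by (rule summable_single)
  then show ?thesis using True by (simp add: power_0_left if_distrib cong: if_cong)
next
  case False
  obtain c where c: "x < c" "c < 1" using dense assms by blast
  have "(\<lambda>k. x * (real (Suc k) / real (Suc k - n))) \<longlonglongrightarrow> x * 1"
    by (intro tendsto_intros) real_asymp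
  then have "\<forall>\<^sub>F k in sequentially. x * (real (Suc k) / real (Suc k - n)) < c"
    using c by (intro order_tendstoD) auto
  then have "\<forall>\<^sub>F k in sequentially. x * (real (Suc k) / real (Suc k - n)) < c \<and> n \<le> k"
    using eventually_ge_at_top[of n] by eventually_elim simp
  then obtain K where K: "\<And>k. k \<ge> K \<Longrightarrow> x * (real (Suc k) / real (Suc k - n)) < c \<and> n \<le> k"
    by (auto simp: eventually_at_top_linorder)
  show ?thesis
  proof (rule summable_ratio_test[OF c(2)])
    fix k assume "K \<le> k"
    from K[OF this] have k: "x * (real (Suc k) / real (Suc k - n)) < c" "n \<le> k" by auto
    have "(Suc k - n) * (Suc k choose n) = Suc k * (k choose n)"
      using binomial_absorb_comp[of "Suc k" n] by simp
    then have "real (Suc k - n) * real (Suc k choose n) = real (Suc k) * real (k choose n)"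
      by (metis of_nat_mult)
    then have "real (Suc k choose n) = real (Suc k) / real (Suc k - n) * real (k choose n)"
      using k(2) by (simp add: field_simps)
    then have "real (Suc k choose n) * x ^ Suc k = (x * (real (Suc k) / real (Suc k - n))) * (real (k choose n) * x ^ k)"
      by simp
    also have "\<dots> \<le> c * (real (k choose n) * x ^ k)"
      using k(1) assms by (intro mult_right_mono) auto
    finally show "norm (real (Suc k choose n) * x ^ Suc k) \<le> c * norm (real (k choose n) * x ^ k)"
      using assms by simp
  qed
qed

lemma sums_choose_power:
  fixes z :: "'a :: {real_normed_field, banach}"
  assumes "norm z < 1"
  shows "(\<lambda>k. of_nat (k choose n) * z ^ k) sums (z ^ n / (1 - z) ^ Suc n)"
proof (induction n)
  case 0
  show ?case using geometric_sums[OF assms] by simp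
next
  case (Suc n)
  have z: "1 - z \<noteq> 0" using assms by auto
  have summ: "summable (\<lambda>k. of_nat (k choose j) * z ^ k)" for j
    by (rule summable_norm_cancel, use assms summable_choose_power[of "norm z" j] in \<open>simp add: norm_mult norm_power\<close>)
  define s where "s = (\<Sum>k. of_nat (k choose Suc n) * z ^ k)"
  have s: "(\<lambda>k. of_nat (k choose Suc n) * z ^ k) sums s"
    unfolding s_def using summ by (rule summable_sums)
  have "(\<lambda>k. of_nat (Suc k choose Suc n) * z ^ Suc k) sums (s - of_nat (0 choose Suc n) * z ^ 0)"
    using s by (subst sums_Suc_iff) simp
  then have 1: "(\<lambda>k. of_nat (Suc k choose Suc n) * z ^ Suc k) sums s" by simp
  define X where "X = z ^ n / (1 - z) ^ Suc n"
  have "(\<lambda>k. z * (of_nat (k choose n) * z ^ k + of_nat (k choose Suc n) * z ^ k)) sums (z * (X + s))"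
    unfolding X_def by (intro sums_mult sums_add Suc.IH s)
  moreover have "z * (of_nat (k choose n) * z ^ k + of_nat (k choose Suc n) * z ^ k) = of_nat (Suc k choose Suc n) * z ^ Suc k" for k
    by (simp add: algebra_simps)
  ultimately have "(\<lambda>k. of_nat (Suc k choose Suc n) * z ^ Suc k) sums (z * (X + s))" by (simp only:)
  from sums_unique2[OF 1 this] have "s - z * s = z * (X + s) - z * s" by (rule arg_cong[where f = "\<lambda>w. w - z * s"])
  also have "\<dots> = z * X" by (simp add: distrib_left)
  also have "s - z * s = s * (1 - z)" by (simp add: algebra_simps)
  finally have "s = z * X / (1 - z)" using z by (simp add: eq_divide_eq)
  also have "z * X / (1 - z) = z ^ Suc n / (1 - z) ^ Suc (Suc n)" by (simp add: X_def mult.commute)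
  finally show ?case using s by (simp only:)
qed

text \<open>Nonnegative coefficients in the Newton expansion of \<open>a\<close> at \<open>0\<close>.\<close>
definition binomial_positive :: "(nat \<Rightarrow> real) \<Rightarrow> bool" where
  "binomial_positive a \<longleftrightarrow> (\<exists>b. (\<forall>n. 0 \<le> b n) \<and> (\<forall>k. a k = (\<Sum>n\<le>k. b n * real (k choose n))))"

lemma binomial_positive_one: "binomial_positive (\<lambda>k. 1)"
proof -
  have "(\<Sum>n\<le>k. (if n = 0 then 1 else 0) * real (k choose n)) = 1" for k
    by (simp add: if_distrib[of "\<lambda>x. x * _"] cong: if_cong)
  then show ?thesis unfolding binomial_positive_def
    by (intro exI[of _ "\<lambda>n. if n = 0 then 1 else 0"]) auto
qed

text \<open>From \<open>k * (k choose n) = n * (k choose n) + (n + 1) * (k choose (n + 1))\<close>.\<close>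
lemma binomial_positive_mult_linear:
  assumes "binomial_positive a" "0 \<le> \<epsilon>"
  shows "binomial_positive (\<lambda>k. (1 + real k * \<epsilon>) * a k)"
proof -
  obtain b where b: "\<And>n. 0 \<le> b n" "\<And>k. a k = (\<Sum>n\<le>k. b n * real (k choose n))"
    using assms(1) by (auto simp: binomial_positive_def)
  define b' where "b' = (\<lambda>n. b n + \<epsilon> * (real n * b n + real n * b (n - 1)))"
  have "(1 + real k * \<epsilon>) * a k = (\<Sum>n\<le>k. b' n * real (k choose n))" for k
  proof -
    have "real k * real (k choose n) = real n * real (k choose n) + real (Suc n) * real (k choose Suc n)" for n
    proof (cases "n \<le> k")
      case True
      have "Suc n * (k choose Suc n) = (k - n) * (k choose n)"
        by (metis binomial_absorb_comp binomial_absorption mult.commute)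
      then have "real (Suc n) * real (k choose Suc n) = (real k - real n) * real (k choose n)"
        using True by (metis of_nat_diff of_nat_mult)
      then show ?thesis by (simp add: algebra_simps)
    qed (simp add: binomial_eq_0)
    then have "real k * a k = (\<Sum>n\<le>k. b n * (real n * real (k choose n) + real (Suc n) * real (k choose Suc n)))"
      unfolding b(2) sum_distrib_left by (intro sum.cong) (simp_all add: mult_ac)
    also have "\<dots> = (\<Sum>n\<le>k. real n * b n * real (k choose n)) + (\<Sum>n\<le>k. real (Suc n) * b n * real (k choose Suc n))"
      by (simp add: sum.distrib[symmetric] algebra_simps)
    also have "(\<Sum>n\<le>k. real (Suc n) * b n * real (k choose Suc n)) = (\<Sum>n\<le>Suc k. real n * b (n - 1) * real (k choose n))"
      unfolding sum.atMost_Suc_shift by simp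
    also have "\<dots> = (\<Sum>n\<le>k. real n * b (n - 1) * real (k choose n))" by (simp add: binomial_eq_0)
    finally have "real k * a k = (\<Sum>n\<le>k. (real n * b n + real n * b (n - 1)) * real (k choose n))"
      by (simp add: sum.distrib[symmetric] algebra_simps)
    then have "(1 + real k * \<epsilon>) * a k = (\<Sum>n\<le>k. b n * real (k choose n)) + \<epsilon> * (\<Sum>n\<le>k. (real n * b n + real n * b (n - 1)) * real (k choose n))"
      using b(2)[of k] by (simp add: algebra_simps)
    also have "\<dots> = (\<Sum>n\<le>k. b' n * real (k choose n))"
      unfolding b'_def sum_distrib_left sum.distrib[symmetric] by (intro sum.cong) (simp_all add: algebra_simps)
    finally show ?thesis .
  qed
  moreover have "0 \<le> b' n" for n using b(1) assms(2) by (simp add: b'_def)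
  ultimately show ?thesis unfolding binomial_positive_def by blast
qed

lemma binomial_positive_prod:
  assumes "finite J" "\<And>j. j \<in> J \<Longrightarrow> 0 \<le> \<epsilon> j"
  shows "binomial_positive (\<lambda>k. \<Prod>j\<in>J. 1 + real k * \<epsilon> j)"
  using assms
proof (induction J rule: finite_induct)
  case empty
  show ?case using binomial_positive_one by simp
next
  case (insert j J)
  then have "binomial_positive (\<lambda>k. (1 + real k * \<epsilon> j) * (\<Prod>j\<in>J. 1 + real k * \<epsilon> j))"
    by (intro binomial_positive_mult_linear) auto
  then show ?case using insert by simp
qed

text \<open>The Newton coefficients are determined recursively by the values, so they converge along with them.\<close>
lemma binomial_positive_tendsto:
  assumes pos: "\<And>N. binomial_positive (f N)" and lim: "\<And>k. (\<lambda>N. f N k) \<longlonglongrightarrow> a k"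
  shows "binomial_positive a"
proof -
  have "\<exists>b. \<forall>N. (\<forall>n. 0 \<le> b N n) \<and> (\<forall>k. f N k = (\<Sum>n\<le>k. b N n * real (k choose n)))"
    using pos unfolding binomial_positive_def by (intro choice) blast
  then obtain b where b: "\<And>N n. 0 \<le> b N n" "\<And>N k. f N k = (\<Sum>n\<le>k. b N n * real (k choose n))" by blast
  have "convergent (\<lambda>N. b N n)" for n
  proof (induction n rule: less_induct)
    case (less n)
    have "b N n = f N n - (\<Sum>j<n. b N j * real (n choose j))" for N
      using b(2)[of N n] by (simp add: lessThan_Suc_atMost[symmetric])
    moreover have "convergent (\<lambda>N. f N n - (\<Sum>j<n. b N j * real (n choose j)))"
      using lim less by (intro convergent_diff convergent_sum convergent_mult convergent_const) (auto simp: convergent_def)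
    ultimately show ?case by simp
  qed
  then obtain c where c: "\<And>n. (\<lambda>N. b N n) \<longlonglongrightarrow> c n" unfolding convergent_def by metis
  have "0 \<le> c n" for n using c b(1) by (intro LIMSEQ_le_const[OF c]) auto
  moreover have "a k = (\<Sum>n\<le>k. c n * real (k choose n))" for k
  proof (rule LIMSEQ_unique[OF lim])
    show "(\<lambda>N. f N k) \<longlonglongrightarrow> (\<Sum>n\<le>k. c n * real (k choose n))"
      unfolding b(2) by (intro tendsto_intros c)
  qed
  ultimately show ?thesis unfolding binomial_positive_def by blast
qed

section \<open>Continuation to the complement of the singularity\<close>

text \<open>The substitution \<open>y = v / (1 + v)\<close> turns \<open>\<Sum>k. (k choose n) y ^ k\<close> into \<open>(1 + v) v ^ n\<close>.  All terms being nonnegative, convergence of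
  the power series for every \<open>y < 1\<close> therefore bounds the Newton series for every \<open>v \<ge> 0\<close>.\<close>
lemma binomial_series_partial_sum_le:
  fixes v :: real
  assumes b: "\<And>n. 0 \<le> b n" "\<And>k. a k = (\<Sum>n\<le>k. b n * real (k choose n))"
    and v: "0 \<le> v" and summ: "summable (\<lambda>k. a k * (v / (1 + v)) ^ k)"
  shows "(\<Sum>n<N. b n * v ^ n) * (1 + v) \<le> (\<Sum>k. a k * (v / (1 + v)) ^ k)"
proof -
  define y where "y = v / (1 + v)"
  have y: "0 \<le> y" "y < 1" "1 - y = 1 / (1 + v)" using v by (auto simp: y_def field_simps)
  have "y ^ n / (1 - y) ^ Suc n = v ^ n * (1 + v)" for n
    unfolding y(3) using v by (simp add: y_def power_divide)
  then have "(\<lambda>k. real (k choose n) * y ^ k) sums (v ^ n * (1 + v))" for n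
    using sums_choose_power[of y n] y by simp
  then have "(\<lambda>k. b n * (real (k choose n) * y ^ k)) sums (b n * (v ^ n * (1 + v)))" for n
    by (rule sums_mult)
  then have S: "(\<lambda>k. \<Sum>n<N. b n * (real (k choose n) * y ^ k)) sums (\<Sum>n<N. b n * (v ^ n * (1 + v)))"
    by (rule sums_sum)
  have "(\<Sum>n<N. b n * (v ^ n * (1 + v))) \<le> (\<Sum>k. a k * y ^ k)"
  proof (rule sums_le[OF _ S])
    show "(\<lambda>k. a k * y ^ k) sums (\<Sum>k. a k * y ^ k)" using summ unfolding y_def by (rule summable_sums)
    show "(\<Sum>n<N. b n * (real (k choose n) * y ^ k)) \<le> a k * y ^ k" for k
    proof -
      have "(\<Sum>n<N. b n * real (k choose n)) = (\<Sum>n\<in>{..<N} \<inter> {..k}. b n * real (k choose n))"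
        by (intro sum.mono_neutral_right) (auto simp: binomial_eq_0)
      also have "\<dots> \<le> a k" unfolding b(2) using b(1) by (intro sum_mono2) auto
      finally have "(\<Sum>n<N. b n * real (k choose n)) * y ^ k \<le> a k * y ^ k" using y by (intro mult_right_mono) auto
      then show ?thesis by (simp only: sum_distrib_right mult.assoc)
    qed
  qed
  then show ?thesis by (simp only: sum_distrib_right mult.assoc y_def)
qed

lemma binomial_series_summable:
  fixes v :: real
  assumes b: "\<And>n. 0 \<le> b n" "\<And>k. a k = (\<Sum>n\<le>k. b n * real (k choose n))"
    and v: "0 \<le> v" and summ: "summable (\<lambda>k. a k * (v / (1 + v)) ^ k)"
  shows "summable (\<lambda>n. b n * v ^ n)"
proof (rule summableI_nonneg_bounded)
  show "0 \<le> b n * v ^ n" for n using b(1) v by simp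
  show "(\<Sum>n<N. b n * v ^ n) \<le> (\<Sum>k. a k * (v / (1 + v)) ^ k)" for N
  proof -
    have "0 \<le> (\<Sum>n<N. b n * v ^ n)" using b(1) v by (intro sum_nonneg) auto
    then have "(\<Sum>n<N. b n * v ^ n) * 1 \<le> (\<Sum>n<N. b n * v ^ n) * (1 + v)"
      using v by (intro mult_left_mono) auto
    then show ?thesis using binomial_series_partial_sum_le[OF b v summ, of N] by simp
  qed
qed

text \<open>Interchanging the summations over \<open>k\<close> and \<open>n\<close> expresses the power series by an entire function of \<open>1 / (1 - z) - 1\<close>.\<close>
lemma power_series_as_function_of_pole:
  fixes z :: complex
  assumes b: "\<And>n. 0 \<le> b n" "\<And>k. a k = (\<Sum>n\<le>k. b n * real (k choose n))"
    and summ: "\<And>y. 0 \<le> y \<Longrightarrow> y < 1 \<Longrightarrow> summable (\<lambda>k. a k * y ^ k)"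
    and z: "norm z < 1"
  shows "(\<lambda>k. of_real (a k) * z ^ k) sums (1 / (1 - z) * eval_fps (Abs_fps (\<lambda>n. of_real (b n))) (z / (1 - z)))"
proof -
  define f where "f = (\<lambda>n k. complex_of_real (b n * real (k choose n)) * z ^ k)"
  define x where "x = norm z"
  have x: "0 \<le> x" "x < 1" using z by (auto simp: x_def)
  have z1: "1 - z \<noteq> 0" using z by auto
  have a0: "0 \<le> a k" for k unfolding b(2) using b(1) by (intro sum_nonneg) auto
  have nf: "norm (f n k) = b n * (real (k choose n) * x ^ k)" for n k
    using b(1)[of n] by (simp add: f_def norm_mult norm_power x_def)
  have sum_k: "(\<lambda>k. norm (f n k)) sums (b n * (x ^ n / (1 - x) ^ Suc n))" for n
    unfolding nf using sums_choose_power[of x n] x by (intro sums_mult) auto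
  have hs_k: "((\<lambda>k. norm (f n k)) has_sum (b n * (x ^ n / (1 - x) ^ Suc n))) UNIV" for n
    using sum_k by (rule sums_nonneg_imp_has_sum) simp
  have summ_b: "summable (\<lambda>n. b n * v ^ n)" if "0 \<le> v" for v :: real
    using that by (intro binomial_series_summable[OF b] summ) auto
  have "summable (\<lambda>n. b n * (x / (1 - x)) ^ n * (1 / (1 - x)))"
    using x by (intro summable_mult2 summ_b) auto
  then have summ_n: "summable (\<lambda>n. b n * (x ^ n / (1 - x) ^ Suc n))"
    by (simp add: power_divide field_simps)
  have "(\<lambda>p. norm (case p of (n, k) \<Rightarrow> f n k)) summable_on (UNIV \<times> UNIV)"
    unfolding Infinite_Sum.abs_summable_on_Sigma_iff
  proof (intro conjI ballI)
    show "(\<lambda>k. norm (case (n, k) of (n, k) \<Rightarrow> f n k)) summable_on UNIV" for n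
      using hs_k[of n] by (auto simp: summable_on_def)
    have nonneg: "0 \<le> b n * (x ^ n / (1 - x) ^ Suc n)" for n using b(1) x by simp
    have "(\<Sum>\<^sub>\<infinity>k. norm (f n k)) = b n * (x ^ n / (1 - x) ^ Suc n)" for n
      using hs_k[of n] by (rule infsumI)
    then have "norm (\<Sum>\<^sub>\<infinity>k. norm (case (n, k) of (n, k) \<Rightarrow> f n k)) = b n * (x ^ n / (1 - x) ^ Suc n)" for n
      using nonneg[of n] by (simp only: prod.case real_norm_def abs_of_nonneg)
    then show "(\<lambda>n. norm (\<Sum>\<^sub>\<infinity>k. norm (case (n, k) of (n, k) \<Rightarrow> f n k))) summable_on UNIV"
      using summable_nonneg_imp_summable_on[OF summ_n nonneg] by (simp only:)
  qed
  then have "(\<lambda>(n, k). f n k) summable_on (UNIV \<times> UNIV)" by (rule abs_summable_summable)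
  then have swap: "(\<Sum>\<^sub>\<infinity>n. \<Sum>\<^sub>\<infinity>k. f n k) = (\<Sum>\<^sub>\<infinity>k. \<Sum>\<^sub>\<infinity>n. f n k)" by (rule infsum_swap_banach)
  have inner_k: "(\<Sum>\<^sub>\<infinity>k. f n k) = of_real (b n) * (z / (1 - z)) ^ n * (1 / (1 - z))" for n
  proof (rule infsumI)
    have "(\<lambda>k. of_real (b n) * (of_nat (k choose n) * z ^ k)) sums (of_real (b n) * (z ^ n / (1 - z) ^ Suc n))"
      using z by (intro sums_mult sums_choose_power)
    then have "f n sums (of_real (b n) * (z ^ n / (1 - z) ^ Suc n))"
      by (simp add: f_def mult.assoc)
    then have "(f n has_sum (of_real (b n) * (z ^ n / (1 - z) ^ Suc n))) UNIV"
      using sum_k[of n] by (intro norm_summable_imp_has_sum) (auto simp: sums_iff)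
    then show "(f n has_sum (of_real (b n) * (z / (1 - z)) ^ n * (1 / (1 - z)))) UNIV"
      by (simp add: power_divide mult_ac)
  qed
  have inner_n: "(\<Sum>\<^sub>\<infinity>n. f n k) = of_real (a k) * z ^ k" for k
  proof (rule infsumI, rule has_sum_finite_neutralI[of "{..k}"])
    show "of_real (a k) * z ^ k = (\<Sum>n\<le>k. f n k)"
      by (simp add: f_def b(2) sum_distrib_right)
  qed (auto simp: f_def binomial_eq_0)
  have nz: "norm (z / (1 - z)) \<ge> 0" by simp
  have "summable (\<lambda>n. norm (complex_of_real (b n) * (z / (1 - z)) ^ n))"
    using summ_b[OF nz] b(1) by (simp add: norm_mult norm_power)
  then have "((\<lambda>n. complex_of_real (b n) * (z / (1 - z)) ^ n) has_sum (\<Sum>n. complex_of_real (b n) * (z / (1 - z)) ^ n)) UNIV"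
    by (intro norm_summable_imp_has_sum summable_sums) (auto intro: summable_norm_cancel)
  then have "((\<lambda>n. complex_of_real (b n) * (z / (1 - z)) ^ n * (1 / (1 - z))) has_sum
      ((\<Sum>n. complex_of_real (b n) * (z / (1 - z)) ^ n) * (1 / (1 - z)))) UNIV"
    by (rule has_sum_cmult_left)
  then have outer_n: "(\<Sum>\<^sub>\<infinity>n. \<Sum>\<^sub>\<infinity>k. f n k) = 1 / (1 - z) * eval_fps (Abs_fps (\<lambda>n. of_real (b n))) (z / (1 - z))"
    unfolding inner_k by (simp add: infsumI eval_fps_def)
  have "summable (\<lambda>k. norm (complex_of_real (a k) * z ^ k))"
    using summ[OF x] a0 by (simp add: norm_mult norm_power x_def)
  then have s: "summable (\<lambda>k. complex_of_real (a k) * z ^ k)" "summable (\<lambda>k. norm (complex_of_real (a k) * z ^ k))"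
    by (auto intro: summable_norm_cancel)
  then have "((\<lambda>k. complex_of_real (a k) * z ^ k) has_sum (\<Sum>k. complex_of_real (a k) * z ^ k)) UNIV"
    by (intro norm_summable_imp_has_sum summable_sums)
  then have "(\<Sum>\<^sub>\<infinity>k. \<Sum>\<^sub>\<infinity>n. f n k) = (\<Sum>k. complex_of_real (a k) * z ^ k)"
    unfolding inner_n by (rule infsumI)
  with swap outer_n s(1) show ?thesis by (simp add: sums_iff)
qed

lemma max_modulus_nonneg_coeffs:
  assumes a0: "\<And>k. 0 \<le> a k" and y: "0 \<le> y" and summ: "summable (\<lambda>k. a k * y ^ k)"
    and G: "\<And>z. norm z = y \<Longrightarrow> (\<lambda>k. of_real (a k) * z ^ k) sums G z"
  shows "max_modulus y G = (\<Sum>k. a k * y ^ k)"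
  unfolding max_modulus_def
proof (rule cSup_eq_maximum)
  have "(\<lambda>k. complex_of_real (a k * y ^ k)) sums of_real (\<Sum>k. a k * y ^ k)"
    using summ by (intro sums_of_real summable_sums)
  moreover have "(\<lambda>k. complex_of_real (a k * y ^ k)) sums G (of_real y)"
    using G[of "of_real y"] y by simp
  ultimately have "G (of_real y) = of_real (\<Sum>k. a k * y ^ k)" by (rule sums_unique2[symmetric])
  moreover have "0 \<le> (\<Sum>k. a k * y ^ k)" using a0 y summ by (intro suminf_nonneg) auto
  ultimately have "(\<Sum>k. a k * y ^ k) = norm (G (of_real y))" by simp
  moreover have "complex_of_real y \<in> sphere 0 y" using y by simp
  ultimately show "(\<Sum>k. a k * y ^ k) \<in> (\<lambda>z. norm (G z)) ` sphere 0 y" by blast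
  fix x assume "x \<in> (\<lambda>z. norm (G z)) ` sphere 0 y"
  then obtain z where z: "norm z = y" "x = norm (G z)" by auto
  have "norm (\<Sum>k. of_real (a k) * z ^ k) \<le> (\<Sum>k. a k * y ^ k)"
    using summ a0 z by (intro norm_suminf_le) (auto simp: norm_mult norm_power)
  moreover have "(\<Sum>k. of_real (a k) * z ^ k) = G z" using G[OF z(1)] by (rule sums_unique[symmetric])
  ultimately show "x \<le> (\<Sum>k. a k * y ^ k)" using z by simp
qed

text \<open>A function with a removable singularity or a pole at \<open>1\<close> is bounded by a multiple of a power of \<open>1 / (1 - y)\<close> as \<open>y\<close> increases to \<open>1\<close>.\<close>
lemma essential_singularity_at_1I:
  assumes an: "G analytic_on (- {1})"
    and growth: "\<And>p::nat. \<forall>\<^sub>F y in at_left (1::real). (1 / (1 - y)) ^ p \<le> norm (G (of_real y))"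
  shows "essential_singularity_at G 1"
  unfolding essential_singularity_at_def
proof
  show iso: "isolated_singularity_at G 1"
    unfolding isolated_singularity_at_def
    using an by (intro exI[of _ 1]) (auto intro: analytic_on_subset)
  have lim: "filterlim (\<lambda>y::real. complex_of_real y) (at 1) (at_left 1)"
  proof (rule filterlim_atI)
    show "((\<lambda>y::real. complex_of_real y) \<longlongrightarrow> 1) (at_left 1)"
      using tendsto_of_real[OF tendsto_ident_at[of "1::real" "{..<1}"]] by simp
    show "\<forall>\<^sub>F y in at_left (1::real). complex_of_real y \<noteq> 1"
      by (auto simp: eventually_at_filter)
  qed
  have no_bound: False if ev: "\<forall>\<^sub>F y in at_left (1::real). norm (G (of_real y)) \<le> B * (1 / (1 - y)) ^ p" for B p
  proof -
    have "filterlim (\<lambda>y::real. 1 / (1 - y)) at_top (at_left 1)" by real_asymp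
    then have "\<forall>\<^sub>F y in at_left (1::real). \<bar>B\<bar> + 1 \<le> 1 / (1 - y)" by (simp add: filterlim_at_top)
    then have "\<forall>\<^sub>F y in at_left (1::real). False"
      using ev growth[of "Suc p"]
    proof eventually_elim
      case (elim y)
      define R where "R = 1 / (1 - y)"
      have R: "\<bar>B\<bar> + 1 \<le> R" "R ^ Suc p \<le> B * R ^ p" using elim by (auto simp: R_def)
      then have "0 < R ^ p" by simp
      moreover have "R * R ^ p \<le> B * R ^ p" using R by simp
      ultimately have "R \<le> B" by (simp add: mult_le_cancel_right)
      then show ?case using R by linarith
    qed
    then show False by (simp add: eventually_False trivial_limit_at_left_real)
  qed
  show "\<not> not_essential G 1"
    unfolding not_essential_def
  proof
    assume "\<exists>x. G \<midarrow>1\<rightarrow> x \<or> is_pole G 1"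
    then consider x where "G \<midarrow>1\<rightarrow> x" | "is_pole G 1" by blast
    then show False
    proof cases
      case (1 x)
      then have "((\<lambda>y. norm (G (of_real y))) \<longlongrightarrow> norm x) (at_left (1::real))"
        by (intro tendsto_norm filterlim_compose[OF _ lim])
      then have "\<forall>\<^sub>F y in at_left (1::real). norm (G (of_real y)) < norm x + 1"
        by (rule order_tendstoD) simp
      then have "\<forall>\<^sub>F y in at_left (1::real). norm (G (of_real y)) \<le> (norm x + 1) * (1 / (1 - y)) ^ 0"
        by eventually_elim simp
      then show False by (rule no_bound)
    next
      case 2
      have "G holomorphic_on UNIV - {1}"
        using an by (auto simp: Compl_eq_Diff_UNIV intro: analytic_imp_holomorphic)
      from zorder_exist_pole[OF this open_UNIV UNIV_I 2] obtain s where s: "0 < s" "zor_poly G 1 holomorphic_on cball 1 s"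
        "\<And>w. w \<in> cball 1 s - {1} \<Longrightarrow> G w = zor_poly G 1 w / (w - 1) ^ nat (- zorder G 1)"
        by blast
      define p where "p = nat (- zorder G 1)"
      have "compact (zor_poly G 1 ` cball 1 s)"
        using s(2) by (intro compact_continuous_image holomorphic_on_imp_continuous_on) auto
      then have "bounded (zor_poly G 1 ` cball 1 s)" by (rule compact_imp_bounded)
      then obtain B where "\<forall>x\<in>zor_poly G 1 ` cball 1 s. norm x \<le> B" unfolding bounded_iff ..
      then have B: "norm (zor_poly G 1 w) \<le> B" if "w \<in> cball 1 s" for w using that by simp
      have "\<forall>\<^sub>F y in at_left (1::real). 1 - s < y \<and> y < 1"
        by (rule eventually_at_leftI[of "1 - s"]) (use s(1) in auto)
      then have "\<forall>\<^sub>F y in at_left (1::real). norm (G (of_real y)) \<le> B * (1 / (1 - y)) ^ p"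
      proof eventually_elim
        case (elim y)
        have "norm (complex_of_real y - 1) = norm (complex_of_real (y - 1))" by simp
        also have "\<dots> = 1 - y" unfolding norm_of_real using elim by simp
        finally have n: "norm (complex_of_real y - 1) = 1 - y" .
        have d: "dist 1 (complex_of_real y) = 1 - y"
          unfolding dist_norm norm_minus_commute[of 1] by (rule n)
        have "norm (G (of_real y)) = norm (zor_poly G 1 (of_real y)) / (1 - y) ^ p"
          using s(3)[of "of_real y"] elim d n by (simp add: p_def norm_divide norm_power)
        also have "\<dots> \<le> B / (1 - y) ^ p"
          using B[of "of_real y"] elim d by (intro divide_right_mono) auto
        finally show ?case by (simp add: power_divide)
      qed
      then show False by (rule no_bound)
    qed
  qed
qed

text \<open>Everything except growth is settled here: the generating function is \<open>w * H (w - 1)\<close> with \<open>w = 1 / (1 - z)\<close> and \<open>H\<close> entire.  It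
  is analytic wherever \<open>w\<close> is, which includes infinity, where \<open>w = 0\<close>.\<close>
theorem PF_fun_with_essential_singularity:
  assumes pos: "binomial_positive a" and PF: "PF_seq r a"
    and summ: "\<And>y. 0 \<le> y \<Longrightarrow> y < 1 \<Longrightarrow> summable (\<lambda>k. a k * y ^ k)"
    and growth: "\<And>p::nat. \<forall>\<^sub>F y in at_left (1::real). (1 / (1 - y)) ^ p \<le> (\<Sum>k. a k * y ^ k)"
  obtains G where "PF_fun r G" "G analytic_on (- {1})" "analytic_at_inf G" "essential_singularity_at G 1"
    "\<And>y. 0 \<le> y \<Longrightarrow> y < 1 \<Longrightarrow> max_modulus y G = (\<Sum>k. a k * y ^ k)"
proof -
  obtain b where b: "\<And>n. 0 \<le> b n" "\<And>k. a k = (\<Sum>n\<le>k. b n * real (k choose n))"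
    using pos by (auto simp: binomial_positive_def)
  define H where "H = Abs_fps (\<lambda>n. complex_of_real (b n))"
  define G where "G = (\<lambda>z. 1 / (1 - z) * eval_fps H (z / (1 - z)))"
  have a0: "0 \<le> a k" for k unfolding b(2) using b(1) by (intro sum_nonneg) auto
  have sums_G: "(\<lambda>k. of_real (a k) * z ^ k) sums G z" if "norm z < 1" for z
    unfolding G_def H_def using b summ that by (rule power_series_as_function_of_pole)
  have radius: "fps_conv_radius H = \<infinity>"
    unfolding fps_conv_radius_def
  proof (rule conv_radius_inftyI'')
    fix z :: complex
    have "summable (\<lambda>n. b n * norm z ^ n)"
      by (intro binomial_series_summable[OF b] summ) (auto simp: divide_less_eq add_pos_nonneg)
    then show "summable (\<lambda>n. fps_nth H n * z ^ n)"
      using b(1) by (intro summable_norm_cancel[of "\<lambda>n. fps_nth H n * z ^ n"]) (simp add: H_def norm_mult norm_power)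
  qed
  have H: "eval_fps H analytic_on A" for A by (rule analytic_on_eval_fps) (auto simp: radius)
  have H_comp: "(\<lambda>z. eval_fps H (g z)) analytic_on A" if "g analytic_on A" for g A
    using analytic_on_compose[OF that H] by (simp add: o_def)
  have an: "G analytic_on (- {1})"
    unfolding G_def by (intro analytic_intros H_comp) auto
  have max: "max_modulus y G = (\<Sum>k. a k * y ^ k)" if "0 \<le> y" "y < 1" for y
    using that by (intro max_modulus_nonneg_coeffs a0 summ sums_G) auto
  have Gy: "norm (G (of_real y)) = (\<Sum>k. a k * y ^ k)" if "0 \<le> y" "y < 1" for y
  proof -
    have "(\<lambda>k. complex_of_real (a k * y ^ k)) sums G (of_real y)" using sums_G[of "of_real y"] that by simp
    moreover have "(\<lambda>k. complex_of_real (a k * y ^ k)) sums of_real (\<Sum>k. a k * y ^ k)"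
      using summ that by (intro sums_of_real summable_sums)
    ultimately have "G (of_real y) = of_real (\<Sum>k. a k * y ^ k)" by (rule sums_unique2)
    moreover have "0 \<le> (\<Sum>k. a k * y ^ k)" using a0 that summ by (intro suminf_nonneg) auto
    ultimately show ?thesis by simp
  qed
  show thesis
  proof (rule that[OF _ an _ _ max])
    show "PF_fun r G"
      unfolding PF_fun_def
    proof (intro exI[of _ a] conjI PF)
      have "summable (\<lambda>k. fps_nth (Abs_fps (\<lambda>k. complex_of_real (a k))) k * (1/2) ^ k)"
        using sums_G[of "1/2"] by (auto simp: sums_iff norm_divide)
      then have "norm (1/2 :: complex) \<le> fps_conv_radius (Abs_fps (\<lambda>k. complex_of_real (a k)))"
        unfolding fps_conv_radius_def by (rule conv_radius_geI)
      then have "0 < fps_conv_radius (Abs_fps (\<lambda>k. complex_of_real (a k)))"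
        by (rule less_le_trans[rotated]) (simp add: norm_divide)
      moreover have "\<forall>\<^sub>F z in nhds 0. eval_fps (Abs_fps (\<lambda>k. complex_of_real (a k))) z = G z"
      proof -
        have "\<forall>\<^sub>F z in nhds (0::complex). z \<in> ball 0 1" by (rule eventually_nhds_in_open) auto
        then show ?thesis
          by eventually_elim (use sums_G in \<open>auto simp: eval_fps_def sums_iff\<close>)
      qed
      ultimately show "G has_fps_expansion Abs_fps (\<lambda>k. complex_of_real (a k))"
        by (simp add: has_fps_expansion_def)
    qed
    show "analytic_at_inf G"
      unfolding analytic_at_inf_def
    proof (intro exI conjI)
      show "(\<lambda>z. z / (z - 1) * eval_fps H (1 / (z - 1))) analytic_on {0}"
        by (intro analytic_intros H_comp) auto
      have "\<forall>\<^sub>F z in at (0::complex). z \<noteq> 0 \<and> z \<in> ball 0 1"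
        by (intro eventually_conj eventually_at_in_open') (auto simp: eventually_at_filter)
      then show "\<forall>\<^sub>F z in at 0. G (1 / z) = z / (z - 1) * eval_fps H (1 / (z - 1))"
      proof eventually_elim
        case (elim z)
        then have "z \<noteq> 0" "z \<noteq> 1" by auto
        \<comment> \<open>\<open>w\<close> and \<open>w - 1\<close> at the point \<open>1 / z\<close>\<close>
        then have "1 / (1 - 1 / z) = z / (z - 1)" "1 / z / (1 - 1 / z) = 1 / (z - 1)"
          by (auto simp: divide_simps)
        then show ?case by (simp only: G_def)
      qed
    qed
    show "essential_singularity_at G 1"
    proof (rule essential_singularity_at_1I[OF an])
      fix p :: nat
      have "\<forall>\<^sub>F y in at_left (1::real). 0 \<le> y \<and> y < 1"
        by (rule eventually_at_leftI[of 0]) auto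
      then show "\<forall>\<^sub>F y in at_left (1::real). (1 / (1 - y)) ^ p \<le> norm (G (of_real y))"
        using growth[of p] by eventually_elim (simp add: Gy)
    qed
  qed
qed

section \<open>Products with zeros in geometric progression\<close>

text \<open>The logarithm of \<open>\<Prod>i. (1 + x / exp i) ^ M i\<close>.  Zeros at \<open>- exp i\<close> make its growth on the logarithmic scale a matter of
  counting zeros.\<close>
definition log_product :: "(nat \<Rightarrow> nat) \<Rightarrow> real \<Rightarrow> real" where
  "log_product M x = (\<Sum>i. real (M i) * ln (1 + x * exp (- real i)))"

abbreviation exp_series :: "(nat \<Rightarrow> nat) \<Rightarrow> real \<Rightarrow> real" where
  "exp_series M y \<equiv> \<Sum>k. exp (log_product M (real k)) * y ^ k"

lemma log_product_term:
  assumes "0 \<le> x"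
  shows "0 \<le> real (M i) * ln (1 + x * exp (- real i))"
    and "real (M i) * ln (1 + x * exp (- real i)) \<le> x * (real (M i) * exp (- real i))"
proof -
  have "0 \<le> x * exp (- real i)" using assms by simp
  then have "0 \<le> ln (1 + x * exp (- real i))" "ln (1 + x * exp (- real i)) \<le> x * exp (- real i)"
    by (auto intro: ln_add_one_self_le_self)
  then show "0 \<le> real (M i) * ln (1 + x * exp (- real i))"
    and "real (M i) * ln (1 + x * exp (- real i)) \<le> x * (real (M i) * exp (- real i))"
    using mult_left_mono[of "ln (1 + x * exp (- real i))" "x * exp (- real i)" "real (M i)"] by (auto simp: mult_ac)
qed

lemma log_product_summable:
  assumes M: "summable (\<lambda>i. real (M i) * exp (- real i))" and x: "0 \<le> x"
  shows "summable (\<lambda>i. real (M i) * ln (1 + x * exp (- real i)))"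
proof (rule summable_comparison_test')
  show "summable (\<lambda>i. x * (real (M i) * exp (- real i)))" using M by (rule summable_mult)
  show "norm (real (M i) * ln (1 + x * exp (- real i))) \<le> x * (real (M i) * exp (- real i))" for i
    using log_product_term[OF x, of M i] by simp
qed

lemma log_product_nonneg:
  assumes "summable (\<lambda>i. real (M i) * exp (- real i))" "0 \<le> x"
  shows "0 \<le> log_product M x"
  unfolding log_product_def using assms
  by (intro suminf_nonneg log_product_summable log_product_term)

lemma log_product_mono:
  assumes M: "summable (\<lambda>i. real (M i) * exp (- real i))" and "0 \<le> x" "x \<le> y"
  shows "log_product M x \<le> log_product M y"
  unfolding log_product_def
proof (rule suminf_le)
  show "real (M i) * ln (1 + x * exp (- real i)) \<le> real (M i) * ln (1 + y * exp (- real i))" for i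
    using assms by (intro mult_left_mono ln_mono add_left_mono mult_right_mono) (auto intro: add_pos_nonneg)
qed (use assms in \<open>auto intro: log_product_summable\<close>)

lemma ln_one_plus_mult_le:
  fixes c x :: real
  assumes "1 \<le> c" "0 \<le> x"
  shows "ln (1 + c * x) \<le> c * ln (1 + x)"
proof -
  define \<phi> where "\<phi> = (\<lambda>x. c * ln (1 + x) - ln (1 + c * x))"
  have "\<phi> 0 \<le> \<phi> x"
  proof (rule DERIV_nonneg_imp_nondecreasing[OF assms(2)])
    fix y :: real assume y: "0 \<le> y" "y \<le> x"
    have pos: "0 < 1 + y" "0 < 1 + c * y" using y assms by (auto intro: add_pos_nonneg)
    have "(\<phi> has_real_derivative (c / (1 + y) - c / (1 + c * y))) (at y)"
      unfolding \<phi>_def using pos by (auto intro!: derivative_eq_intros)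
    moreover have "0 \<le> c / (1 + y) - c / (1 + c * y)"
      using pos assms y by (auto intro!: divide_left_mono simp: mult_le_cancel_right1)
    ultimately show "\<exists>d. (\<phi> has_real_derivative d) (at y) \<and> 0 \<le> d" by blast
  qed
  then show ?thesis by (simp add: \<phi>_def)
qed

text \<open>The function is concave and vanishes at \<open>0\<close>.\<close>
lemma log_product_mult_le:
  assumes M: "summable (\<lambda>i. real (M i) * exp (- real i))" and c: "1 \<le> c" and x: "0 \<le> x"
  shows "log_product M (c * x) \<le> c * log_product M x"
proof -
  have "log_product M (c * x) \<le> (\<Sum>i. c * (real (M i) * ln (1 + x * exp (- real i))))"
    unfolding log_product_def
  proof (rule suminf_le)
    fix i
    have "ln (1 + c * (x * exp (- real i))) \<le> c * ln (1 + x * exp (- real i))"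
      using c x by (intro ln_one_plus_mult_le) auto
    then show "real (M i) * ln (1 + c * x * exp (- real i)) \<le> c * (real (M i) * ln (1 + x * exp (- real i)))"
      using mult_left_mono[of "ln (1 + c * (x * exp (- real i)))" "c * ln (1 + x * exp (- real i))" "real (M i)"]
      by (simp add: mult_ac)
  next
    show "summable (\<lambda>i. real (M i) * ln (1 + c * x * exp (- real i)))"
      using M c x by (intro log_product_summable) auto
    show "summable (\<lambda>i. c * (real (M i) * ln (1 + x * exp (- real i))))"
      using M x by (intro summable_mult log_product_summable)
  qed
  also have "\<dots> = c * log_product M x"
    unfolding log_product_def using M x by (intro suminf_mult log_product_summable)
  finally show ?thesis .
qed

lemma exp_log_product_limit:
  assumes M: "summable (\<lambda>i. real (M i) * exp (- real i))"
  shows "(\<lambda>K. \<Prod>p\<in>Sigma {..<K} (\<lambda>i. {..<M i}). 1 + real k / exp (real (fst p))) \<longlonglongrightarrow> exp (log_product M (real k))"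
proof -
  have "(\<Prod>p\<in>Sigma {..<K} (\<lambda>i. {..<M i}). 1 + real k / exp (real (fst p)))
      = exp (\<Sum>i<K. real (M i) * ln (1 + real k * exp (- real i)))" for K
  proof -
    have pos: "0 < 1 + real k * exp (- real i)" for i by (auto intro: add_pos_nonneg)
    have "(\<Prod>p\<in>Sigma {..<K} (\<lambda>i. {..<M i}). 1 + real k / exp (real (fst p)))
        = (\<Prod>i<K. \<Prod>j<M i. 1 + real k * exp (- real i))"
      by (subst prod.Sigma) (auto simp: exp_minus divide_inverse case_prod_beta)
    also have "\<dots> = (\<Prod>i<K. exp (real (M i) * ln (1 + real k * exp (- real i))))"
      using pos by (simp add: exp_of_nat_mult)
    finally show ?thesis by (simp add: exp_sum)
  qed
  moreover have "(\<lambda>K. exp (\<Sum>i<K. real (M i) * ln (1 + real k * exp (- real i)))) \<longlonglongrightarrow> exp (log_product M (real k))"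
    unfolding log_product_def
    by (intro tendsto_exp summable_LIMSEQ log_product_summable M) simp
  ultimately show ?thesis by simp
qed

lemma binomial_positive_exp_log_product:
  assumes "summable (\<lambda>i. real (M i) * exp (- real i))"
  shows "binomial_positive (\<lambda>k. exp (log_product M (real k)))"
proof (rule binomial_positive_tendsto[OF _ exp_log_product_limit[OF assms]])
  fix K
  have "binomial_positive (\<lambda>k. \<Prod>p\<in>Sigma {..<K} (\<lambda>i. {..<M i}). 1 + real k * (1 / exp (real (fst p))))"
    by (rule binomial_positive_prod) auto
  then show "binomial_positive (\<lambda>k. \<Prod>p\<in>Sigma {..<K} (\<lambda>i. {..<M i}). 1 + real k / exp (real (fst p)))" by simp
qed

text \<open>The condition \<open>m \<le> M 0\<close> supplies the zero at \<open>-1\<close>.\<close>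
lemma PF_seq_exp_log_product:
  obtains m :: nat where "0 < m"
    "\<And>M. summable (\<lambda>i. real (M i) * exp (- real i)) \<Longrightarrow> m \<le> M 0 \<Longrightarrow> (\<And>i. M i = 0 \<or> m \<le> M i) \<Longrightarrow>
      PF_seq r (\<lambda>k. exp (log_product M (real k)))"
proof (rule PF_seq_linear_product[where r = r and 'i = "nat \<times> nat"])
  fix m :: nat
  assume m: "0 < m"
    "\<And>J (\<xi> :: nat \<times> nat \<Rightarrow> real). finite J \<Longrightarrow> (\<And>j. j \<in> J \<Longrightarrow> 1 \<le> \<xi> j) \<Longrightarrow> (\<exists>j\<in>J. \<xi> j = 1) \<Longrightarrow>
      (\<And>j. j \<in> J \<Longrightarrow> m \<le> card {i\<in>J. \<xi> i = \<xi> j}) \<Longrightarrow> PF_seq r (\<lambda>n. \<Prod>j\<in>J. 1 + real n / \<xi> j)"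
  show thesis
  proof (rule that[OF m(1)])
    fix M :: "nat \<Rightarrow> nat"
    assume M: "summable (\<lambda>i. real (M i) * exp (- real i))" and M0: "m \<le> M 0" and Mi: "\<And>i. M i = 0 \<or> m \<le> M i"
    let ?J = "\<lambda>K. Sigma {..<Suc K} (\<lambda>i. {..<M i})"
    show "PF_seq r (\<lambda>k. exp (log_product M (real k)))"
    proof (rule PF_seq_tendsto)
      show "(\<lambda>K. \<Prod>p\<in>?J K. 1 + real k / exp (real (fst p))) \<longlonglongrightarrow> exp (log_product M (real k))" for k
        using exp_log_product_limit[OF M, of k] by (rule LIMSEQ_Suc)
      show "PF_seq r (\<lambda>k. \<Prod>p\<in>?J K. 1 + real k / exp (real (fst p)))" for K
      proof (rule m(2))
        show "finite (?J K)" by simp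
        show "\<exists>p\<in>?J K. exp (real (fst p)) = 1"
          using m(1) M0 by (intro bexI[of _ "(0, 0)"]) auto
        show "m \<le> card {q \<in> ?J K. exp (real (fst q)) = exp (real (fst p))}" if "p \<in> ?J K" for p
        proof -
          obtain i j where p: "p = (i, j)" "i < Suc K" "j < M i" using \<open>p \<in> ?J K\<close> by auto
          have "{q \<in> ?J K. exp (real (fst q)) = exp (real (fst p))} = {i} \<times> {..<M i}"
            using p by auto
          then show ?thesis using Mi[of i] p by (simp add: card_cartesian_product)
        qed
      qed simp
    qed
  qed
qed

text \<open>Terms with \<open>k \<le> K\<close> are dominated by the geometric series with ratio \<open>y\<close>.  For \<open>k \<ge> K\<close>, concavity and the hypothesis on \<open>K\<close>
  let the coefficient grow at most like \<open>exp (k (1 - y) / 2)\<close>, while \<open>y ^ k \<le> exp (- k (1 - y))\<close>; so those terms are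
  dominated by a geometric series as well.\<close>
lemma series_le_exp_log_product:
  assumes M: "summable (\<lambda>i. real (M i) * exp (- real i))" and y: "0 \<le> y" "y < 1" and K: "0 < K"
    and LK: "log_product M K \<le> K * (1 - y) / 2"
  shows "summable (\<lambda>k. exp (log_product M (real k)) * y ^ k)"
    and "exp_series M y \<le> 5 / (1 - y) * exp (log_product M K)"
proof -
  define q where "q = exp (- ((1 - y) / 2))"
  let ?E = "exp (log_product M K)"
  have q: "0 < q" "q < 1" using y by (auto simp: q_def)
  have term_le: "exp (log_product M (real k)) * y ^ k \<le> ?E * y ^ k + q ^ k" for k
  proof (cases "real k \<le> K")
    case True
    then have "exp (log_product M (real k)) \<le> ?E" using log_product_mono[OF M, of "real k" K] by simp
    then have "exp (log_product M (real k)) * y ^ k \<le> ?E * y ^ k" using y by (intro mult_right_mono) auto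
    then show ?thesis using q by (simp add: add_increasing2)
  next
    case False
    then have "log_product M (real k / K * K) \<le> real k / K * log_product M K"
      using K by (intro log_product_mult_le[OF M]) auto
    also have "\<dots> \<le> real k / K * (K * (1 - y) / 2)" using LK K by (intro mult_left_mono) auto
    finally have L: "log_product M (real k) \<le> real k * ((1 - y) / 2)" using K by simp
    have "y \<le> exp (- (1 - y))" using exp_ge_add_one_self[of "- (1 - y)"] by simp
    then have "y ^ k \<le> exp (- (1 - y)) ^ k" using y by (intro power_mono) auto
    then have "exp (log_product M (real k)) * y ^ k \<le> exp (real k * ((1 - y) / 2)) * exp (- (1 - y)) ^ k"
      using L y by (intro mult_mono) auto
    also have "\<dots> = q ^ k"
      by (simp add: q_def exp_of_nat_mult[symmetric] exp_add[symmetric] algebra_simps)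
    finally show ?thesis using y by (simp add: add_increasing)
  qed
  have S: "(\<lambda>k. ?E * y ^ k + q ^ k) sums (?E * (1 / (1 - y)) + 1 / (1 - q))"
    using y q by (intro sums_add sums_mult geometric_sums) auto
  show summ: "summable (\<lambda>k. exp (log_product M (real k)) * y ^ k)"
    using term_le y by (intro summable_comparison_test'[OF sums_summable[OF S], of 0]) auto
  have "exp_series M y \<le> (\<Sum>k. ?E * y ^ k + q ^ k)"
    by (rule suminf_le[OF term_le summ sums_summable[OF S]])
  also have "\<dots> = ?E * (1 / (1 - y)) + 1 / (1 - q)" by (rule sums_unique[OF S, symmetric])
  also have "1 / (1 - q) \<le> 4 / (1 - y)"
  proof -
    define x where "x = (1 - y) / 2"
    have x: "0 < x" "x \<le> 1" using y by (auto simp: x_def)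
    have "1 + x \<le> exp x" by (rule exp_ge_add_one_self)
    then have "q \<le> 1 / (1 + x)" using x unfolding q_def x_def[symmetric] exp_minus by (simp add: divide_inverse le_imp_inverse_le)
    also have "\<dots> \<le> 1 - x / 2" using x by (simp add: field_simps) 
    finally have "(1 - y) / 4 \<le> 1 - q" unfolding x_def by linarith
    then have "1 / (1 - q) \<le> 1 / ((1 - y) / 4)" using y by (intro divide_left_mono) (auto simp: q)
    then show ?thesis by simp
  qed
  also have "4 / (1 - y) \<le> ?E * (4 / (1 - y))"
  proof -
    have "1 * (4 / (1 - y)) \<le> ?E * (4 / (1 - y))"
      using log_product_nonneg[OF M, of K] K y by (intro mult_right_mono) auto
    then show ?thesis by simp
  qed
  finally show "exp_series M y \<le> 5 / (1 - y) * ?E"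
    by (simp add: field_simps)
qed

text \<open>A single term suffices, the one whose index is the integer part of \<open>1 / (1 - y)\<close>.\<close>
lemma series_ge_exp_log_product:
  assumes M: "summable (\<lambda>i. real (M i) * exp (- real i))" and y: "1 / 2 \<le> y" "y < 1"
    and summ: "summable (\<lambda>k. exp (log_product M (real k)) * y ^ k)"
  shows "exp (log_product M (1 / (1 - y) * exp (- 1)) - 2) \<le> exp_series M y"
proof -
  define R where "R = 1 / (1 - y)"
  define k where "k = nat \<lfloor>R\<rfloor>"
  have R: "2 \<le> R" "1 - y = 1 / R" using y by (auto simp: R_def field_simps)
  have k: "real k \<le> R" "R - 1 < real k" using R by (auto simp: k_def)
  have "2 \<le> exp (1::real)" using exp_ge_add_one_self[of "1::real"] by simp
  then have "R * exp (- 1) \<le> R * (1 / 2)" using R by (intro mult_left_mono) (auto simp: exp_minus field_simps)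
  also have "\<dots> \<le> real k" using k R by simp
  finally have "log_product M (R * exp (- 1)) \<le> log_product M (real k)" using R by (intro log_product_mono[OF M]) auto
  moreover have "exp (- 2) \<le> y ^ k"
  proof -
    define x where "x = 1 - y"
    have x: "0 < x" "x \<le> 1 / 2" "y = 1 - x" using y by (auto simp: x_def)
    have "1 + 2 * x \<le> exp (2 * x)" by (rule exp_ge_add_one_self)
    then have "inverse (exp (2 * x)) \<le> inverse (1 + 2 * x)" using x(1) by (intro le_imp_inverse_le) auto
    then have "exp (- (2 * x)) \<le> 1 / (1 + 2 * x)" by (simp only: exp_minus inverse_eq_divide)
    also have "\<dots> \<le> y"
    proof -
      have "0 \<le> x * (1 - 2 * x)" using x by simp
      then have "1 \<le> (1 - x) * (1 + 2 * x)" by (simp add: algebra_simps)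
      then show ?thesis using x by (simp add: pos_divide_le_eq)
    qed
    finally have "exp (- (2 * x)) ^ k \<le> y ^ k" by (intro power_mono) auto
    moreover have "exp (- 2) \<le> exp (- (2 * x)) ^ k"
    proof -
      have "real k * x \<le> R * x" using k x(1) by (intro mult_right_mono) auto
      also have "R * x = 1" using y by (simp add: R_def x_def)
      finally show ?thesis by (simp add: exp_of_nat_mult[symmetric])
    qed
    ultimately show ?thesis by simp
  qed
  ultimately have "exp (log_product M (R * exp (- 1))) * exp (- 2) \<le> exp (log_product M (real k)) * y ^ k"
    by (intro mult_mono) auto
  also have "\<dots> \<le> exp_series M y"
    using sum_le_suminf[OF summ, of "{k}"] y by simp
  finally show ?thesis by (simp add: R_def exp_diff exp_minus divide_inverse)
qed

section \<open>Counting zeros\<close>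

text \<open>Multiplicities with partial sums \<open>m * N i\<close>.  They are multiples of \<open>m\<close>, as the multiply positive construction demands, and
  the counting function \<open>m * N i\<close> can follow any nondecreasing function of \<open>i\<close> up to an error of size \<open>m\<close>.\<close>
definition multiplicities :: "nat \<Rightarrow> (nat \<Rightarrow> nat) \<Rightarrow> nat \<Rightarrow> nat" where
  "multiplicities m N i = m * (case i of 0 \<Rightarrow> N 0 | Suc j \<Rightarrow> N (Suc j) - N j)"

text \<open>The sum of \<open>(n - i) * multiplicities m N i\<close> over \<open>i < n\<close> (\<open>sum_weighted_multiplicities\<close>); up to lower order it is the value of the logarithm of
  the product at \<open>exp n\<close>.\<close>
abbreviation total :: "nat \<Rightarrow> (nat \<Rightarrow> nat) \<Rightarrow> nat \<Rightarrow> real" where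
  "total m N n \<equiv> real m * (\<Sum>i<n. real (N i))"

lemma sum_multiplicities:
  assumes "mono N"
  shows "(\<Sum>i\<le>n. multiplicities m N i) = m * N n"
proof (induction n)
  case (Suc n)
  have "N n \<le> N (Suc n)" using assms by (auto simp: mono_def)
  then show ?case using Suc by (simp add: multiplicities_def diff_mult_distrib2)
qed (simp add: multiplicities_def)

lemma multiplicities_le: "multiplicities m N i \<le> m * N i"
  by (cases i) (auto simp: multiplicities_def)

lemma sum_weighted_multiplicities:
  assumes "mono N"
  shows "(\<Sum>i<n. real (multiplicities m N i) * (real n - real i)) = total m N n"
proof (induction n)
  case (Suc n)
  have "(\<Sum>i<Suc n. real (multiplicities m N i) * (real (Suc n) - real i)) =
      (\<Sum>i<Suc n. real (multiplicities m N i) * (real n - real i)) + (\<Sum>i<Suc n. real (multiplicities m N i))"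
    by (simp only: sum.distrib[symmetric]) (simp add: algebra_simps)
  also have "(\<Sum>i<Suc n. real (multiplicities m N i)) = real (m * N n)"
    unfolding sum_multiplicities[OF assms, symmetric] by (simp add: lessThan_Suc_atMost)
  also have "(\<Sum>i<Suc n. real (multiplicities m N i) * (real n - real i)) = total m N n"
    using Suc by simp
  finally show ?case by (simp add: distrib_left)
qed simp

lemma summable_powr_exp: "summable (\<lambda>j. (real j + 2) powr c * exp (- real j))"
proof (rule summable_comparison_test_bigo)
  show "summable (\<lambda>n. norm (1 / real n ^ 2))" using inverse_power_summable[of 2, where 'a = real] by (simp add: divide_inverse)
  show "(\<lambda>j. (real j + 2) powr c * exp (- real j)) \<in> O(\<lambda>n. 1 / real n ^ 2)" by real_asymp
qed

lemma summable_multiplicities: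
  assumes N: "\<And>i. real (N i) \<le> C * (real i + 1) powr c" and c: "0 \<le> c"
  shows "summable (\<lambda>i. real (multiplicities m N i) * exp (- real i))"
proof (rule summable_comparison_test')
  have C: "0 \<le> C" using N[of 0] by (simp add: order_trans[OF of_nat_0_le_iff])
  show "summable (\<lambda>i. real m * C * ((real i + 2) powr c * exp (- real i)))"
    by (intro summable_mult summable_powr_exp)
  fix i
  have "real (multiplicities m N i) \<le> real m * real (N i)"
    using multiplicities_le[of m N i] by (simp flip: of_nat_mult)
  also have "\<dots> \<le> real m * (C * (real i + 2) powr c)"
  proof (rule mult_left_mono)
    have "(real i + 1) powr c \<le> (real i + 2) powr c" using c by (intro powr_mono2) auto
    then show "real (N i) \<le> C * (real i + 2) powr c" using N[of i] mult_left_mono[OF _ C] by (meson order_trans)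
  qed simp
  finally have "real (multiplicities m N i) * exp (- real i) \<le> real m * (C * (real i + 2) powr c) * exp (- real i)"
    by (rule mult_right_mono) simp
  then show "norm (real (multiplicities m N i) * exp (- real i)) \<le> real m * C * ((real i + 2) powr c * exp (- real i))"
    by (simp add: mult_ac)
qed

text \<open>Only the zeros with \<open>i < n\<close> are kept, for which \<open>ln (1 + exp (n - i)) \<ge> n - i\<close>.\<close>
lemma log_product_multiplicities_ge:
  assumes N: "mono N" and M: "summable (\<lambda>i. real (multiplicities m N i) * exp (- real i))"
  shows "total m N n \<le> log_product (multiplicities m N) (exp (real n))"
proof -
  let ?M = "multiplicities m N"
  have "total m N n = (\<Sum>i<n. real (?M i) * (real n - real i))"
    using sum_weighted_multiplicities[OF N] by simp
  also have "\<dots> \<le> (\<Sum>i<n. real (?M i) * ln (1 + exp (real n) * exp (- real i)))"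
  proof (intro sum_mono mult_left_mono)
    fix i
    have "ln (exp (real n - real i)) \<le> ln (1 + exp (real n - real i))"
      by (intro ln_mono) (auto intro: add_pos_pos)
    then show "real n - real i \<le> ln (1 + exp (real n) * exp (- real i))"
      by (simp add: exp_add[symmetric])
  qed simp
  also have "\<dots> \<le> log_product ?M (exp (real n))"
    unfolding log_product_def
    by (intro sum_le_suminf log_product_summable M log_product_term) auto
  finally show ?thesis .
qed

text \<open>For \<open>i \<le> n\<close> a factor contributes at most \<open>n + 1 - i\<close>, which sums to the total up to \<open>n + 1\<close>; for \<open>i > n\<close> it contributes at most
  \<open>exp (n - i)\<close>, so the remaining factors together are of the order of the multiplicities near \<open>n\<close>.\<close>
lemma log_product_multiplicities_le:
  assumes N: "mono N" "\<And>i. real (N i) \<le> C * (real i + 1) powr c" and c: "0 \<le> c"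
  obtains D where "0 \<le> D"
    "\<And>n. log_product (multiplicities m N) (exp (real n)) \<le> total m N (Suc n) + D * (real n + 1) powr c"
proof -
  let ?M = "multiplicities m N"
  have M: "summable (\<lambda>i. real (?M i) * exp (- real i))" using N(2) c by (rule summable_multiplicities)
  have C: "0 \<le> C" using N(2)[of 0] by (simp add: order_trans[OF of_nat_0_le_iff])
  define Z where "Z = (\<Sum>j. (real j + 2) powr c * exp (- real j))"
  define D where "D = real m * C * Z"
  have Z: "0 \<le> Z" unfolding Z_def by (intro suminf_nonneg summable_powr_exp) simp
  show thesis
  proof (rule that)
    show "0 \<le> D" using C Z by (simp add: D_def)
    fix n
    let ?t = "\<lambda>i. real (?M i) * ln (1 + exp (real n) * exp (- real i))"
    have summ: "summable ?t" by (intro log_product_summable M) simp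
    have tail: "?t (j + Suc n) \<le> real m * C * (real n + 1) powr c * ((real j + 2) powr c * exp (- real j))" for j
    proof -
      have "ln (1 + exp (real n) * exp (- real (j + Suc n))) \<le> exp (real n) * exp (- real (j + Suc n))"
        by (rule ln_add_one_self_le_self) simp
      also have "\<dots> \<le> exp (- real j)" by (simp add: exp_add[symmetric])
      finally have "?t (j + Suc n) \<le> (real m * real (N (j + Suc n))) * exp (- real j)"
        using multiplicities_le[of m N "j + Suc n"] by (intro mult_mono) (auto simp flip: of_nat_mult)
      also have "\<dots> \<le> (real m * (C * ((real n + 1) * (real j + 2)) powr c)) * exp (- real j)"
      proof (intro mult_right_mono mult_left_mono)
        have "real (N (j + Suc n)) \<le> C * (real (j + Suc n) + 1) powr c" by (rule N(2))
        \<comment> \<open>Separating \<open>n\<close> from \<open>j\<close> leaves a convergent series in \<open>j\<close>.\<close>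
        also have "\<dots> \<le> C * ((real n + 1) * (real j + 2)) powr c"
        proof (intro mult_left_mono powr_mono2 c C)
          show "real (j + Suc n) + 1 \<le> (real n + 1) * (real j + 2)" by (simp add: algebra_simps)
        qed simp
        finally show "real (N (j + Suc n)) \<le> C * ((real n + 1) * (real j + 2)) powr c" .
      qed auto
      finally show ?thesis by (simp add: powr_mult mult_ac)
    qed
    have head: "?t i \<le> real (?M i) * (real (Suc n) - real i)" if "i < Suc n" for i
    proof (rule mult_left_mono)
      have "2 \<le> exp (1::real)" using exp_ge_add_one_self[of "1::real"] by simp
      then have "2 * exp (real n - real i) \<le> exp 1 * exp (real n - real i)" by (rule mult_right_mono) simp
      moreover have "1 \<le> exp (real n - real i)" using that by simp
      ultimately have "1 + exp (real n - real i) \<le> exp 1 * exp (real n - real i)" by linarith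
      then have "ln (1 + exp (real n - real i)) \<le> ln (exp 1 * exp (real n - real i))"
        by (intro ln_mono) (auto intro: add_pos_pos)
      then show "ln (1 + exp (real n) * exp (- real i)) \<le> real (Suc n) - real i"
        by (simp add: exp_add[symmetric] algebra_simps)
    qed simp
    have "log_product ?M (exp (real n)) = (\<Sum>j. ?t (j + Suc n)) + (\<Sum>i<Suc n. ?t i)"
      unfolding log_product_def using summ by (rule suminf_split_initial_segment)
    also have "(\<Sum>i<Suc n. ?t i) \<le> (\<Sum>i<Suc n. real (?M i) * (real (Suc n) - real i))"
      using head by (intro sum_mono) auto
    also have "\<dots> = total m N (Suc n)" by (rule sum_weighted_multiplicities[OF N(1)])
    also have "(\<Sum>j. ?t (j + Suc n)) \<le> (\<Sum>j. real m * C * (real n + 1) powr c * ((real j + 2) powr c * exp (- real j)))"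
      using tail by (intro suminf_le summable_ignore_initial_segment[OF summ] summable_mult summable_powr_exp)
    also have "\<dots> = D * (real n + 1) powr c"
      unfolding D_def Z_def by (subst suminf_mult[OF summable_powr_exp]) (simp add: mult_ac)
    finally show "log_product ?M (exp (real n)) \<le> total m N (Suc n) + D * (real n + 1) powr c" by simp
  qed
qed

section \<open>Growth of the generating function\<close>

text \<open>With \<open>s = ln (1 / (1 - y))\<close>, the logarithm of the series is at least that of the product at \<open>exp (s - 1)\<close>, minus \<open>2\<close>.\<close>
lemma log_series_ge_eventually:
  fixes \<alpha> \<alpha>' p :: real
  assumes N: "mono N" and M: "summable (\<lambda>i. real (multiplicities m N i) * exp (- real i))"
    and summ: "\<And>y. 0 \<le> y \<Longrightarrow> y < 1 \<Longrightarrow> summable (\<lambda>k. exp (log_product (multiplicities m N) (real k)) * y ^ k)"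
    and \<alpha>: "0 \<le> \<alpha>'" "\<alpha>' < \<alpha>" and p: "0 < p"
    and ev: "\<forall>\<^sub>F n in sequentially. \<alpha> * real n powr p \<le> total m N n"
  shows "\<forall>\<^sub>F y in at_left (1::real). \<alpha>' * ln (1 / (1 - y)) powr p
           \<le> ln (exp_series (multiplicities m N) y)"
proof -
  let ?L = "log_product (multiplicities m N)"
  have s: "filterlim (\<lambda>y::real. ln (1 / (1 - y))) at_top (at_left 1)" by real_asymp
  have n: "filterlim (\<lambda>s::real. nat \<lfloor>s - 1\<rfloor>) sequentially at_top" by real_asymp
  have "((\<lambda>s::real. (\<alpha> * (s - 2) powr p - 2) / s powr p) \<longlongrightarrow> \<alpha>) at_top"
    using p \<alpha> by real_asymp
  then have "\<forall>\<^sub>F s in at_top. \<alpha>' < (\<alpha> * (s - 2) powr p - 2) / s powr p"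
    using \<alpha> by (intro order_tendstoD) auto
  moreover have "\<forall>\<^sub>F s::real in at_top. \<alpha> * real (nat \<lfloor>s - 1\<rfloor>) powr p \<le> total m N (nat \<lfloor>s - 1\<rfloor>)"
    using eventually_compose_filterlim[OF ev n] .
  moreover have "\<forall>\<^sub>F s::real in at_top. 2 < s" by (rule eventually_gt_at_top)
  ultimately have "\<forall>\<^sub>F s in at_top. \<alpha>' * s powr p + 2 \<le> ?L (exp (s - 1))"
  proof eventually_elim
    case (elim s)
    define n where "n = nat \<lfloor>s - 1\<rfloor>"
    have n: "s - 2 \<le> real n" "real n \<le> s - 1" using elim(3) by (auto simp: n_def) linarith
    have "\<alpha>' * s powr p + 2 \<le> \<alpha> * (s - 2) powr p" using elim(1,3) by (simp add: pos_less_divide_eq)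
    also have "\<dots> \<le> \<alpha> * real n powr p" using n elim(3) p \<alpha> by (intro mult_left_mono powr_mono2) auto
    also have "\<dots> \<le> total m N n" using elim(2) by (simp add: n_def)
    also have "\<dots> \<le> ?L (exp (real n))" by (rule log_product_multiplicities_ge[OF N M])
    also have "\<dots> \<le> ?L (exp (s - 1))" using n by (intro log_product_mono[OF M]) auto
    finally show ?case .
  qed
  from eventually_compose_filterlim[OF this s]
  have "\<forall>\<^sub>F y in at_left (1::real). \<alpha>' * ln (1 / (1 - y)) powr p + 2 \<le> ?L (exp (ln (1 / (1 - y)) - 1))"
    .
  moreover have "\<forall>\<^sub>F y in at_left (1::real). 1 / 2 < y \<and> y < 1"
    by (rule eventually_at_leftI[of "1 / 2"]) auto
  ultimately show ?thesis
  proof eventually_elim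
    case (elim y)
    have "0 < 1 / (1 - y)" using elim(2) by simp
    then have e: "exp (ln (1 / (1 - y)) - 1) = 1 / (1 - y) * exp (- 1)"
      by (simp only: exp_diff exp_ln exp_minus divide_inverse)
    have "exp (?L (1 / (1 - y) * exp (- 1)) - 2) \<le> (\<Sum>k. exp (?L (real k)) * y ^ k)"
      using elim(2) by (intro series_ge_exp_log_product M summ) auto
    moreover from this have "0 < (\<Sum>k. exp (?L (real k)) * y ^ k)" by (rule less_le_trans[OF exp_gt_zero])
    ultimately have "?L (1 / (1 - y) * exp (- 1)) - 2 \<le> ln (\<Sum>k. exp (?L (real k)) * y ^ k)"
      by (simp add: ln_ge_iff)
    then show ?case using elim(1) unfolding e by linarith
  qed
qed

text \<open>With \<open>s = ln (1 / (1 - y))\<close>, the cut-off \<open>K\<close> is taken near \<open>exp ((1 + \<eta>) s)\<close>.  Any \<open>\<eta> > 0\<close> is admissible, because the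
  logarithm of the product is polynomially bounded in \<open>s\<close> whereas \<open>K (1 - y)\<close> is of order \<open>exp (\<eta> s)\<close>; and a small \<open>\<eta>\<close> costs only the factor
  \<open>(1 + \<eta>) powr p\<close>.\<close>
lemma log_series_le_eventually:
  fixes \<beta> \<beta>' p c :: real
  assumes N: "mono N" "\<And>i. real (N i) \<le> C * (real i + 1) powr c" and c: "0 \<le> c" "c < p"
    and \<beta>: "0 \<le> \<beta>" "\<beta> < \<beta>'" and p: "1 < p"
    and ev: "\<forall>\<^sub>F n in sequentially. total m N n \<le> \<beta> * real n powr p"
  shows "\<forall>\<^sub>F y in at_left (1::real). ln (exp_series (multiplicities m N) y)
           \<le> \<beta>' * ln (1 / (1 - y)) powr p"
proof -
  let ?L = "log_product (multiplicities m N)"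
  have M: "summable (\<lambda>i. real (multiplicities m N i) * exp (- real i))" using N(2) c(1) by (rule summable_multiplicities)
  obtain D where D: "0 \<le> D" "\<And>n. ?L (exp (real n)) \<le> total m N (Suc n) + D * (real n + 1) powr c"
    using log_product_multiplicities_le[OF N c(1), of m] by blast
  have "((\<lambda>\<eta>. \<beta> * (1 + \<eta>) powr p) \<longlongrightarrow> \<beta> * (1 + 0) powr p) (at_right 0)"
    by (intro tendsto_intros) auto
  then have "\<forall>\<^sub>F \<eta> in at_right 0. \<beta> * (1 + \<eta>) powr p < \<beta>'" using \<beta> by (intro order_tendstoD) auto
  moreover have "\<forall>\<^sub>F \<eta> in at_right (0::real). 0 < \<eta>" by (rule eventually_at_right_less)
  ultimately have "\<forall>\<^sub>F \<eta> in at_right (0::real). 0 < \<eta> \<and> \<beta> * (1 + \<eta>) powr p < \<beta>'" by eventually_elim simp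
  then obtain \<eta> :: real where \<eta>: "0 < \<eta>" "\<beta> * (1 + \<eta>) powr p < \<beta>'"
    using eventually_happens'[OF trivial_limit_at_right_real] by blast
  define B where "B = (\<lambda>s. \<beta> * ((1 + \<eta>) * s + 2) powr p + D * ((1 + \<eta>) * s + 2) powr c)"
  have s: "filterlim (\<lambda>y::real. ln (1 / (1 - y))) at_top (at_left 1)" by real_asymp
  have n: "filterlim (\<lambda>s::real. Suc (nat \<lceil>(1 + \<eta>) * s\<rceil>)) sequentially at_top" using \<eta>(1) by real_asymp
  have "((\<lambda>s. (2 + s + B s) / s powr p) \<longlongrightarrow> \<beta> * (1 + \<eta>) powr p) at_top"
    unfolding B_def using p c \<eta>(1) \<beta>(1) D(1) by real_asymp
  then have "\<forall>\<^sub>F s in at_top. (2 + s + B s) / s powr p < \<beta>'" using \<eta>(2) by (intro order_tendstoD) auto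
  moreover have "((\<lambda>s. B s / exp (\<eta> * s)) \<longlongrightarrow> 0) at_top"
    unfolding B_def using \<eta>(1) by real_asymp
  then have "\<forall>\<^sub>F s in at_top. B s / exp (\<eta> * s) < 1 / 2" by (intro order_tendstoD) auto
  moreover have "\<forall>\<^sub>F s in at_top. total m N (Suc (nat \<lceil>(1 + \<eta>) * s\<rceil>)) \<le> \<beta> * real (Suc (nat \<lceil>(1 + \<eta>) * s\<rceil>)) powr p"
    using eventually_compose_filterlim[OF ev n] .
  moreover have "\<forall>\<^sub>F s::real in at_top. 0 < s" by (rule eventually_gt_at_top)
  ultimately have "\<forall>\<^sub>F s in at_top. \<exists>K. 0 < K \<and> ?L K \<le> K / exp s / 2 \<and> ln 5 + s + ?L K \<le> \<beta>' * s powr p"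
  proof eventually_elim
    case (elim s)
    define n where "n = nat \<lceil>(1 + \<eta>) * s\<rceil>"
    have "0 < (1 + \<eta>) * s" using elim(4) \<eta>(1) by simp
    then have n: "(1 + \<eta>) * s \<le> real n" "real n + 1 \<le> (1 + \<eta>) * s + 2" unfolding n_def by linarith+
    have "?L (exp (real n)) \<le> total m N (Suc n) + D * (real n + 1) powr c" by (rule D(2))
    also have "\<dots> \<le> \<beta> * (real n + 1) powr p + D * (real n + 1) powr c"
      using elim(3) by (simp add: n_def add.commute)
    also have "\<dots> \<le> B s"
    proof -
      have "(real n + 1) powr q \<le> ((1 + \<eta>) * s + 2) powr q" if "0 \<le> q" for q
        using that n(2) by (intro powr_mono2) auto
      then show ?thesis
        unfolding B_def using p c \<beta>(1) D(1) by (intro add_mono mult_left_mono) auto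
    qed
    finally have L: "?L (exp (real n)) \<le> B s" .
    have "B s \<le> exp (\<eta> * s) / 2" using elim(2) by (simp add: divide_less_eq)
    also have "exp (\<eta> * s) \<le> exp (real n - s)" using n(1) by (simp add: algebra_simps)
    also have "exp (real n - s) = exp (real n) / exp s" by (rule exp_diff)
    finally have "?L (exp (real n)) \<le> exp (real n) / exp s / 2" using L by simp
    moreover have "ln 5 + s + ?L (exp (real n)) \<le> \<beta>' * s powr p"
    proof -
      have "ln (5::real) \<le> 2"
      proof -
        have "(5::real) \<le> exp 2" using exp_lower_Taylor_quadratic[of "2::real"] by simp
        then have "ln (5::real) \<le> ln (exp 2)" by (intro ln_mono) auto
        then show ?thesis by simp
      qed
      moreover have "2 + s + B s \<le> \<beta>' * s powr p" using elim(1,4) by (simp add: divide_less_eq)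
      ultimately show ?thesis using L by linarith
    qed
    ultimately show ?case by (intro exI[of _ "exp (real n)"]) auto
  qed
  from eventually_compose_filterlim[OF this s]
  have "\<forall>\<^sub>F y in at_left (1::real). \<exists>K. 0 < K \<and> ?L K \<le> K / exp (ln (1 / (1 - y))) / 2 \<and>
      ln 5 + ln (1 / (1 - y)) + ?L K \<le> \<beta>' * ln (1 / (1 - y)) powr p"
    .
  moreover have "\<forall>\<^sub>F y in at_left (1::real). 0 < y \<and> y < 1"
    by (rule eventually_at_leftI[of 0]) auto
  ultimately show ?thesis
  proof eventually_elim
    case (elim y)
    then obtain K where K: "0 < K" "?L K \<le> K / exp (ln (1 / (1 - y))) / 2"
      "ln 5 + ln (1 / (1 - y)) + ?L K \<le> \<beta>' * ln (1 / (1 - y)) powr p" by blast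
    have y: "0 \<le> y" "y < 1" using elim(2) by auto
    have LK: "?L K \<le> K * (1 - y) / 2" using K(2) y by simp
    have up: "(\<Sum>k. exp (?L (real k)) * y ^ k) \<le> 5 / (1 - y) * exp (?L K)"
      by (rule series_le_exp_log_product(2)[OF M y K(1) LK])
    have summ: "summable (\<lambda>k. exp (?L (real k)) * y ^ k)"
      by (rule series_le_exp_log_product(1)[OF M y K(1) LK])
    have "exp (?L (real 0)) * y ^ 0 \<le> (\<Sum>k. exp (?L (real k)) * y ^ k)"
      using sum_le_suminf[OF summ, of "{0}"] y by simp
    then have pos: "0 < (\<Sum>k. exp (?L (real k)) * y ^ k)" by (rule less_le_trans[rotated]) simp
    have "ln (\<Sum>k. exp (?L (real k)) * y ^ k) \<le> ln (5 / (1 - y) * exp (?L K))"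
      using up pos by (intro ln_mono) auto
    also have "\<dots> = ln 5 + ln (1 / (1 - y)) + ?L K"
      using y by (simp add: ln_mult ln_div)
    finally show ?case using K(3) by linarith
  qed
qed

lemma log_series_summable:
  assumes N: "mono N" "\<And>i. real (N i) \<le> C * (real i + 1) powr c" and c: "0 \<le> c" and y: "0 \<le> y" "y < 1"
  shows "summable (\<lambda>k. exp (log_product (multiplicities m N) (real k)) * y ^ k)"
proof -
  let ?L = "log_product (multiplicities m N)"
  have M: "summable (\<lambda>i. real (multiplicities m N i) * exp (- real i))" using N(2) c(1) by (rule summable_multiplicities)
  obtain D where D: "0 \<le> D" "\<And>n. ?L (exp (real n)) \<le> total m N (Suc n) + D * (real n + 1) powr c"
    using log_product_multiplicities_le[OF N c, of m] by blast
  have C: "0 \<le> C" using N(2)[of 0] by (simp add: order_trans[OF of_nat_0_le_iff])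
  have "((\<lambda>n. (real m * ((real n + 1) * (C * (real n + 1) powr c)) + D * (real n + 1) powr c) / exp (real n)) \<longlonglongrightarrow> 0)"
    by real_asymp
  then have "\<forall>\<^sub>F n in sequentially. (real m * ((real n + 1) * (C * (real n + 1) powr c)) + D * (real n + 1) powr c) / exp (real n) < (1 - y) / 2"
    using y by (intro order_tendstoD) auto
  then obtain n where n: "(real m * ((real n + 1) * (C * (real n + 1) powr c)) + D * (real n + 1) powr c) / exp (real n) < (1 - y) / 2"
    using eventually_happens'[OF sequentially_bot] by blast
  have "(\<Sum>i<Suc n. real (N i)) \<le> (\<Sum>i<Suc n. C * (real n + 1) powr c)"
  proof (rule sum_mono)
    fix i assume "i \<in> {..<Suc n}"
    then have "C * (real i + 1) powr c \<le> C * (real n + 1) powr c" using c C by (intro mult_left_mono powr_mono2) auto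
    then show "real (N i) \<le> C * (real n + 1) powr c" using N(2)[of i] by linarith
  qed
  also have "\<dots> = (real n + 1) * (C * (real n + 1) powr c)" by simp
  finally have "total m N (Suc n) \<le> real m * ((real n + 1) * (C * (real n + 1) powr c))"
    by (rule mult_left_mono) simp
  then have "?L (exp (real n)) \<le> real m * ((real n + 1) * (C * (real n + 1) powr c)) + D * (real n + 1) powr c"
    using D(2)[of n] by linarith
  also have "\<dots> \<le> exp (real n) * (1 - y) / 2" using n by (simp add: divide_less_eq mult_ac)
  finally show ?thesis by (intro series_le_exp_log_product(1)[OF M y, of "exp (real n)"]) auto
qed

section \<open>Prescribing the growth\<close>

text \<open>Keeping only the upper half of the summands loses a constant factor, which is harmless when the profile is compared with
  \<open>n powr \<rho>\<close> up to a factor tending to \<open>0\<close> or to infinity.\<close>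
lemma growth_profile_sandwich:
  fixes g :: "real \<Rightarrow> real" and m :: nat
  assumes m: "0 < m" and g0: "\<And>x. 1 \<le> x \<Longrightarrow> 0 \<le> g x" and g: "\<And>x y. 1 \<le> x \<Longrightarrow> x \<le> y \<Longrightarrow> g x \<le> g y"
  defines "N \<equiv> \<lambda>i. Suc (nat \<lfloor>g (real i + 1)\<rfloor>)"
  shows "mono N"
    and "2 \<le> n \<Longrightarrow> real n / 2 * g (real n / 2) \<le> total m N n"
    and "total m N n \<le> real m * (real n * (g (real n) + 1))"
proof -
  have gS: "g (real i + 1) \<le> real (N i)" "real (N i) \<le> g (real i + 1) + 1" for i
    using g0[of "real i + 1"] unfolding N_def by linarith+
  show "mono N"
    unfolding N_def by (intro monoI) (auto intro!: nat_mono floor_mono g)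
  show "real n / 2 * g (real n / 2) \<le> total m N n" if n: "2 \<le> n"
  proof -
    have "real n / 2 * g (real n / 2) \<le> real (n - n div 2) * g (real n / 2)"
      using n by (intro mult_right_mono g0) linarith+
    also have "\<dots> = (\<Sum>i\<in>{n div 2..<n}. g (real n / 2))" by simp
    also have "\<dots> \<le> (\<Sum>i\<in>{n div 2..<n}. real (N i))"
    proof (rule sum_mono)
      fix i assume "i \<in> {n div 2..<n}"
      then have "real n / 2 \<le> real i + 1" by auto
      then have "g (real n / 2) \<le> g (real i + 1)" using n by (intro g) auto
      then show "g (real n / 2) \<le> real (N i)" using gS(1)[of i] by linarith
    qed
    also have "\<dots> \<le> (\<Sum>i<n. real (N i))" by (intro sum_mono2) auto
    also have "\<dots> \<le> total m N n"
      using m mult_right_mono[of 1 "real m" "\<Sum>i<n. real (N i)"] by (simp add: sum_nonneg)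
    finally show ?thesis .
  qed
  have "(\<Sum>i<n. real (N i)) \<le> (\<Sum>i<n. g (real n) + 1)"
  proof (rule sum_mono)
    fix i assume "i \<in> {..<n}"
    then have "g (real i + 1) \<le> g (real n)" by (intro g) auto
    then show "real (N i) \<le> g (real n) + 1" using gS(2)[of i] by linarith
  qed
  then show "total m N n \<le> real m * (real n * (g (real n) + 1))"
    by (intro mult_left_mono) simp_all
qed

text \<open>The counting functions whose totals have order \<open>\<rho>\<close> and, for \<open>\<rho> > 1\<close>, type \<open>\<sigma>\<close> with respect to \<open>n powr \<rho>\<close>.  The condition
  involving \<open>B\<close> demands faster than linear growth; for \<open>\<rho> = 1\<close> it is what makes the singularity essential.\<close>
definition growth_profile :: "nat \<Rightarrow> real \<Rightarrow> ereal \<Rightarrow> (nat \<Rightarrow> nat) \<Rightarrow> bool" where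
  "growth_profile m \<rho> \<sigma> N \<longleftrightarrow> mono N \<and> 1 \<le> N 0 \<and>
     (\<forall>p<\<rho>. \<forall>\<^sub>F n in sequentially. real n powr p \<le> total m N n) \<and>
     (\<forall>p>\<rho>. \<forall>\<^sub>F n in sequentially. total m N n \<le> real n powr p) \<and>
     (\<forall>B. \<forall>\<^sub>F n in sequentially. B * real n \<le> total m N n) \<and>
     (1 < \<rho> \<longrightarrow> (\<lambda>n. ereal (total m N n / real n powr \<rho>)) \<longlonglongrightarrow> \<sigma>)"

lemma growth_profile_squeeze:
  assumes N: "mono N" "1 \<le> N 0"
    and lo: "\<forall>\<^sub>F n in sequentially. l (real n) \<le> total m N n"
    and hi: "\<forall>\<^sub>F n in sequentially. total m N n \<le> h (real n)"
    and lp: "\<And>p. p < \<rho> \<Longrightarrow> \<forall>\<^sub>F n in sequentially. real n powr p \<le> l (real n)"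
    and hp: "\<And>p. \<rho> < p \<Longrightarrow> \<forall>\<^sub>F n in sequentially. h (real n) \<le> real n powr p"
    and lB: "\<And>B. \<forall>\<^sub>F n in sequentially. B * real n \<le> l (real n)"
    and lim: "1 < \<rho> \<Longrightarrow> (\<lambda>n. ereal (total m N n / real n powr \<rho>)) \<longlonglongrightarrow> \<sigma>"
  shows "growth_profile m \<rho> \<sigma> N"
  unfolding growth_profile_def
proof (intro conjI N allI impI lim)
  show "\<forall>\<^sub>F n in sequentially. real n powr p \<le> total m N n" if "p < \<rho>" for p
    using lp[OF that] lo by eventually_elim linarith
  show "\<forall>\<^sub>F n in sequentially. total m N n \<le> real n powr p" if "\<rho> < p" for p
    using hp[OF that] hi by eventually_elim linarith
  show "\<forall>\<^sub>F n in sequentially. B * real n \<le> total m N n" for B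
    using lB[of B] lo by eventually_elim linarith
qed

text \<open>The increments of \<open>\<sigma> n powr \<rho>\<close>, which increase by convexity, are rounded to multiples of \<open>m\<close>; the errors add up to at most
  \<open>m n\<close>, which is of lower order as \<open>\<rho> > 1\<close>.\<close>
lemma growth_profile_finite:
  fixes \<sigma> \<rho> :: real
  assumes m: "0 < m" and \<sigma>: "0 < \<sigma>" and \<rho>: "1 < \<rho>"
  shows "\<exists>N. growth_profile m \<rho> (ereal \<sigma>) N"
proof -
  define d where "d = (\<lambda>i. \<sigma> * (real (Suc i) powr \<rho> - real i powr \<rho>))"
  define N where "N = (\<lambda>i. Suc (nat \<lfloor>d i / real m\<rfloor>))"
  let ?T = "\<lambda>n. total m N n"
  have d0: "0 \<le> d i" for i
    using \<sigma> \<rho> powr_mono2[of \<rho> "real i" "real (Suc i)"] by (simp add: d_def)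
  have d_mono: "d i \<le> d (Suc i)" for i
  proof -
    have "2 * real (Suc i) powr \<rho> \<le> real i powr \<rho> + real (Suc (Suc i)) powr \<rho>"
    proof (cases "i = 0")
      case True
      have "(2::real) powr 1 \<le> 2 powr \<rho>" using \<rho> by (intro powr_mono) auto
      then show ?thesis using True \<rho> by simp
    next
      case False
      have "((1 - 1/2) *\<^sub>R real i + (1/2) *\<^sub>R real (Suc (Suc i))) powr \<rho> \<le> (1 - 1/2) * real i powr \<rho> + (1/2) * real (Suc (Suc i)) powr \<rho>"
        using convex_onD[OF powr_convex[of \<rho>], of "1/2" "real i" "real (Suc (Suc i))"] \<rho> False by simp
      also have "(1 - 1/2) *\<^sub>R real i + (1/2) *\<^sub>R real (Suc (Suc i)) = real (Suc i)" by (simp add: field_simps)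
      finally show ?thesis by simp
    qed
    then show ?thesis using \<sigma> by (simp add: d_def)
  qed
  have "mono N"
  proof (rule incseq_SucI[folded mono_def])
    show "N i \<le> N (Suc i)" for i
      unfolding N_def using d_mono[of i] m by (auto intro!: nat_mono floor_mono divide_right_mono)
  qed
  have sum_d: "(\<Sum>i<n. d i) = \<sigma> * real n powr \<rho>" for n
    using \<rho> by (induction n) (auto simp: d_def algebra_simps)
  have mN: "d i \<le> real m * real (N i)" "real m * real (N i) \<le> d i + real m" for i
  proof -
    have "0 \<le> d i / real m" using d0 m by simp
    then have "d i / real m \<le> real (N i)" "real (N i) \<le> d i / real m + 1"
      by (auto simp: N_def) linarith
    then show "d i \<le> real m * real (N i)" "real m * real (N i) \<le> d i + real m"
      using m by (auto simp: field_simps)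
  qed
  have lo: "\<sigma> * real n powr \<rho> \<le> ?T n" for n
    unfolding sum_d[symmetric] sum_distrib_left by (intro sum_mono mN)
  have hi: "?T n \<le> \<sigma> * real n powr \<rho> + real m * real n" for n
  proof -
    have "?T n \<le> (\<Sum>i<n. d i + real m)" unfolding sum_distrib_left by (intro sum_mono mN)
    then show ?thesis by (simp add: sum.distrib sum_d mult.commute)
  qed
  have "growth_profile m \<rho> (ereal \<sigma>) N"
  proof (rule growth_profile_squeeze[where l = "\<lambda>x. \<sigma> * x powr \<rho>" and h = "\<lambda>x. \<sigma> * x powr \<rho> + real m * x"])
    show "\<forall>\<^sub>F n in sequentially. real n powr p \<le> \<sigma> * real n powr \<rho>" if "p < \<rho>" for p
      using that \<sigma> by real_asymp
    show "\<forall>\<^sub>F n in sequentially. \<sigma> * real n powr \<rho> + real m * real n \<le> real n powr p" if "\<rho> < p" for p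
      using that \<sigma> \<rho> m by real_asymp
    show "\<forall>\<^sub>F n in sequentially. B * real n \<le> \<sigma> * real n powr \<rho>" for B
      using \<sigma> \<rho> by real_asymp
    have "(\<lambda>n. ?T n / real n powr \<rho>) \<longlonglongrightarrow> \<sigma>"
    proof (rule tendsto_sandwich)
      show "\<forall>\<^sub>F n in sequentially. \<sigma> \<le> ?T n / real n powr \<rho>"
        using eventually_gt_at_top[of 0] by eventually_elim (use lo in \<open>auto simp: field_simps\<close>)
      show "\<forall>\<^sub>F n in sequentially. ?T n / real n powr \<rho> \<le> (\<sigma> * real n powr \<rho> + real m * real n) / real n powr \<rho>"
        using hi by (intro always_eventually allI divide_right_mono) auto
      show "(\<lambda>n. (\<sigma> * real n powr \<rho> + real m * real n) / real n powr \<rho>) \<longlonglongrightarrow> \<sigma>"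
        using \<rho> \<sigma> m by real_asymp
    qed simp
    then show "(\<lambda>n. ereal (?T n / real n powr \<rho>)) \<longlonglongrightarrow> ereal \<sigma>" by (rule tendsto_ereal)
  qed (use \<open>mono N\<close> lo hi in \<open>auto simp: N_def\<close>)
  then show ?thesis by blast
qed

text \<open>The total is comparable to \<open>n powr \<rho> * ln n\<close>.\<close>
lemma growth_profile_infinite:
  fixes \<rho> :: real
  assumes m: "0 < m" and \<rho>: "1 \<le> \<rho>"
  shows "\<exists>N. growth_profile m \<rho> \<infinity> N"
proof -
  define g where "g = (\<lambda>x::real. x powr (\<rho> - 1) * (1 + ln x))"
  define N where "N = (\<lambda>i. Suc (nat \<lfloor>g (real i + 1)\<rfloor>))"
  let ?T = "\<lambda>n. total m N n"
  have g0: "0 \<le> g x" if "1 \<le> x" for x using that by (simp add: g_def)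
  have g_mono: "g x \<le> g y" if "1 \<le> x" "x \<le> y" for x y
    unfolding g_def using that \<rho> by (intro mult_mono powr_mono2 add_left_mono ln_mono) auto
  have S1: "mono N" unfolding N_def by (rule growth_profile_sandwich(1)[where g = g, OF m g0 g_mono])
  have S2: "real n / 2 * g (real n / 2) \<le> ?T n" if "2 \<le> n" for n
    unfolding N_def by (rule growth_profile_sandwich(2)[where g = g, OF m g0 g_mono that])
  have S3: "?T n \<le> real m * (real n * (g (real n) + 1))" for n
    unfolding N_def by (rule growth_profile_sandwich(3)[where g = g, OF m g0 g_mono])
  have lo: "\<forall>\<^sub>F n in sequentially. real n / 2 * g (real n / 2) \<le> ?T n"
    using eventually_ge_at_top[of 2] by eventually_elim (rule S2)
  have "growth_profile m \<rho> \<infinity> N"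
  proof (rule growth_profile_squeeze[where l = "\<lambda>x. x / 2 * g (x / 2)" and h = "\<lambda>x. real m * (x * (g x + 1))"])
    show "\<forall>\<^sub>F n in sequentially. real n powr p \<le> real n / 2 * g (real n / 2)" if "p < \<rho>" for p
      unfolding g_def using that by real_asymp
    show "\<forall>\<^sub>F n in sequentially. real m * (real n * (g (real n) + 1)) \<le> real n powr p" if "\<rho> < p" for p
    proof (cases "\<rho> = 1")
      case True
      show ?thesis unfolding g_def True using that True m by real_asymp
    next
      case False
      then have "1 < \<rho>" using \<rho> by simp
      then show ?thesis unfolding g_def using that m by real_asymp
    qed
    show "\<forall>\<^sub>F n in sequentially. B * real n \<le> real n / 2 * g (real n / 2)" for B
    proof (cases "\<rho> = 1")
      case True
      show ?thesis unfolding g_def True by real_asymp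
    next
      case False
      then have "1 < \<rho>" using \<rho> by simp
      then show ?thesis unfolding g_def by real_asymp
    qed
    have "filterlim (\<lambda>n. real n / 2 * g (real n / 2) / real n powr \<rho>) at_top sequentially"
      unfolding g_def using \<rho> by real_asymp
    moreover have "\<forall>\<^sub>F n in sequentially. real n / 2 * g (real n / 2) / real n powr \<rho> \<le> ?T n / real n powr \<rho>"
      using lo by eventually_elim (rule divide_right_mono, simp_all)
    ultimately have "filterlim (\<lambda>n. ?T n / real n powr \<rho>) at_top sequentially"
      by (rule filterlim_at_top_mono)
    then show "(\<lambda>n. ereal (?T n / real n powr \<rho>)) \<longlonglongrightarrow> \<infinity>"
      by (simp add: tendsto_PInfty_eq_at_top)
  qed (use S1 S3 lo in \<open>auto simp: N_def\<close>)
  then show ?thesis by blast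
qed

text \<open>The total is comparable to \<open>n powr \<rho> / ln n\<close>.\<close>
lemma growth_profile_zero:
  fixes \<rho> :: real
  assumes m: "0 < m" and \<rho>: "1 < \<rho>"
  shows "\<exists>N. growth_profile m \<rho> 0 N"
proof -
  \<comment> \<open>Adding this constant to the logarithm makes \<open>g\<close> increasing from \<open>1\<close> on.\<close>
  define \<kappa> where "\<kappa> = 1 / (\<rho> - 1)"
  define g where "g = (\<lambda>x::real. x powr (\<rho> - 1) / (\<kappa> + ln x))"
  define N where "N = (\<lambda>i. Suc (nat \<lfloor>g (real i + 1)\<rfloor>))"
  let ?T = "\<lambda>n. total m N n"
  have \<kappa>: "0 < \<kappa>" using \<rho> by (simp add: \<kappa>_def)
  have g0: "0 \<le> g x" if "1 \<le> x" for x using that \<kappa> by (simp add: g_def)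
  have g_mono: "g x \<le> g y" if "1 \<le> x" "x \<le> y" for x y
  proof -
    define t where "t = ln (y / x)"
    have t: "0 \<le> t" "ln y = ln x + t" using that by (auto simp: t_def ln_div)
    have lx: "0 \<le> ln x" using that by simp
    have "(\<rho> - 1) * \<kappa> = 1" using \<rho> by (simp add: \<kappa>_def)
    moreover have "0 \<le> (\<rho> - 1) * t * ln x" using \<rho> t lx by simp
    moreover have "(1 + (\<rho> - 1) * t) * (\<kappa> + ln x) = \<kappa> + ln x + ((\<rho> - 1) * \<kappa>) * t + (\<rho> - 1) * t * ln x"
      by (simp add: algebra_simps)
    ultimately have "\<kappa> + ln y \<le> (1 + (\<rho> - 1) * t) * (\<kappa> + ln x)"
      unfolding t(2) by simp
    also have "\<dots> \<le> exp ((\<rho> - 1) * t) * (\<kappa> + ln x)"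
      using \<kappa> lx by (intro mult_right_mono exp_ge_add_one_self) auto
    finally have "x powr (\<rho> - 1) * (\<kappa> + ln y) \<le> x powr (\<rho> - 1) * (exp ((\<rho> - 1) * t) * (\<kappa> + ln x))"
      by (rule mult_left_mono) simp
    also have "x powr (\<rho> - 1) * (exp ((\<rho> - 1) * t) * (\<kappa> + ln x)) = y powr (\<rho> - 1) * (\<kappa> + ln x)"
      using that t(2) by (simp add: powr_def exp_add[symmetric] algebra_simps)
    finally show ?thesis
      unfolding g_def using \<kappa> lx t by (simp add: frac_le_eq divide_le_eq pos_le_divide_eq add_pos_nonneg)
  qed
  have S1: "mono N" unfolding N_def by (rule growth_profile_sandwich(1)[where g = g, OF m g0 g_mono])
  have S2: "real n / 2 * g (real n / 2) \<le> ?T n" if "2 \<le> n" for n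
    unfolding N_def by (rule growth_profile_sandwich(2)[where g = g, OF m g0 g_mono that])
  have S3: "?T n \<le> real m * (real n * (g (real n) + 1))" for n
    unfolding N_def by (rule growth_profile_sandwich(3)[where g = g, OF m g0 g_mono])
  have lo: "\<forall>\<^sub>F n in sequentially. real n / 2 * g (real n / 2) \<le> ?T n"
    using eventually_ge_at_top[of 2] by eventually_elim (rule S2)
  have "growth_profile m \<rho> 0 N"
  proof (rule growth_profile_squeeze[where l = "\<lambda>x. x / 2 * g (x / 2)" and h = "\<lambda>x. real m * (x * (g x + 1))"])
    show "\<forall>\<^sub>F n in sequentially. real n powr p \<le> real n / 2 * g (real n / 2)" if "p < \<rho>" for p
      unfolding g_def using that by real_asymp
    show "\<forall>\<^sub>F n in sequentially. real m * (real n * (g (real n) + 1)) \<le> real n powr p" if "\<rho> < p" for p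
      unfolding g_def using that \<rho> m by real_asymp
    show "\<forall>\<^sub>F n in sequentially. B * real n \<le> real n / 2 * g (real n / 2)" for B
      unfolding g_def using \<rho> by real_asymp
    have "(\<lambda>n. ?T n / real n powr \<rho>) \<longlonglongrightarrow> 0"
    proof (rule tendsto_sandwich)
      show "\<forall>\<^sub>F n in sequentially. 0 \<le> ?T n / real n powr \<rho>"
        by (intro always_eventually allI divide_nonneg_nonneg mult_nonneg_nonneg sum_nonneg) auto
      show "\<forall>\<^sub>F n in sequentially. ?T n / real n powr \<rho> \<le> real m * (real n * (g (real n) + 1)) / real n powr \<rho>"
        using S3 by (intro always_eventually allI divide_right_mono) auto
      show "(\<lambda>n. real m * (real n * (g (real n) + 1)) / real n powr \<rho>) \<longlonglongrightarrow> 0"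
        unfolding g_def using \<rho> m by real_asymp
    qed simp
    then show "(\<lambda>n. ereal (?T n / real n powr \<rho>)) \<longlonglongrightarrow> 0"
      unfolding zero_ereal_def by (rule tendsto_ereal)
  qed (use S1 S3 lo in \<open>auto simp: N_def\<close>)
  then show ?thesis by blast
qed

lemma growth_profile_exists:
  assumes "0 < m" "1 \<le> \<rho>" "0 \<le> \<sigma>"
  obtains N where "growth_profile m \<rho> \<sigma> N"
proof (cases "\<rho> = 1")
  case True
  then have "growth_profile m \<rho> \<sigma> N \<longleftrightarrow> growth_profile m \<rho> \<infinity> N" for N by (simp add: growth_profile_def)
  then show ?thesis using growth_profile_infinite[of m \<rho>] assms that by blast
next
  case False
  then have \<rho>: "1 < \<rho>" using assms by simp
  show ?thesis
  proof (cases \<sigma>)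
    case (real s)
    show ?thesis
    proof (cases "s = 0")
      case True
      then show ?thesis using growth_profile_zero[OF assms(1) \<rho>] real that by (auto simp: zero_ereal_def)
    next
      case False
      then have "0 < s" using assms(3) real by simp
      then show ?thesis using growth_profile_finite[OF assms(1) _ \<rho>, of s] real that by auto
    qed
  next
    case PInf
    then show ?thesis using growth_profile_infinite[OF assms(1,2)] that by auto
  next
    case MInf
    then show ?thesis using assms(3) by simp
  qed
qed

text \<open>By monotonicity, \<open>i * N i\<close> is at most the sum of \<open>N\<close> over the indices from \<open>i\<close> to \<open>2 i - 1\<close>, hence at most
  \<open>(2 i) powr (c + 1)\<close> for large \<open>i\<close>.\<close>
lemma growth_profile_power_bound:
  assumes N: "growth_profile m \<rho> \<sigma> N" and m: "0 < m" and c: "\<rho> - 1 < c" "0 \<le> c"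
  obtains C where "\<And>i. real (N i) \<le> C * (real i + 1) powr c"
proof -
  have mono: "mono N" using N by (simp add: growth_profile_def)
  have "\<forall>\<^sub>F n in sequentially. total m N n \<le> real n powr (c + 1)"
    using N c(1) by (simp add: growth_profile_def)
  then obtain n0 where n0: "\<And>n. n0 \<le> n \<Longrightarrow> total m N n \<le> real n powr (c + 1)"
    by (auto simp: eventually_at_top_linorder)
  define C where "C = 2 powr (c + 1) + real (N (Suc n0))"
  show thesis
  proof (rule that)
    fix i
    have one: "1 \<le> (real i + 1) powr c" using c(2) by (intro ge_one_powr_ge_zero) auto
    show "real (N i) \<le> C * (real i + 1) powr c"
    proof (cases "i \<le> Suc n0")
      case True
      then have "real (N i) \<le> real (N (Suc n0))" using mono by (auto simp: mono_def)
      also have "\<dots> \<le> real (N (Suc n0)) * (real i + 1) powr c" using one by (simp add: mult_le_cancel_left1)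
      also have "\<dots> \<le> C * (real i + 1) powr c" by (intro mult_right_mono) (auto simp: C_def)
      finally show ?thesis .
    next
      case False
      then have i: "0 < i" "n0 \<le> 2 * i" by auto
      have "real i * real (N i) = (\<Sum>j\<in>{i..<2 * i}. real (N i))" by simp
      also have "\<dots> \<le> (\<Sum>j\<in>{i..<2 * i}. real (N j))" using mono by (intro sum_mono) (auto simp: mono_def)
      also have "\<dots> \<le> (\<Sum>j<2 * i. real (N j))" by (intro sum_mono2) auto
      also have "\<dots> \<le> real m * (\<Sum>j<2 * i. real (N j))"
        using m mult_right_mono[of 1 "real m" "\<Sum>j<2 * i. real (N j)"] by (simp add: sum_nonneg)
      also have "\<dots> \<le> real (2 * i) powr (c + 1)" using i(2) by (rule n0)
      also have "\<dots> = real i * (2 powr (c + 1) * real i powr c)"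
        using i(1) by (simp add: powr_mult powr_add)
      finally have "real (N i) \<le> 2 powr (c + 1) * real i powr c" using i(1) by simp
      also have "\<dots> \<le> C * (real i + 1) powr c"
        using c(2) by (intro mult_mono powr_mono2) (auto simp: C_def)
      finally show ?thesis .
    qed
  qed
qed

section \<open>Multiply positive functions of prescribed growth\<close>

lemma growth_profile_series_ge:
  fixes \<alpha> \<alpha>' p :: real
  assumes N: "growth_profile m \<rho> \<sigma> N" and m: "0 < m" and \<rho>: "1 \<le> \<rho>"
    and "0 \<le> \<alpha>'" "\<alpha>' < \<alpha>" "0 < p"
    and "\<forall>\<^sub>F n in sequentially. \<alpha> * real n powr p \<le> total m N n"
  shows "\<forall>\<^sub>F y in at_left (1::real). \<alpha>' * ln (1 / (1 - y)) powr p
           \<le> ln (exp_series (multiplicities m N) y)"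
proof -
  have mono: "mono N" using N by (simp add: growth_profile_def)
  have \<rho>0: "0 \<le> \<rho>" using \<rho> by simp
  obtain C where C: "\<And>i. real (N i) \<le> C * (real i + 1) powr \<rho>"
    using growth_profile_power_bound[OF N m, of \<rho>] \<rho>0 by auto
  show ?thesis
    by (rule log_series_ge_eventually[OF mono summable_multiplicities[OF C \<rho>0] log_series_summable[OF mono C \<rho>0] assms(4-7)])
qed

lemma growth_profile_series_le:
  fixes \<beta> \<beta>' p :: real
  assumes N: "growth_profile m \<rho> \<sigma> N" and m: "0 < m" and \<rho>: "1 \<le> \<rho>"
    and \<beta>: "0 \<le> \<beta>" "\<beta> < \<beta>'" and p: "1 < p" "\<rho> \<le> p"
    and ev: "\<forall>\<^sub>F n in sequentially. total m N n \<le> \<beta> * real n powr p"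
  shows "\<forall>\<^sub>F y in at_left (1::real). ln (exp_series (multiplicities m N) y)
           \<le> \<beta>' * ln (1 / (1 - y)) powr p"
proof -
  have mono: "mono N" using N by (simp add: growth_profile_def)
  \<comment> \<open>Any exponent between \<open>\<rho> - 1\<close> and \<open>\<rho>\<close> makes the error in the logarithm of the product negligible.\<close>
  define c where "c = \<rho> - 1 / 2"
  have c: "0 \<le> c" "\<rho> - 1 < c" "c < p" using \<rho> p by (auto simp: c_def)
  obtain C where C: "\<And>i. real (N i) \<le> C * (real i + 1) powr c"
    using growth_profile_power_bound[OF N m c(2,1)] by blast
  show ?thesis by (rule log_series_le_eventually[OF mono C c(1,3) \<beta> p(1) ev])
qed

text \<open>Exponents \<open>p\<close> slightly below and slightly above \<open>\<rho>\<close> trap \<open>ln (A y)\<close> between constant multiples of powers of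
  \<open>ln (1 / (1 - y))\<close>; the constants disappear under the second logarithm.\<close>
lemma growth_profile_loglog_limit:
  assumes N: "growth_profile m \<rho> \<sigma> N" and m: "0 < m" and \<rho>: "1 \<le> \<rho>"
  defines "A \<equiv> \<lambda>y. exp_series (multiplicities m N) y"
  shows "((\<lambda>y. ln (ln (A y)) / ln (ln (1 / (1 - y)))) \<longlongrightarrow> \<rho>) (at_left 1)"
proof (rule order_tendstoI)
  have s: "filterlim (\<lambda>y::real. ln (1 / (1 - y))) at_top (at_left 1)" by real_asymp
  have s_gt: "\<forall>\<^sub>F y in at_left (1::real). 1 < ln (1 / (1 - y))" using s by (simp add: filterlim_at_top_dense)
  fix a assume a: "a < \<rho>"
  obtain p where p: "max a (1 / 2) < p" "p < \<rho>" using dense[of "max a (1 / 2)" \<rho>] a \<rho> by auto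
  have "\<forall>\<^sub>F n in sequentially. 1 * real n powr p \<le> total m N n"
    using N p(2) by (simp add: growth_profile_def)
  then have "\<forall>\<^sub>F y in at_left 1. 1 / 2 * ln (1 / (1 - y)) powr p \<le> ln (A y)"
    unfolding A_def using p by (intro growth_profile_series_ge[OF N m \<rho>, of _ 1]) auto
  moreover have "\<forall>\<^sub>F s::real in at_top. a * ln s < ln (1 / 2) + p * ln s"
    using p by real_asymp
  note eventually_compose_filterlim[OF this s]
  ultimately show "\<forall>\<^sub>F y in at_left 1. a < ln (ln (A y)) / ln (ln (1 / (1 - y)))"
    using s_gt
  proof eventually_elim
    case (elim y)
    let ?s = "ln (1 / (1 - y))"
    have "0 < 1 / 2 * ?s powr p" using elim(3) by simp
    then have "ln (1 / 2 * ?s powr p) \<le> ln (ln (A y))" using elim(1) by (intro ln_mono)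
    moreover have "ln (1 / 2 * ?s powr p) = ln (1 / 2) + p * ln ?s" using elim(3) by (subst ln_mult) (auto simp: ln_powr)
    ultimately have "a * ln ?s < ln (ln (A y))" using elim(2) by linarith
    moreover have "0 < ln ?s" using elim(3) by (rule ln_gt_zero)
    ultimately show ?case by (simp add: pos_less_divide_eq)
  qed
next
  have s: "filterlim (\<lambda>y::real. ln (1 / (1 - y))) at_top (at_left 1)" by real_asymp
  have s_gt: "\<forall>\<^sub>F y in at_left (1::real). 1 < ln (1 / (1 - y))" using s by (simp add: filterlim_at_top_dense)
  fix a assume a: "\<rho> < a"
  obtain p where p: "\<rho> < p" "p < a" using dense a by blast
  have "\<forall>\<^sub>F n in sequentially. total m N n \<le> 1 * real n powr p"
    using N p(1) by (simp add: growth_profile_def)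
  then have "\<forall>\<^sub>F y in at_left 1. ln (A y) \<le> 2 * ln (1 / (1 - y)) powr p"
    unfolding A_def using p \<rho> by (intro growth_profile_series_le[OF N m \<rho>, of 1]) auto
  moreover have "\<forall>\<^sub>F y in at_left 1. 1 * ln (1 / (1 - y)) powr 1 \<le> ln (A y)"
  proof -
    have "\<forall>\<^sub>F n in sequentially. 2 * real n \<le> total m N n"
      using N by (simp add: growth_profile_def)
    then show ?thesis
      unfolding A_def by (intro growth_profile_series_ge[OF N m \<rho>, of _ 2]) auto
  qed
  moreover have "\<forall>\<^sub>F s::real in at_top. ln 2 + p * ln s < a * ln s"
    using p by real_asymp
  note eventually_compose_filterlim[OF this s]
  ultimately show "\<forall>\<^sub>F y in at_left 1. ln (ln (A y)) / ln (ln (1 / (1 - y))) < a"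
    using s_gt
  proof eventually_elim
    case (elim y)
    let ?s = "ln (1 / (1 - y))"
    have "0 < 1 * ?s powr 1" using elim(4) by simp
    then have "0 < ln (A y)" using elim(2) by linarith
    then have "ln (ln (A y)) \<le> ln (2 * ?s powr p)" using elim(1) by (intro ln_mono)
    also have "\<dots> = ln 2 + p * ln ?s" using elim(4) by (subst ln_mult) (auto simp: ln_powr)
    finally have "ln (ln (A y)) < a * ln ?s" using elim(3) by linarith
    moreover have "0 < ln ?s" using elim(4) by (rule ln_gt_zero)
    ultimately show ?case by (simp add: pos_divide_less_eq)
  qed
qed

lemma growth_profile_type_limit:
  assumes N: "growth_profile m \<rho> \<sigma> N" and m: "0 < m" and \<rho>: "1 < \<rho>" and \<sigma>: "0 \<le> \<sigma>"
  defines "A \<equiv> \<lambda>y. exp_series (multiplicities m N) y"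
  shows "((\<lambda>y. ereal (ln (A y) / ln (1 / (1 - y)) powr \<rho>)) \<longlongrightarrow> \<sigma>) (at_left 1)"
proof (rule order_tendstoI)
  have \<rho>1: "1 \<le> \<rho>" using \<rho> by simp
  have lim: "(\<lambda>n. ereal (total m N n / real n powr \<rho>)) \<longlonglongrightarrow> \<sigma>"
    using N \<rho> by (simp add: growth_profile_def)
  have s: "filterlim (\<lambda>y::real. ln (1 / (1 - y))) at_top (at_left 1)" by real_asymp
  have s_gt: "\<forall>\<^sub>F y in at_left (1::real). 1 < ln (1 / (1 - y))" using s by (simp add: filterlim_at_top_dense)
  fix a assume a: "a < \<sigma>"
  show "\<forall>\<^sub>F y in at_left 1. a < ereal (ln (A y) / ln (1 / (1 - y)) powr \<rho>)"
  proof (cases "a < 0")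
    case True
    have "\<forall>\<^sub>F n in sequentially. 1 * real n \<le> total m N n"
      using N unfolding growth_profile_def by blast
    then have "\<forall>\<^sub>F n in sequentially. 1 * real n powr 1 \<le> total m N n" by simp
    then have "\<forall>\<^sub>F y in at_left 1. 0 * ln (1 / (1 - y)) powr 1 \<le> ln (A y)"
      unfolding A_def by (intro growth_profile_series_ge[OF N m \<rho>1, of _ 1]) auto
    then show ?thesis
    proof eventually_elim
      case (elim y)
      then have "0 \<le> ln (A y) / ln (1 / (1 - y)) powr \<rho>" by simp
      then have "0 \<le> ereal (ln (A y) / ln (1 / (1 - y)) powr \<rho>)" by simp
      then show ?case using True by (rule less_le_trans[rotated])
    qed
  next
    case False
    obtain \<alpha> where \<alpha>: "a < ereal \<alpha>" "ereal \<alpha> < \<sigma>" using ereal_dense2[OF a] by blast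
    obtain \<alpha>' where \<alpha>': "a < ereal \<alpha>'" "ereal \<alpha>' < ereal \<alpha>" using ereal_dense2[OF \<alpha>(1)] by blast
    have "0 \<le> a" using False by simp
    then have "0 \<le> ereal \<alpha>'" using less_imp_le[OF \<alpha>'(1)] by (rule order_trans)
    then have \<alpha>0: "0 \<le> \<alpha>'" "\<alpha>' < \<alpha>" using \<alpha>'(2) by simp_all
    have "\<forall>\<^sub>F n in sequentially. ereal \<alpha> < ereal (total m N n / real n powr \<rho>)"
      using lim \<alpha>(2) by (rule order_tendstoD)
    then have "\<forall>\<^sub>F n in sequentially. \<alpha> * real n powr \<rho> \<le> total m N n"
      using eventually_gt_at_top[of 0] by eventually_elim (simp add: pos_less_divide_eq)
    then have "\<forall>\<^sub>F y in at_left 1. \<alpha>' * ln (1 / (1 - y)) powr \<rho> \<le> ln (A y)"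
      unfolding A_def using \<alpha>0 \<rho> by (intro growth_profile_series_ge[OF N m \<rho>1, of _ \<alpha>]) auto
    then show ?thesis
      using s_gt
    proof eventually_elim
      case (elim y)
      then have "\<alpha>' \<le> ln (A y) / ln (1 / (1 - y)) powr \<rho>" by (simp add: pos_le_divide_eq)
      then have "ereal \<alpha>' \<le> ereal (ln (A y) / ln (1 / (1 - y)) powr \<rho>)" by simp
      with \<alpha>'(1) show ?case by (rule less_le_trans)
    qed
  qed
next
  have \<rho>1: "1 \<le> \<rho>" using \<rho> by simp
  have lim: "(\<lambda>n. ereal (total m N n / real n powr \<rho>)) \<longlonglongrightarrow> \<sigma>"
    using N \<rho> by (simp add: growth_profile_def)
  have s: "filterlim (\<lambda>y::real. ln (1 / (1 - y))) at_top (at_left 1)" by real_asymp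
  have s_gt: "\<forall>\<^sub>F y in at_left (1::real). 1 < ln (1 / (1 - y))" using s by (simp add: filterlim_at_top_dense)
  fix a assume a: "\<sigma> < a"
  obtain \<beta>' where \<beta>': "\<sigma> < ereal \<beta>'" "ereal \<beta>' < a" using ereal_dense2[OF a] by blast
  obtain \<beta> where \<beta>: "\<sigma> < ereal \<beta>" "ereal \<beta> < ereal \<beta>'" using ereal_dense2[OF \<beta>'(1)] by blast
  have "0 \<le> ereal \<beta>" using \<sigma> less_imp_le[OF \<beta>(1)] by (rule order_trans)
  then have \<beta>0: "0 \<le> \<beta>" "\<beta> < \<beta>'" using \<beta>(2) by simp_all
  have "\<forall>\<^sub>F n in sequentially. ereal (total m N n / real n powr \<rho>) < ereal \<beta>"
    using lim \<beta>(1) by (rule order_tendstoD)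
  then have "\<forall>\<^sub>F n in sequentially. total m N n \<le> \<beta> * real n powr \<rho>"
    using eventually_gt_at_top[of 0] by eventually_elim (simp add: pos_divide_less_eq)
  then have "\<forall>\<^sub>F y in at_left 1. ln (A y) \<le> \<beta>' * ln (1 / (1 - y)) powr \<rho>"
    unfolding A_def using \<beta>0 \<rho> by (intro growth_profile_series_le[OF N m \<rho>1, of \<beta>]) auto
  then show "\<forall>\<^sub>F y in at_left 1. ereal (ln (A y) / ln (1 / (1 - y)) powr \<rho>) < a"
    using s_gt
  proof eventually_elim
    case (elim y)
    then have "ln (A y) / ln (1 / (1 - y)) powr \<rho> \<le> \<beta>'" by (simp add: pos_divide_le_eq)
    then have "ereal (ln (A y) / ln (1 / (1 - y)) powr \<rho>) \<le> ereal \<beta>'" by simp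
    then show ?case using \<beta>'(2) by (rule le_less_trans)
  qed
qed

lemma growth_profile_superpolynomial:
  assumes N: "growth_profile m \<rho> \<sigma> N" and m: "0 < m" and \<rho>: "1 \<le> \<rho>"
  shows "\<forall>\<^sub>F y in at_left (1::real). (1 / (1 - y)) ^ p \<le> exp_series (multiplicities m N) y"
proof -
  let ?A = "\<lambda>y. exp_series (multiplicities m N) y"
  have mono: "mono N" using N by (simp add: growth_profile_def)
  have \<rho>0: "0 \<le> \<rho>" using \<rho> by simp
  obtain C where C: "\<And>i. real (N i) \<le> C * (real i + 1) powr \<rho>"
    using growth_profile_power_bound[OF N m, of \<rho>] \<rho>0 by auto
  have "\<forall>\<^sub>F n in sequentially. (real p + 1) * real n \<le> total m N n"
    using N unfolding growth_profile_def by blast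
  then have "\<forall>\<^sub>F y in at_left (1::real). real p * ln (1 / (1 - y)) powr 1 \<le> ln (?A y)"
    by (intro growth_profile_series_ge[OF N m \<rho>, of _ "real p + 1"]) auto
  moreover have "\<forall>\<^sub>F y in at_left (1::real). 0 < y \<and> y < 1"
    by (rule eventually_at_leftI[of 0]) auto
  ultimately show ?thesis
  proof eventually_elim
    case (elim y)
    have y: "0 < y" "y < 1" using elim(2) by auto
    have "0 < ?A y"
      using y by (intro suminf_pos log_series_summable[OF mono C \<rho>0]) auto
    moreover have "1 \<le> 1 / (1 - y)" using y by simp
    then have "0 \<le> ln (1 / (1 - y))" by (rule ln_ge_zero)
    then have "ln ((1 / (1 - y)) ^ p) \<le> ln (?A y)"
      using elim(1) y by (simp add: ln_realpow)
    moreover have "0 < (1 / (1 - y)) ^ p" using y by simp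
    ultimately show ?case by (simp only: ln_le_cancel_iff)
  qed
qed

theorem theoremC:
  fixes r :: nat and \<rho>\<^sub>0 :: real and \<sigma>\<^sub>0 :: ereal
  assumes "r \<ge> 2" and "1 \<le> \<rho>\<^sub>0" and "0 \<le> \<sigma>\<^sub>0"
  shows "\<exists>G :: complex \<Rightarrow> complex.
    PF_fun r G \<and>
    G analytic_on (- {1}) \<and> analytic_at_inf G \<and>
    essential_singularity_at G 1 \<and>
    Limsup (at_left 1)
      (\<lambda>y::real. ereal (ln (ln (max_modulus y G)) / ln (ln (1 / (1 - y))))) = ereal \<rho>\<^sub>0 \<and>
    (\<rho>\<^sub>0 > 1 \<longrightarrow>
      Limsup (at_left 1)
        (\<lambda>y::real. ereal (ln (max_modulus y G) / (ln (1 / (1 - y))) powr \<rho>\<^sub>0)) = \<sigma>\<^sub>0)"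
proof (rule PF_seq_exp_log_product[where r = r])
  fix m :: nat
  assume m: "0 < m" and PF: "\<And>M. summable (\<lambda>i. real (M i) * exp (- real i)) \<Longrightarrow> m \<le> M 0 \<Longrightarrow>
      (\<And>i. M i = 0 \<or> m \<le> M i) \<Longrightarrow> PF_seq r (\<lambda>k. exp (log_product M (real k)))"
  obtain N where N: "growth_profile m \<rho>\<^sub>0 \<sigma>\<^sub>0 N"
    using growth_profile_exists[OF m assms(2,3)] .
  let ?M = "multiplicities m N"
  let ?a = "\<lambda>k. exp (log_product ?M (real k))"
  let ?A = "\<lambda>y. \<Sum>k. ?a k * y ^ k"
  have mono: "mono N" "1 \<le> N 0" using N by (simp_all add: growth_profile_def)
  have \<rho>0: "0 \<le> \<rho>\<^sub>0" using assms(2) by simp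
  obtain C where C: "\<And>i. real (N i) \<le> C * (real i + 1) powr \<rho>\<^sub>0"
    using growth_profile_power_bound[OF N m, of \<rho>\<^sub>0] \<rho>0 by auto
  have M: "summable (\<lambda>i. real (?M i) * exp (- real i))" using C \<rho>0 by (rule summable_multiplicities)
  have PF_a: "PF_seq r ?a"
  proof (rule PF[OF M])
    show "m \<le> ?M 0" using mono(2) by (simp add: multiplicities_def)
    have "m * x = 0 \<or> m \<le> m * x" for x by (cases x) auto
    then show "?M i = 0 \<or> m \<le> ?M i" for i unfolding multiplicities_def by blast
  qed
  show ?thesis
  proof (rule PF_fun_with_essential_singularity[OF binomial_positive_exp_log_product[OF M] PF_a
        log_series_summable[OF mono(1) C \<rho>0] growth_profile_superpolynomial[OF N m assms(2)]])
    fix G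
    assume G: "PF_fun r G" "G analytic_on (- {1})" "analytic_at_inf G" "essential_singularity_at G 1"
      and max: "\<And>y. 0 \<le> y \<Longrightarrow> y < 1 \<Longrightarrow> max_modulus y G = ?A y"
    have "\<forall>\<^sub>F y in at_left (1::real). 0 < y \<and> y < 1"
      by (rule eventually_at_leftI[of 0]) auto
    then have max_ev: "\<forall>\<^sub>F y in at_left (1::real). ?A y = max_modulus y G"
      by eventually_elim (simp add: max)
    have "((\<lambda>y. ereal (ln (ln (?A y)) / ln (ln (1 / (1 - y))))) \<longlongrightarrow> ereal \<rho>\<^sub>0) (at_left 1)"
      using growth_profile_loglog_limit[OF N m assms(2)] by (rule tendsto_ereal)
    moreover have "\<forall>\<^sub>F y in at_left (1::real). ereal (ln (ln (?A y)) / ln (ln (1 / (1 - y)))) = ereal (ln (ln (max_modulus y G)) / ln (ln (1 / (1 - y))))"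
      using max_ev by eventually_elim simp
    ultimately have "((\<lambda>y. ereal (ln (ln (max_modulus y G)) / ln (ln (1 / (1 - y))))) \<longlongrightarrow> ereal \<rho>\<^sub>0) (at_left 1)"
      by (rule Lim_transform_eventually)
    then have 1: "Limsup (at_left 1) (\<lambda>y::real. ereal (ln (ln (max_modulus y G)) / ln (ln (1 / (1 - y))))) = ereal \<rho>\<^sub>0"
      by (intro lim_imp_Limsup) (simp_all add: trivial_limit_at_left_real)
    have 2: "Limsup (at_left 1) (\<lambda>y::real. ereal (ln (max_modulus y G) / (ln (1 / (1 - y))) powr \<rho>\<^sub>0)) = \<sigma>\<^sub>0" if \<rho>1: "\<rho>\<^sub>0 > 1"
    proof -
      have "((\<lambda>y. ereal (ln (?A y) / ln (1 / (1 - y)) powr \<rho>\<^sub>0)) \<longlongrightarrow> \<sigma>\<^sub>0) (at_left 1)"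
        by (rule growth_profile_type_limit[OF N m \<rho>1 assms(3)])
      moreover have "\<forall>\<^sub>F y in at_left (1::real). ereal (ln (?A y) / ln (1 / (1 - y)) powr \<rho>\<^sub>0) = ereal (ln (max_modulus y G) / ln (1 / (1 - y)) powr \<rho>\<^sub>0)"
        using max_ev by eventually_elim simp
      ultimately have "((\<lambda>y. ereal (ln (max_modulus y G) / ln (1 / (1 - y)) powr \<rho>\<^sub>0)) \<longlongrightarrow> \<sigma>\<^sub>0) (at_left 1)"
        by (rule Lim_transform_eventually)
      then show ?thesis by (intro lim_imp_Limsup) (simp_all add: trivial_limit_at_left_real)
    qed
    show ?thesis using G 1 2 by blast
  qed
qed

end
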